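(* Let $(X,\sigma_X)$, $(Y,\sigma_Y)$ be one-sided subshifts and $\pi:(X,\sigma_X)\to(Y,\sigma_Y)$ a (one-block) factor map. Let $\alpha>0$ and define $F:Y\to\mathbb R$ by $F(y)=\limsup_{n\to\infty}\frac1n\log|D_n(y)|$ (a bounded Borel function). Then $$\sup_{\mu\in M(X,\sigma_X)}\{h_\mu(\sigma_X)+\alpha h_{\pi\mu}(\sigma_Y)\}=(\alpha+1)\sup_{m\in M(Y,\sigma_Y)}\Big\{h_m(\sigma_Y)+\frac1{\alpha+1}\int F\,dm\Big\}$$ $$=(\alpha+1)\sup_{\mu\in M(X,\sigma_X)}\Big\{h_\mu(\sigma_X)-\frac{\alpha}{\alpha+1}\int F\circ\pi\,d\mu\Big\}.$$ There exists a $\sigma_X$-invariant ergodic Borel probability measure attaining the first supremum. Let $K_\alpha$ be the collection of all measures in $M(X,\sigma_X)$ attaining the first supremum. Then $K_\alpha=M_{-\frac{\alpha}{\alpha+1}F\circ\pi}(X,\sigma_X)$. Moreover $\mu\in K_\alpha$ if and only if (i) $\pi\mu$ is an equilibrium state for $\frac1{\alpha+1}F$ and (ii) $\mu$ is a measure of maximal relative entropy over $\pi\mu$.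
   Context: A (one-sided) subshift $(X,\sigma_X)$ is a closed shift-invariant subset $X\subseteq\{1,\dots,k\}^{\mathbb N}$ with the shift $\sigma_X$. A factor map $\pi$ is a continuous surjection with $\pi\circ\sigma_X=\sigma_Y\circ\pi$; it is one-block if the $i$-th coordinate of $\pi(x)$ depends only on $x_i$. $M(X,\sigma_X)$ is the set of $\sigma_X$-invariant Borel probability measures, $h_\mu$ is entropy, and $\pi\mu$ is the push-forward. For $y\in Y$, $n\in\mathbb N$, $D_n(y)$ is a set consisting of one point from each nonempty set $\pi^{-1}(y)\cap[i_1\cdots i_n]$, where $[i_1\cdots i_n]$ ranges over cylinders of length $n$ in $X$; $|D_n(y)|$ is its cardinality. For a bounded Borel measurable $f:X\to\mathbb R$, an equilibrium state for $f$ is a $\mu\in M(X,\sigma_X)$ attaining $\sup_{\nu\in M(X,\sigma_X)}\{h_\nu(\sigma_X)+\int f\,d\nu\}$; $M_f(X,\sigma_X)$ is the set of these (same on $Y$). A measure $\mu\in M(X,\sigma_X)$ is a measure of maximal relative entropy over $m\in M(Y,\sigma_Y)$ if $\pi\mu=m$ and $h_\mu(\sigma_X)=\sup\{h_{\bar\mu}(\sigma_X):\bar\mu\in M(X,\sigma_X),\ \pi\bar\mu=m\}$. *)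

theory Defs
  imports "HOL-Probability.Probability"
begin

text \<open>Symbols are natural numbers and points are functions \<^typ>\<open>nat \<Rightarrow> nat\<close>, which carry the library's
  product topology (over the discrete topology) and its Borel sets.  Coordinates are counted
  from 0.\<close>

definition shift :: "(nat \<Rightarrow> nat) \<Rightarrow> (nat \<Rightarrow> nat)" where
  "shift x = (\<lambda>i. x (Suc i))"

text \<open>Since the full shift is closed in \<^typ>\<open>nat \<Rightarrow> nat\<close>, closedness may be taken in the whole type.
  Subshifts are nonempty; invariance means \<open>\<sigma>(X) \<subseteq> X\<close>, without surjectivity.\<close>

definition subshift :: "nat \<Rightarrow> (nat \<Rightarrow> nat) set \<Rightarrow> bool" where
  "subshift k X \<longleftrightarrow> X \<noteq> {} \<and> X \<subseteq> {x. \<forall>i. x i \<in> {1..k}} \<and> closed X \<and> shift ` X \<subseteq> X"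

definition factor_map ::
  "(nat \<Rightarrow> nat) set \<Rightarrow> (nat \<Rightarrow> nat) set \<Rightarrow> ((nat \<Rightarrow> nat) \<Rightarrow> (nat \<Rightarrow> nat)) \<Rightarrow> bool" where
  "factor_map X Y p \<longleftrightarrow>
     continuous_on X p \<and> p ` X = Y \<and> (\<forall>x\<in>X. p (shift x) = shift (p x))"

definition one_block :: "(nat \<Rightarrow> nat) set \<Rightarrow> ((nat \<Rightarrow> nat) \<Rightarrow> (nat \<Rightarrow> nat)) \<Rightarrow> bool" where
  "one_block X p \<longleftrightarrow> (\<forall>i. \<forall>x\<in>X. \<forall>x'\<in>X. x i = x' i \<longrightarrow> p x i = p x' i)"

definition borel_on :: "(nat \<Rightarrow> nat) set \<Rightarrow> (nat \<Rightarrow> nat) measure" where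
  "borel_on X = restrict_space borel X"

definition invariant_measures :: "(nat \<Rightarrow> nat) set \<Rightarrow> (nat \<Rightarrow> nat) measure set" where
  "invariant_measures X =
     {M. prob_space M \<and> sets M = sets (borel_on X) \<and> distr M M shift = M}"

definition ergodic :: "(nat \<Rightarrow> nat) measure \<Rightarrow> bool" where
  "ergodic M \<longleftrightarrow>
     (\<forall>A\<in>sets M. shift -` A \<inter> space M = A \<longrightarrow> measure M A = 0 \<or> measure M A = 1)"

definition push ::
  "(nat \<Rightarrow> nat) set \<Rightarrow> ((nat \<Rightarrow> nat) \<Rightarrow> (nat \<Rightarrow> nat)) \<Rightarrow> (nat \<Rightarrow> nat) measure \<Rightarrow> (nat \<Rightarrow> nat) measure"
  where "push Y p M = distr M (borel_on Y) p"

subsection \<open>Kolmogorov--Sinai entropy\<close>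

definition finite_partitions :: "'a measure \<Rightarrow> 'a set set set" where
  "finite_partitions M = {P. finite P \<and> P \<subseteq> sets M \<and> partition_on (space M) P}"

text \<open>The convention \<open>0 log 0 = 0\<close> is automatic in HOL.\<close>

definition partition_entropy :: "'a measure \<Rightarrow> 'a set set \<Rightarrow> real" where
  "partition_entropy M P = - (\<Sum>A\<in>P. measure M A * ln (measure M A))"

text \<open>The join of \<open>P, T\<^sup>-\<^sup>1 P, \<dots>, T\<^sup>-\<^sup>(\<^sup>n\<^sup>-\<^sup>1\<^sup>) P\<close>.\<close>

definition iterated_join :: "'a measure \<Rightarrow> ('a \<Rightarrow> 'a) \<Rightarrow> 'a set set \<Rightarrow> nat \<Rightarrow> 'a set set" where
  "iterated_join M T P n =
     (\<lambda>f. {x \<in> space M. \<forall>i<n. (T ^^ i) x \<in> f i}) ` ({..<n} \<rightarrow>\<^sub>E P) - {{}}"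

text \<open>The limit exists, by subadditivity, whenever \<open>M\<close> is a \<open>T\<close>-invariant probability measure.\<close>

definition entropy_wrt :: "'a measure \<Rightarrow> ('a \<Rightarrow> 'a) \<Rightarrow> 'a set set \<Rightarrow> real" where
  "entropy_wrt M T P = lim (\<lambda>n. partition_entropy M (iterated_join M T P n) / real n)"

definition KS_entropy :: "'a measure \<Rightarrow> ('a \<Rightarrow> 'a) \<Rightarrow> ereal" where
  "KS_entropy M T = (SUP P\<in>finite_partitions M. ereal (entropy_wrt M T P))"

abbreviation h :: "(nat \<Rightarrow> nat) measure \<Rightarrow> ereal" where
  "h M \<equiv> KS_entropy M shift"

subsection \<open>Growth of fibres\<close>

definition cylinder :: "(nat \<Rightarrow> nat) set \<Rightarrow> nat list \<Rightarrow> (nat \<Rightarrow> nat) set" where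
  "cylinder X w = {x \<in> X. \<forall>i<length w. x i = w ! i}"

text \<open>\<open>S\<close> is an admissible choice of the set \<open>D\<^sub>n(y)\<close>.\<close>

definition fibre_selection ::
  "(nat \<Rightarrow> nat) set \<Rightarrow> ((nat \<Rightarrow> nat) \<Rightarrow> (nat \<Rightarrow> nat)) \<Rightarrow> nat \<Rightarrow> (nat \<Rightarrow> nat) \<Rightarrow> (nat \<Rightarrow> nat) set \<Rightarrow> bool"
  where
  "fibre_selection X p n y S \<longleftrightarrow>
     S \<subseteq> {x\<in>X. p x = y} \<and>
     (\<forall>w. length w = n \<and> {x\<in>X. p x = y} \<inter> cylinder X w \<noteq> {} \<longrightarrow>
        (\<exists>!x. x \<in> S \<and> x \<in> cylinder X w))"

text \<open>The upper limit is taken in \<^typ>\<open>ereal\<close>; for admissible \<open>D\<close> and \<open>y \<in> Y\<close> it lies between \<open>0\<close> and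
  \<open>ln k\<close>, because \<open>1 \<le> card (D n y) \<le> k ^ n\<close>, so the conversion to a real loses nothing.\<close>

definition fibre_growth :: "(nat \<Rightarrow> (nat \<Rightarrow> nat) \<Rightarrow> (nat \<Rightarrow> nat) set) \<Rightarrow> (nat \<Rightarrow> nat) \<Rightarrow> real" where
  "fibre_growth D y =
     real_of_ereal (limsup (\<lambda>n. ereal (1 / real n * ln (real (card (D n y))))))"

subsection \<open>Equilibrium states\<close>

definition equilibrium_states ::
  "(nat \<Rightarrow> nat) set \<Rightarrow> ((nat \<Rightarrow> nat) \<Rightarrow> real) \<Rightarrow> (nat \<Rightarrow> nat) measure set" where
  "equilibrium_states X f =
     {M \<in> invariant_measures X.
        h M + ereal (\<integral>x. f x \<partial>M) = (SUP N\<in>invariant_measures X. h N + ereal (\<integral>x. f x \<partial>N))}"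

definition max_relative_entropy ::
  "(nat \<Rightarrow> nat) set \<Rightarrow> (nat \<Rightarrow> nat) set \<Rightarrow> ((nat \<Rightarrow> nat) \<Rightarrow> (nat \<Rightarrow> nat)) \<Rightarrow>
   (nat \<Rightarrow> nat) measure \<Rightarrow> (nat \<Rightarrow> nat) measure \<Rightarrow> bool" where
  "max_relative_entropy X Y p M m \<longleftrightarrow>
     M \<in> invariant_measures X \<and> m \<in> invariant_measures Y \<and> push Y p M = m \<and>
     h M = (SUP N\<in>{N \<in> invariant_measures X. push Y p N = m}. h N)"

definition K_set ::
  "(nat \<Rightarrow> nat) set \<Rightarrow> (nat \<Rightarrow> nat) set \<Rightarrow> ((nat \<Rightarrow> nat) \<Rightarrow> (nat \<Rightarrow> nat)) \<Rightarrow> real \<Rightarrow>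
   (nat \<Rightarrow> nat) measure set" where
  "K_set X Y p \<alpha> =
     {M \<in> invariant_measures X.
        h M + ereal \<alpha> * h (push Y p M) =
        (SUP N\<in>invariant_measures X. h N + ereal \<alpha> * h (push Y p N))}"

end

theory Submission
  imports Defs
begin

text \<open>The key is the relative variational principle
  \<open>sup {h \<mu> | \<pi>\<mu> = m} = h m + \<integral> F dm\<close>, with the supremum attained; all the equalities
  and the description of the maximizers then follow by rearranging.  For the upper bound, the entropy
  of \<open>n\<close>-blocks of \<open>x\<close> given \<open>r\<close>-blocks of \<open>\<pi> x\<close> is at most the mean logarithm of the number of
  \<open>n\<close>-words compatible with such an \<open>r\<close>-block, which by compactness decreases to \<open>log |D\<^sub>n|\<close> as
  \<open>r\<close> grows.  For the lower bound, lift \<open>m\<close> by choosing uniformly among all the \<open>n\<close>-words over an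
  \<open>n\<close>-word of \<open>Y\<close>, average over shifts and pass to a limit measure (Misiurewicz); that this reaches
  \<open>\<integral> F dm\<close> is a maximal ergodic inequality for the subadditive sequence of fibre counts.  Finally
  \<open>h \<mu> + \<alpha> h (\<pi>\<mu>)\<close> is affine and upper semicontinuous in \<open>\<mu>\<close>, so the extreme points of its set
  of maximizers are ergodic.\<close>

section \<open>Entropy of simple functions\<close>

text \<open>The number of words in the fibre over \<open>y\<close> depends on all of
  \<open>y\<close>, while entropy estimates see finitely many letters. So two counts run side by
  side: that of \<open>fibre_words n y\<close>, which defines \<open>F\<close>, and the larger one
  of \<open>fibre_words_over n v\<close>, which prescribes just a block \<open>v\<close> of the
  image. In the upper bound the block may grow at fixed \<open>n\<close>. In the lower bound it may
  not: the uniform lift controls exactly \<open>n\<close> image letters, so it gains the relaxed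
  count with \<open>r = n\<close>. The two are linked by cutting a fibre word into head and tail,
  with the exact count for the head and the relaxed one for the tail; iterated, this bounds the
  exact count by orbit sums of the relaxed one along \<open>shift ^^ q\<close>. Pointwise
  \<open>F\<close> only satisfies \<open>F y \<le> F (shift y)\<close>; invariance holds almost
  everywhere. Limits of measures are taken as pointwise limits of the probabilities of words, from
  which a measure is then built. The entropy \<open>h\<close>, a supremum over all finite
  partitions, is first reduced to the growth of prefix entropies by the generator theorem.\<close>

lemma log_sum_inequality:
  fixes a b :: "'i \<Rightarrow> real"
  assumes fin: "finite I" and a: "\<And>i. i \<in> I \<Longrightarrow> 0 \<le> a i" and b: "\<And>i. i \<in> I \<Longrightarrow> 0 \<le> b i"
    and ab: "\<And>i. i \<in> I \<Longrightarrow> b i = 0 \<Longrightarrow> a i = 0"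
  shows "(\<Sum>i\<in>I. a i * (ln (b i) - ln (a i))) \<le> sum a I * (ln (sum b I) - ln (sum a I))"
proof (cases "sum a I = 0")
  case True
  then have "\<forall>i\<in>I. a i = 0" using sum_nonneg_eq_0_iff[OF fin, of a] a by auto
  then show ?thesis using True by simp
next
  case False
  define A where "A = sum a I"
  define B where "B = sum b I"
  have A: "A > 0" using False a sum_nonneg[of I a] unfolding A_def by fastforce
  obtain j where j: "j \<in> I" "a j \<noteq> 0" using False by (meson sum.neutral)
  then have bj: "b j > 0" using ab[of j] b[of j] by fastforce
  have "b j \<le> B" unfolding B_def using j fin b by (intro member_le_sum) auto
  then have B: "B > 0" using bj by simp
  \<comment> \<open>The tangent of \<open>ln\<close> at \<open>1\<close>, taken at the ratio of the
    normalised weights \<open>b i / B\<close> and \<open>a i / A\<close>. The corrections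
    \<open>b i * A / B - a i\<close> cancel in the sum.\<close>
  have bound: "a i * (ln (b i) - ln (a i)) \<le> a i * (ln B - ln A) + (b i * A / B - a i)"
    if i: "i \<in> I" for i
  proof (cases "a i = 0")
    case True
    then show ?thesis using A B b[OF i] by simp
  next
    case False
    then have ai: "a i > 0" using a[OF i] by simp
    then have bi: "b i > 0" using ab[OF i] b[OF i] by fastforce
    have "ln (b i * A / (a i * B)) \<le> b i * A / (a i * B) - 1"
      using ai bi A B by (intro ln_le_minus_one) simp
    moreover have "ln (b i * A / (a i * B)) = ln (b i) + ln A - ln (a i) - ln B"
      using ai bi A B by (simp add: ln_div ln_mult)
    ultimately have "a i * (ln (b i) + ln A - ln (a i) - ln B) \<le> a i * (b i * A / (a i * B) - 1)"
      using ai by (simp add: mult_left_mono)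
    also have "\<dots> = b i * A / B - a i" using ai B by (simp add: field_simps)
    finally show ?thesis by (simp add: algebra_simps)
  qed
  have "(\<Sum>i\<in>I. a i * (ln (b i) - ln (a i))) \<le> (\<Sum>i\<in>I. a i * (ln B - ln A) + (b i * A / B - a i))"
    by (intro sum_mono bound)
  also have "\<dots> = A * (ln B - ln A) + (B * A / B - A)"
    by (simp add: sum.distrib sum_subtractf sum_distrib_right sum_divide_distrib A_def B_def)
  finally show ?thesis using B by (simp add: A_def B_def)
qed

section \<open>Distribution, entropy and conditional entropy of finite-valued functions\<close>

definition pr :: "'a measure \<Rightarrow> ('a \<Rightarrow> 'b) \<Rightarrow> 'b \<Rightarrow> real" where
  "pr M f v = measure M (f -` {v} \<inter> space M)"

text \<open>Shannon entropy of the partition into the level sets of \<open>f\<close>. With functions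
  in place of partitions, a join becomes a pair and a coarser partition becomes a
  composition.\<close>

definition ent :: "'a measure \<Rightarrow> ('a \<Rightarrow> 'b) \<Rightarrow> real" where
  "ent M f = (\<Sum>v\<in>f ` space M. - (pr M f v * ln (pr M f v)))"

text \<open>The conditional entropy \<open>H(f | g)\<close>, introduced through the chain
  rule.\<close>

definition cent :: "'a measure \<Rightarrow> ('a \<Rightarrow> 'b) \<Rightarrow> ('a \<Rightarrow> 'c) \<Rightarrow> real" where
  "cent M f g = ent M (\<lambda>x. (f x, g x)) - ent M g"

lemma pr_nonneg [simp]: "0 \<le> pr M f v"
  by (simp add: pr_def)

lemma pr_outside: "v \<notin> f ` space M \<Longrightarrow> pr M f v = 0"
proof -
  assume "v \<notin> f ` space M"
  then have "f -` {v} \<inter> space M = {}" by auto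
  then show ?thesis by (simp add: pr_def)
qed

lemma ent_superset:
  assumes "finite S" "f ` space M \<subseteq> S"
  shows "ent M f = (\<Sum>v\<in>S. - (pr M f v * ln (pr M f v)))"
  unfolding ent_def using assms by (intro sum.mono_neutral_left) (auto simp: pr_outside)

lemma pr_cong: "(\<And>x. x \<in> space M \<Longrightarrow> f x = g x) \<Longrightarrow> pr M f v = pr M g v"
  unfolding pr_def by (intro arg_cong[where f = "measure M"]) auto

lemma ent_cong: "(\<And>x. x \<in> space M \<Longrightarrow> f x = g x) \<Longrightarrow> ent M f = ent M g"
  unfolding ent_def by (intro sum.cong image_cong) (simp_all add: pr_cong[of M f g])

context finite_measure
begin

lemma pr_comp_sum:
  assumes f: "simple_function M f"
  shows "pr M (\<lambda>x. k (f x)) v = (\<Sum>u\<in>{u \<in> f ` space M. k u = v}. pr M f u)"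
proof -
  have eq: "(\<lambda>x. k (f x)) -` {v} \<inter> space M
      = (\<Union>u\<in>{u \<in> f ` space M. k u = v}. f -` {u} \<inter> space M)" by auto
  show ?thesis unfolding pr_def eq
    using f by (intro finite_measure_finite_Union)
      (auto simp: simple_function_def disjoint_family_on_def)
qed

lemma pr_comp_ge:
  assumes f: "simple_function M f"
  shows "pr M f u \<le> pr M (\<lambda>x. k (f x)) (k u)"
proof (cases "u \<in> f ` space M")
  case True
  then show ?thesis unfolding pr_comp_sum[OF f]
    using f by (intro member_le_sum) (auto simp: simple_function_def)
qed (simp add: pr_outside)

text \<open>Grouping the values \<open>u\<close> of \<open>f\<close> by \<open>k u\<close> exhibits
  the lost entropy as the mean of minus the logarithm of the conditional probability of
  \<open>f\<close> given \<open>k \<circ> f\<close>. The choice \<open>k = snd\<close> gives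
  conditional entropy, and \<open>k = butlast\<close> the entropy of the last letter of a word given
  the earlier ones.\<close>

lemma ent_diff_formula:
  assumes f: "simple_function M f"
  shows "ent M f - ent M (\<lambda>x. k (f x))
    = (\<Sum>u\<in>f ` space M. pr M f u * (ln (pr M (\<lambda>x. k (f x)) (k u)) - ln (pr M f u)))"
proof -
  let ?g = "\<lambda>x. k (f x)"
  have fin: "finite (f ` space M)" using f by (simp add: simple_function_def)
  have "ent M ?g = (\<Sum>v\<in>k ` f ` space M. - (pr M ?g v * ln (pr M ?g v)))"
    by (simp add: ent_def image_image)
  also have "\<dots> = (\<Sum>v\<in>k ` f ` space M. \<Sum>u\<in>{u \<in> f ` space M. k u = v}.
      - (pr M f u * ln (pr M ?g (k u))))"
  proof (rule sum.cong[OF refl])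
    fix v
    have "- (pr M ?g v * ln (pr M ?g v))
        = - ((\<Sum>u\<in>{u \<in> f ` space M. k u = v}. pr M f u) * ln (pr M ?g v))"
      by (subst (1) pr_comp_sum[OF f]) simp
    then show "- (pr M ?g v * ln (pr M ?g v)) = (\<Sum>u\<in>{u \<in> f ` space M. k u = v}.
      - (pr M f u * ln (pr M ?g (k u))))"
      by (simp add: sum_distrib_right sum_negf)
  qed
  also have "\<dots> = (\<Sum>u\<in>f ` space M. - (pr M f u * ln (pr M ?g (k u))))"
    by (rule sum.image_gen[OF fin, symmetric])
  finally show ?thesis
    by (simp add: ent_def sum_subtractf[symmetric] sum_negf algebra_simps)
qed

lemma ent_comp_le:
  assumes f: "simple_function M f"
  shows "ent M (\<lambda>x. k (f x)) \<le> ent M f"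
proof -
  have "0 \<le> pr M f u * (ln (pr M (\<lambda>x. k (f x)) (k u)) - ln (pr M f u))" for u
  proof (cases "pr M f u = 0")
    case False
    then have "0 < pr M f u" using pr_nonneg[of M f u] by linarith
    then show ?thesis using pr_comp_ge[OF f, of u k] by simp
  qed simp
  then have "0 \<le> ent M f - ent M (\<lambda>x. k (f x))"
    unfolding ent_diff_formula[OF f] by (intro sum_nonneg)
  then show ?thesis by simp
qed

lemma ent_eq_if_determined:
  assumes f: "simple_function M f" and g: "simple_function M g"
    and "\<And>x. x \<in> space M \<Longrightarrow> g x = k (f x)" "\<And>x. x \<in> space M \<Longrightarrow> f x = l (g x)"
  shows "ent M f = ent M g"
proof (rule antisym)
  show "ent M g \<le> ent M f"
    using ent_comp_le[OF f, of k] by (subst ent_cong[of M g "\<lambda>x. k (f x)"]) (simp_all add: assms(3))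
  show "ent M f \<le> ent M g"
    using ent_comp_le[OF g, of l] by (subst ent_cong[of M f "\<lambda>x. l (g x)"]) (simp_all add: assms(4))
qed

lemma ent_le_if_determined:
  assumes f: "simple_function M f" and "\<And>x. x \<in> space M \<Longrightarrow> g x = k (f x)"
  shows "ent M g \<le> ent M f"
  using ent_comp_le[OF f, of k] by (subst ent_cong[of M g "\<lambda>x. k (f x)"]) (simp_all add: assms(2))

lemma cent_formula:
  assumes f: "simple_function M f" and g: "simple_function M g"
  shows "cent M f g = (\<Sum>z\<in>(\<lambda>x. (f x, g x)) ` space M.
    pr M (\<lambda>x. (f x, g x)) z * (ln (pr M g (snd z)) - ln (pr M (\<lambda>x. (f x, g x)) z)))"
  using ent_diff_formula[OF simple_function_Pair[OF f g], of snd] by (simp add: cent_def)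

text \<open>For a fixed value of \<open>(f x, k (g x))\<close> the log sum inequality merges the
  finer values of \<open>g\<close>, and the probabilities of those that occur add up to at most the
  probability of the value of \<open>k (g x)\<close>.\<close>

lemma cent_antimono:
  assumes f: "simple_function M f" and g: "simple_function M g"
  shows "cent M f g \<le> cent M f (\<lambda>x. k (g x))"
proof -
  let ?P = "\<lambda>x. (f x, g x)" and ?Q = "\<lambda>x. (f x, k (g x))" and ?r = "\<lambda>z. (fst z, k (snd z))"
  have P: "simple_function M ?P" by (rule simple_function_Pair[OF f g])
  have kg: "simple_function M (\<lambda>x. k (g x))" using simple_function_compose[OF g, of k] by (simp add: comp_def)
  have fin: "finite (?P ` space M)" "finite (g ` space M)"
    using P g by (auto simp: simple_function_def)
  have prQ: "pr M ?Q v = (\<Sum>z\<in>{z \<in> ?P ` space M. ?r z = v}. pr M ?P z)" for v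
    using pr_comp_sum[OF P, of ?r v] by simp
  have "cent M f g = (\<Sum>v\<in>?r ` ?P ` space M. \<Sum>z\<in>{z \<in> ?P ` space M. ?r z = v}.
      pr M ?P z * (ln (pr M g (snd z)) - ln (pr M ?P z)))"
    unfolding cent_formula[OF f g] by (rule sum.image_gen[OF fin(1)])
  also have "\<dots> \<le> (\<Sum>v\<in>?r ` ?P ` space M.
      pr M ?Q v * (ln (pr M (\<lambda>x. k (g x)) (snd v)) - ln (pr M ?Q v)))"
  proof (rule sum_mono)
    fix v
    let ?I = "{z \<in> ?P ` space M. ?r z = v}"
    have le: "pr M ?P z \<le> pr M g (snd z)" for z using pr_comp_ge[OF P, of z snd] by simp
    have zero: "pr M ?P z = 0" if "pr M g (snd z) = 0" for z
      using le[of z] that pr_nonneg[of M ?P z] by linarith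
    have "(\<Sum>z\<in>?I. pr M ?P z * (ln (pr M g (snd z)) - ln (pr M ?P z)))
        \<le> pr M ?Q v * (ln (\<Sum>z\<in>?I. pr M g (snd z)) - ln (pr M ?Q v))"
      unfolding prQ using fin zero by (intro log_sum_inequality) auto
    also have "\<dots> \<le> pr M ?Q v * (ln (pr M (\<lambda>x. k (g x)) (snd v)) - ln (pr M ?Q v))"
    proof (cases "pr M ?Q v = 0")
      case False
      then have pos: "0 < pr M ?Q v" using pr_nonneg[of M ?Q v] by linarith
      have 1: "pr M ?Q v \<le> (\<Sum>z\<in>?I. pr M g (snd z))" unfolding prQ by (intro sum_mono le)
      \<comment> \<open>On \<open>?I\<close> the first component is fixed, so \<open>snd\<close> is
        injective there.\<close>
      have "(\<Sum>z\<in>?I. pr M g (snd z)) = (\<Sum>u\<in>snd ` ?I. pr M g u)"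
        by (rule sum.reindex_cong[symmetric, where l = snd]) (auto simp: inj_on_def prod_eq_iff)
      also have "\<dots> \<le> pr M (\<lambda>x. k (g x)) (snd v)"
        unfolding pr_comp_sum[OF g] using fin by (intro sum_mono2) auto
      finally show ?thesis using pos 1 by (intro mult_left_mono) auto
    qed simp
    finally show "(\<Sum>z\<in>?I. pr M ?P z * (ln (pr M g (snd z)) - ln (pr M ?P z)))
        \<le> pr M ?Q v * (ln (pr M (\<lambda>x. k (g x)) (snd v)) - ln (pr M ?Q v))" .
  qed
  also have "?r ` ?P ` space M = ?Q ` space M" by (simp add: image_image)
  finally show ?thesis by (subst cent_formula[OF f kg])
qed

lemma cent_antimono':
  assumes f: "simple_function M f" and g: "simple_function M g"
    and "\<And>x. x \<in> space M \<Longrightarrow> g' x = k (g x)"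
  shows "cent M f g \<le> cent M f g'"
proof -
  have "cent M f (\<lambda>x. k (g x)) = cent M f g'"
    unfolding cent_def using assms(3)
    by (intro arg_cong2[where f = "(-)"] ent_cong) auto
  then show ?thesis using cent_antimono[OF f g, of k] by simp
qed

lemma cent_Pair_le:
  assumes f: "simple_function M f" and f': "simple_function M f'" and g: "simple_function M g"
  shows "cent M (\<lambda>x. (f x, f' x)) g \<le> cent M f g + cent M f' g"
proof -
  have S: "simple_function M (\<lambda>x. (f' x, g x))" "simple_function M (\<lambda>x. ((f x, f' x), g x))"
    "simple_function M (\<lambda>x. (f x, f' x, g x))"
    using f f' g by (auto intro!: simple_function_Pair)
  have "ent M (\<lambda>x. ((f x, f' x), g x)) = ent M (\<lambda>x. (f x, f' x, g x))"
    by (rule ent_eq_if_determined[OF S(2,3), of "\<lambda>((a, b), c). (a, b, c)" "\<lambda>(a, b, c). ((a, b), c)"]) auto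
  then have "cent M (\<lambda>x. (f x, f' x)) g = cent M f (\<lambda>x. (f' x, g x)) + cent M f' g"
    unfolding cent_def by linarith
  also have "cent M f (\<lambda>x. (f' x, g x)) \<le> cent M f g"
    using cent_antimono[OF f S(1), of snd] by simp
  finally show ?thesis by simp
qed

text \<open>Over a value \<open>v\<close> of \<open>g\<close> the function \<open>f\<close> takes at
  most \<open>card (R v)\<close> values, and the log sum inequality with constant second weights is
  Jensen's bound by the logarithm of their number. The sets \<open>R v\<close> may overcount; later
  they consist of the words compatible with a block of the image.\<close>

lemma cent_le_card:
  assumes f: "simple_function M f" and g: "simple_function M g"
    and R: "\<And>v. v \<in> g ` space M \<Longrightarrow> finite (R v)"
    and fR: "\<And>x. x \<in> space M \<Longrightarrow> f x \<in> R (g x)"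
  shows "cent M f g \<le> (\<Sum>v\<in>g ` space M. pr M g v * ln (real (card (R v))))"
proof -
  let ?P = "\<lambda>x. (f x, g x)"
  have P: "simple_function M ?P" by (rule simple_function_Pair[OF f g])
  have fin: "finite (?P ` space M)" using P by (auto simp: simple_function_def)
  have "cent M f g = (\<Sum>v\<in>snd ` ?P ` space M. \<Sum>z\<in>{z \<in> ?P ` space M. snd z = v}.
      pr M ?P z * (ln (pr M g (snd z)) - ln (pr M ?P z)))"
    unfolding cent_formula[OF f g] by (rule sum.image_gen[OF fin])
  also have "snd ` ?P ` space M = g ` space M" by (simp add: image_image)
  also have "(\<Sum>v\<in>g ` space M. \<Sum>z\<in>{z \<in> ?P ` space M. snd z = v}.
      pr M ?P z * (ln (pr M g (snd z)) - ln (pr M ?P z))) \<le> (\<Sum>v\<in>g ` space M. pr M g v * ln (real (card (R v))))"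
  proof (rule sum_mono)
    fix v assume v: "v \<in> g ` space M"
    let ?I = "{z \<in> ?P ` space M. snd z = v}"
    have prg: "pr M g v = (\<Sum>z\<in>?I. pr M ?P z)" using pr_comp_sum[OF P, of snd v] by simp
    have fI: "finite ?I" using fin by simp
    have I0: "?I \<noteq> {}" using v by auto
    have "card ?I = card (fst ` ?I)"
      by (rule card_image[symmetric]) (auto simp: inj_on_def prod_eq_iff)
    also have "\<dots> \<le> card (R v)" using R[OF v] fR by (intro card_mono) auto
    finally have cI: "card ?I \<le> card (R v)" .
    have c0: "0 < card ?I" using fI I0 by (simp add: card_gt_0_iff)
    have "(\<Sum>z\<in>?I. pr M ?P z * (ln (pr M g (snd z)) - ln (pr M ?P z)))
        = (\<Sum>z\<in>?I. pr M ?P z * (ln (pr M g v) - ln (pr M ?P z)))" by (rule sum.cong) auto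
    also have "\<dots> \<le> pr M g v * (ln (\<Sum>z\<in>?I. pr M g v) - ln (pr M g v))"
    proof -
      have "pr M ?P z = 0" if "z \<in> ?I" "pr M g v = 0" for z
      proof -
        have "pr M ?P z \<le> 0" using pr_comp_ge[OF P, of z snd] that by simp
        then show ?thesis by (intro antisym) auto
      qed
      then show ?thesis using log_sum_inequality[OF fI, of "pr M ?P" "\<lambda>_. pr M g v"]
        unfolding prg[symmetric] by auto
    qed
    also have "\<dots> \<le> pr M g v * ln (real (card (R v)))"
    proof (cases "pr M g v = 0")
      case False
      then have pos: "0 < pr M g v" using pr_nonneg[of M g v] by linarith
      have "ln (\<Sum>z\<in>?I. pr M g v) = ln (real (card ?I)) + ln (pr M g v)"
        using pos c0 by (simp add: ln_mult)
      moreover have "ln (real (card ?I)) \<le> ln (real (card (R v)))" using cI c0 by simp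
      ultimately show ?thesis using pos by simp
    qed simp
    finally show "(\<Sum>z\<in>?I. pr M ?P z * (ln (pr M g (snd z)) - ln (pr M ?P z)))
      \<le> pr M g v * ln (real (card (R v)))" .
  qed
  finally show ?thesis .
qed

end

lemma (in prob_space) pr_le_1: "pr M f v \<le> 1"
  by (simp add: pr_def)

lemma (in prob_space) ent_nonneg: "0 \<le> ent M f"
proof -
  have "0 \<le> - (pr M f v * ln (pr M f v))" for v
  proof (cases "pr M f v = 0")
    case False
    then have "0 < pr M f v" using pr_nonneg[of M f v] by linarith
    then show ?thesis using pr_le_1[of f v] by (simp add: mult_le_0_iff)
  qed simp
  then show ?thesis unfolding ent_def by (intro sum_nonneg)
qed

lemma (in prob_space) ent_const [simp]: "ent M (\<lambda>_. c) = 0"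
proof -
  have "(\<lambda>_. c) ` space M = {c}" using not_empty by auto
  moreover have "pr M (\<lambda>_. c) c = 1" by (simp add: pr_def prob_space)
  ultimately show ?thesis by (simp add: ent_def)
qed

lemma (in prob_space) ent_eq_cent_const:
  assumes f: "simple_function M f"
  shows "ent M f = cent M f (\<lambda>_. ())"
proof -
  have "ent M (\<lambda>x. (f x, ())) = ent M f"
    by (rule ent_eq_if_determined[OF simple_function_Pair[OF f simple_function_const] f,
        where k = fst and l = "\<lambda>a. (a, ())"]) auto
  then show ?thesis by (simp add: cent_def)
qed

lemma (in prob_space) ent_Pair_le:
  assumes f: "simple_function M f" and g: "simple_function M g"
  shows "ent M (\<lambda>x. (f x, g x)) \<le> ent M f + ent M g"
proof -
  have "cent M f g \<le> cent M f (\<lambda>x. ())" using cent_antimono[OF f g, of "\<lambda>_. ()"] .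
  then show ?thesis using ent_eq_cent_const[OF f] by (simp add: cent_def)
qed

lemma (in prob_space) ent_le_card:
  assumes f: "simple_function M f" and R: "finite R" "f ` space M \<subseteq> R"
  shows "ent M f \<le> ln (real (card R))"
proof -
  have *: "(\<lambda>_. ()) ` space M = {()}" using not_empty by auto
  have "pr M (\<lambda>_. ()) () = 1" by (simp add: pr_def prob_space)
  moreover have "cent M f (\<lambda>_. ()) \<le> (\<Sum>v\<in>(\<lambda>_. ()) ` space M. pr M (\<lambda>_. ()) v * ln (real (card R)))"
    using R by (intro cent_le_card[OF f simple_function_const]) auto
  ultimately show ?thesis unfolding * ent_eq_cent_const[OF f] by simp
qed

section \<open>Entropy of measure-preserving maps\<close>

lemma subadditive_mult_le:
  fixes a :: "nat \<Rightarrow> real"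
  assumes sub: "\<And>m n. a (m + n) \<le> a m + a n"
  shows "a (t * q + s) \<le> real t * a q + a s"
proof (induction t)
  case (Suc t)
  have "a (Suc t * q + s) \<le> a q + a (t * q + s)" using sub[of q "t * q + s"] by (simp add: algebra_simps)
  then show ?case using Suc by (simp add: algebra_simps)
qed simp

lemma fekete:
  fixes a :: "nat \<Rightarrow> real"
  assumes sub: "\<And>m n. a (m + n) \<le> a m + a n" and nonneg: "\<And>n. 0 \<le> a n"
  shows "(\<lambda>n. a n / real n) \<longlonglongrightarrow> (INF n\<in>{1..}. a n / real n)"
proof -
  let ?L = "INF n\<in>{1..}. a n / real n"
  have bdd: "bdd_below ((\<lambda>n. a n / real n) ` {1..})"
    using nonneg by (intro bdd_belowI2[where m = 0]) auto
  show ?thesis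
  proof (rule LIMSEQ_I)
    fix e :: real assume e: "0 < e"
    have "\<exists>q\<in>{1..}. a q / real q < ?L + e / 2"
      by (rule cINF_less_iff[THEN iffD1, OF _ bdd]) (use e in auto)
    then obtain q where q: "q \<ge> 1" "a q / real q < ?L + e / 2" by auto
    \<comment> \<open>Bounds every remainder term \<open>a (n mod q)\<close> at once, so that it
      disappears after division by \<open>n\<close>.\<close>
    define C where "C = (\<Sum>s<q. a s)"
    have C0: "0 \<le> C" unfolding C_def using nonneg by (intro sum_nonneg) auto
    obtain N :: nat where N: "C / (e / 2) < real N" using reals_Archimedean2 by blast
    show "\<exists>no. \<forall>n\<ge>no. norm (a n / real n - ?L) < e"
    proof (intro exI allI impI)
      fix n assume n: "max N 1 \<le> n"
      then have n1: "n \<ge> 1" by simp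
      have low: "?L \<le> a n / real n" using n1 by (intro cINF_lower[OF bdd]) auto
      have "a n \<le> real (n div q) * a q + a (n mod q)"
        using subadditive_mult_le[OF sub, of "n div q" q "n mod q"] by simp
      also have "a (n mod q) \<le> C"
        unfolding C_def using q nonneg by (intro member_le_sum) auto
      also have "real (n div q) * a q \<le> (real n / real q) * a q"
        using nonneg by (intro mult_right_mono) (simp_all add: of_nat_div_le_of_nat)
      finally have "a n \<le> real n * (a q / real q) + C" by simp
      then have "a n / real n \<le> a q / real q + C / real n" using n1 by (simp add: field_simps)
      also have "C / real n < e / 2"
      proof -
        have "C / (e / 2) < real n" using N n by (meson less_le_trans of_nat_mono max.bounded_iff)
        then show ?thesis using e n1 by (simp add: field_simps)
      qed
      finally have "a n / real n < ?L + e" using q(2) by simp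
      then show "norm (a n / real n - ?L) < e" using low e by simp
    qed
  qed
qed

lemma fekete_lower:
  fixes a :: "nat \<Rightarrow> real"
  assumes nonneg: "\<And>n. 0 \<le> a n" and n: "n \<ge> 1"
  shows "(INF n\<in>{1..}. a n / real n) \<le> a n / real n"
  using n nonneg by (intro cINF_lower bdd_belowI2[where m = 0]) auto

section \<open>Itineraries and the transport of entropy along measurable maps\<close>

definition itinerary :: "('a \<Rightarrow> 'a) \<Rightarrow> ('a \<Rightarrow> 'b) \<Rightarrow> nat \<Rightarrow> 'a \<Rightarrow> 'b list" where
  "itinerary T f n x = map (\<lambda>i. f ((T ^^ i) x)) [0..<n]"

lemma length_itinerary [simp]: "length (itinerary T f n x) = n"
  by (simp add: itinerary_def)

lemma nth_itinerary [simp]: "i < n \<Longrightarrow> itinerary T f n x ! i = f ((T ^^ i) x)"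
  by (simp add: itinerary_def)

lemma itinerary_0 [simp]: "itinerary T f 0 x = []"
  by (simp add: itinerary_def)

lemma itinerary_Suc: "itinerary T f (Suc n) x = itinerary T f n x @ [f ((T ^^ n) x)]"
  by (simp add: itinerary_def)

lemma take_itinerary: "m \<le> n \<Longrightarrow> take m (itinerary T f n x) = itinerary T f m x"
  by (auto intro!: nth_equalityI)

lemma drop_itinerary: "drop m (itinerary T f n x) = itinerary T f (n - m) ((T ^^ m) x)"
  by (auto intro!: nth_equalityI simp: funpow_add[THEN fun_cong, symmetric, simplified] add.commute)

lemma itinerary_eq_iff:
  "itinerary T f n x = itinerary T f n y \<longleftrightarrow> (\<forall>i<n. f ((T ^^ i) x) = f ((T ^^ i) y))"
  by (simp add: list_eq_iff_nth_eq)

lemma simple_function_sets: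
  assumes f: "simple_function M f"
  shows "f -` S \<inter> space M \<in> sets M"
proof -
  have "f -` S \<inter> space M = (\<Union>v\<in>S \<inter> f ` space M. f -` {v} \<inter> space M)" by auto
  also have "\<dots> \<in> sets M"
    using f by (intro sets.finite_UN) (auto simp: simple_function_def)
  finally show ?thesis .
qed

lemma simple_function_comp_measurable:
  assumes f: "simple_function N f" and g: "g \<in> measurable M N"
  shows "simple_function M (\<lambda>x. f (g x))"
  unfolding simple_function_def
proof (intro conjI ballI)
  have "(\<lambda>x. f (g x)) ` space M \<subseteq> f ` space N" using measurable_space[OF g] by auto
  then show "finite ((\<lambda>x. f (g x)) ` space M)"
    using f by (auto simp: simple_function_def intro: finite_subset)
  fix v
  have "(\<lambda>x. f (g x)) -` {v} \<inter> space M = g -` (f -` {v} \<inter> space N) \<inter> space M"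
    using measurable_space[OF g] by auto
  also have "\<dots> \<in> sets M" by (intro measurable_sets[OF g] simple_function_sets[OF f])
  finally show "(\<lambda>x. f (g x)) -` {v} \<inter> space M \<in> sets M" .
qed

lemma pr_distr:
  assumes g: "g \<in> measurable M N" and f: "simple_function N f"
  shows "pr (distr M N g) f v = pr M (\<lambda>x. f (g x)) v"
proof -
  have "pr (distr M N g) f v = measure M (g -` (f -` {v} \<inter> space N) \<inter> space M)"
    unfolding pr_def by (simp add: measure_distr[OF g simple_function_sets[OF f]])
  also have "g -` (f -` {v} \<inter> space N) \<inter> space M = (\<lambda>x. f (g x)) -` {v} \<inter> space M"
    using measurable_space[OF g] by auto
  finally show ?thesis by (simp add: pr_def)
qed

lemma ent_distr:
  assumes g: "g \<in> measurable M N" and f: "simple_function N f"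
  shows "ent (distr M N g) f = ent M (\<lambda>x. f (g x))"
proof -
  have "(\<lambda>x. f (g x)) ` space M \<subseteq> f ` space N" using measurable_space[OF g] by auto
  moreover have "finite (f ` space N)" using f by (simp add: simple_function_def)
  ultimately have "ent M (\<lambda>x. f (g x)) = (\<Sum>v\<in>f ` space N. - (pr (distr M N g) f v * ln (pr (distr M N g) f v)))"
    using pr_distr[OF g f] by (subst ent_superset[of "f ` space N"]) auto
  then show ?thesis by (simp add: ent_def)
qed

locale measure_preserving = prob_space M for M :: "'a measure" +
  fixes T :: "'a \<Rightarrow> 'a"
  assumes T_meas: "T \<in> measurable M M" and T_distr: "distr M M T = M"
begin

lemma funpow_measurable: "T ^^ i \<in> measurable M M"
proof (induction i)
  case (Suc i)
  then show ?case using measurable_comp[OF Suc T_meas] by (simp add: comp_def)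
qed (simp add: id_def)

lemma funpow_distr: "distr M M (T ^^ i) = M"
proof (induction i)
  case (Suc i)
  have "distr M M (T ^^ Suc i) = distr (distr M M (T ^^ i)) M T"
    using distr_distr[OF T_meas funpow_measurable[of i]] by (simp add: comp_def)
  then show ?case by (simp only: Suc T_distr)
qed (simp add: id_def)

lemma funpow_measure_preserving: "measure_preserving M (T ^^ i)"
  by unfold_locales (rule funpow_measurable funpow_distr)+

lemma pr_comp: "simple_function M f \<Longrightarrow> pr M (\<lambda>x. f (T x)) v = pr M f v"
  using pr_distr[OF T_meas, of f v] by (simp add: T_distr)

lemma ent_comp: "simple_function M f \<Longrightarrow> ent M (\<lambda>x. f (T x)) = ent M f"
  using ent_distr[OF T_meas, of f] by (simp add: T_distr)

lemma cent_comp: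
  assumes "simple_function M f" "simple_function M g"
  shows "cent M (\<lambda>x. f (T x)) (\<lambda>x. g (T x)) = cent M f g"
  unfolding cent_def using ent_comp[OF simple_function_Pair[OF assms]] ent_comp[OF assms(2)] by simp

lemma simple_function_funpow:
  "simple_function M f \<Longrightarrow> simple_function M (\<lambda>x. f ((T ^^ i) x))"
  by (rule simple_function_comp_measurable[OF _ funpow_measurable])

lemma simple_function_itinerary:
  assumes f: "simple_function M f"
  shows "simple_function M (itinerary T f n)"
proof (induction n)
  case 0
  then show ?case by (simp add: itinerary_def[abs_def])
next
  case (Suc n)
  show ?case
    using simple_function_compose[OF simple_function_Pair[OF Suc simple_function_funpow[OF f, of n]],
        of "\<lambda>(u, a). u @ [a]"]
    by (simp add: itinerary_Suc[abs_def] comp_def)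
qed

lemma ent_itinerary_add:
  assumes f: "simple_function M f"
  shows "ent M (itinerary T f (m + n)) \<le> ent M (itinerary T f m) + ent M (itinerary T f n)"
proof -
  note S = simple_function_itinerary[OF f]
  interpret Tm: measure_preserving M "T ^^ m" by (rule funpow_measure_preserving)
  have 1: "simple_function M (\<lambda>x. itinerary T f n ((T ^^ m) x))"
    by (rule simple_function_comp_measurable[OF S funpow_measurable])
  have "ent M (itinerary T f (m + n)) \<le> ent M (\<lambda>x. (itinerary T f m x, itinerary T f n ((T ^^ m) x)))"
  proof (rule ent_le_if_determined[OF simple_function_Pair[OF S 1], of _ "\<lambda>(u, v). u @ v"])
    fix x
    show "itinerary T f (m + n) x = (\<lambda>(u, v). u @ v) (itinerary T f m x, itinerary T f n ((T ^^ m) x))"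
      using append_take_drop_id[of m "itinerary T f (m + n) x"]
      by (simp add: take_itinerary drop_itinerary)
  qed
  also have "\<dots> \<le> ent M (itinerary T f m) + ent M (\<lambda>x. itinerary T f n ((T ^^ m) x))"
    by (rule ent_Pair_le[OF S 1])
  also have "ent M (\<lambda>x. itinerary T f n ((T ^^ m) x)) = ent M (itinerary T f n)"
    by (rule Tm.ent_comp[OF S])
  finally show ?thesis .
qed

lemma cent_itinerary_le:
  assumes f: "simple_function M f" and b: "simple_function M b"
  shows "cent M (itinerary T f n) b \<le> (\<Sum>i<n. cent M (\<lambda>x. f ((T ^^ i) x)) b)"
proof (induction n)
  case 0
  have "ent M (\<lambda>x. (itinerary T f 0 x, b x)) = ent M b"
    by (rule ent_eq_if_determined[OF simple_function_Pair[OF simple_function_itinerary[OF f] b] b,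
        where k = snd and l = "\<lambda>v. ([], v)"]) auto
  then show ?case by (simp add: cent_def)
next
  case (Suc n)
  note S = simple_function_itinerary[OF f] simple_function_funpow[OF f, of n]
  have "ent M (\<lambda>x. (itinerary T f (Suc n) x, b x)) \<le> ent M (\<lambda>x. ((itinerary T f n x, f ((T ^^ n) x)), b x))"
    by (rule ent_le_if_determined[of _ _ "\<lambda>((u, a), c). (u @ [a], c)"])
      (auto intro!: simple_function_Pair S b simp: itinerary_Suc)
  then have "cent M (itinerary T f (Suc n)) b \<le> cent M (\<lambda>x. (itinerary T f n x, f ((T ^^ n) x))) b"
    by (simp add: cent_def)
  also have "\<dots> \<le> cent M (itinerary T f n) b + cent M (\<lambda>x. f ((T ^^ n) x)) b"
    by (rule cent_Pair_le[OF S b])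
  finally show ?case using Suc by simp
qed

text \<open>Since \<open>b\<close> knows the value of \<open>g\<close> at each time
  \<open>i < n\<close>, conditioning the \<open>i\<close>-th letter on \<open>b\<close> is at least
  as strong as conditioning it on \<open>g\<close> at that time, and invariance turns each such term
  into \<open>cent M f g\<close>. The generator theorem takes a long itinerary for \<open>b\<close>,
  the upper bound a long prefix of the image.\<close>

lemma ent_itinerary_le:
  assumes f: "simple_function M f" and g: "simple_function M g" and b: "simple_function M b"
    and det: "\<And>i x. i < n \<Longrightarrow> x \<in> space M \<Longrightarrow> g ((T ^^ i) x) = k i (b x)"
  shows "ent M (itinerary T f n) \<le> ent M b + real n * cent M f g"
proof -
  have "ent M (itinerary T f n) \<le> ent M (\<lambda>x. (itinerary T f n x, b x))"
    by (rule ent_le_if_determined[OF simple_function_Pair[OF simple_function_itinerary[OF f] b], of _ fst]) simp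
  also have "\<dots> = ent M b + cent M (itinerary T f n) b" by (simp add: cent_def)
  also have "cent M (itinerary T f n) b \<le> (\<Sum>i<n. cent M (\<lambda>x. f ((T ^^ i) x)) b)"
    by (rule cent_itinerary_le[OF f b])
  also have "\<dots> \<le> (\<Sum>i<n. cent M f g)"
  proof (rule sum_mono)
    fix i assume i: "i \<in> {..<n}"
    interpret Ti: measure_preserving M "T ^^ i" by (rule funpow_measure_preserving)
    have "cent M (\<lambda>x. f ((T ^^ i) x)) b \<le> cent M (\<lambda>x. f ((T ^^ i) x)) (\<lambda>x. g ((T ^^ i) x))"
      using i det by (intro cent_antimono'[OF simple_function_funpow[OF f] b, of _ "k i"]) auto
    then show "cent M (\<lambda>x. f ((T ^^ i) x)) b \<le> cent M f g" by (simp add: Ti.cent_comp[OF f g])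
  qed
  finally show ?thesis by simp
qed

text \<open>By Fekete's lemma this infimum is the limit in \<open>entropy_wrt\<close> for the level
  sets of \<open>f\<close>; as an infimum it is bounded by every single block.\<close>

definition entropy_rate :: "('a \<Rightarrow> 'b) \<Rightarrow> real" where
  "entropy_rate f = (INF n\<in>{1..}. ent M (itinerary T f n) / real n)"

lemma entropy_rate_LIMSEQ:
  assumes f: "simple_function M f"
  shows "(\<lambda>n. ent M (itinerary T f n) / real n) \<longlonglongrightarrow> entropy_rate f"
  unfolding entropy_rate_def by (rule fekete[OF ent_itinerary_add[OF f] ent_nonneg])

section \<open>Finite partitions as level sets\<close>

definition level_partition :: "('a \<Rightarrow> 'b) \<Rightarrow> 'a set set" where
  "level_partition f = (\<lambda>v. f -` {v} \<inter> space M) ` f ` space M"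

lemma level_partition_finite_partitions:
  assumes f: "simple_function M f"
  shows "level_partition f \<in> finite_partitions M"
  unfolding finite_partitions_def level_partition_def
  using f by (auto simp: simple_function_def partition_on_def disjoint_def)

lemma finite_partition_is_level_partition:
  assumes P: "P \<in> finite_partitions M"
  obtains f :: "'a \<Rightarrow> 'a set" where "simple_function M f" "P = level_partition f"
proof -
  have part: "partition_on (space M) P" and fin: "finite P" and Psets: "P \<subseteq> sets M"
    using P by (auto simp: finite_partitions_def)
  define f where "f x = (THE A. A \<in> P \<and> x \<in> A)" for x
  have f_eq: "f x = A" if "A \<in> P" "x \<in> A" for x A
    unfolding f_def using part that
    by (intro the_equality) (auto simp: partition_on_def disjoint_def)
  have ex: "\<exists>A\<in>P. x \<in> A" if "x \<in> space M" for x
    using part that by (auto simp: partition_on_def)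
  have sub: "A \<subseteq> space M" "A \<noteq> {}" if "A \<in> P" for A using part that by (auto simp: partition_on_def)
  have im: "f ` space M = P"
  proof (intro equalityI subsetI)
    fix A assume "A \<in> f ` space M"
    then show "A \<in> P" using ex f_eq by auto
  next
    fix A assume A: "A \<in> P"
    then obtain x where "x \<in> A" using sub(2)[OF A] by blast
    then have "f x = A" "x \<in> space M" using A sub(1)[OF A] f_eq[of A x] by auto
    then show "A \<in> f ` space M" by blast
  qed
  have vim: "f -` {A} \<inter> space M = A" if "A \<in> P" for A
  proof (intro equalityI subsetI)
    fix x assume "x \<in> f -` {A} \<inter> space M"
    then show "x \<in> A" using ex[of x] f_eq[of _ x] by auto
  next
    fix x assume "x \<in> A"
    then show "x \<in> f -` {A} \<inter> space M" using that sub(1)[OF that] f_eq[of A x] by auto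
  qed
  show thesis
  proof (rule that)
    show "simple_function M f"
      unfolding simple_function_def im using fin vim Psets by auto
    show "P = level_partition f" unfolding level_partition_def im using vim by auto
  qed
qed

text \<open>Both sides omit empty cells: \<open>iterated_join\<close> removes \<open>{}\<close>, and
  the right-hand side only runs over itineraries that occur.\<close>

lemma iterated_join_level_partition:
  "iterated_join M T (level_partition f) n
    = (\<lambda>u. itinerary T f n -` {u} \<inter> space M) ` itinerary T f n ` space M" (is "?L = ?R")
proof (intro equalityI subsetI)
  have sp: "(T ^^ i) x \<in> space M" if "x \<in> space M" for i x
    using measurable_space[OF funpow_measurable that] .
  {
    fix B assume "B \<in> ?L"
    then obtain F where F: "F \<in> {..<n} \<rightarrow>\<^sub>E level_partition f"
      and B: "B = {x \<in> space M. \<forall>i<n. (T ^^ i) x \<in> F i}" and "B \<noteq> {}"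
      by (auto simp: iterated_join_def)
    then obtain x where x: "x \<in> B" by auto
    have "F i = {y \<in> space M. f y = f ((T ^^ i) x)}" if "i < n" for i
    proof -
      have "F i \<in> level_partition f" "(T ^^ i) x \<in> F i" using F B x that by auto
      then show ?thesis by (auto simp: level_partition_def)
    qed
    then have "B = itinerary T f n -` {itinerary T f n x} \<inter> space M"
      unfolding B using sp by (auto simp: itinerary_eq_iff)
    then show "B \<in> ?R" using x B by auto
  next
    fix B assume "B \<in> ?R"
    then obtain x where x: "x \<in> space M" and B: "B = itinerary T f n -` {itinerary T f n x} \<inter> space M"
      by auto
    define F where "F = (\<lambda>i\<in>{..<n}. {y \<in> space M. f y = f ((T ^^ i) x)})"
    have "F \<in> {..<n} \<rightarrow>\<^sub>E level_partition f"
      unfolding F_def level_partition_def using x sp by (auto intro!: image_eqI[where x = "f ((T ^^ _) x)"])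
    moreover have "B = {x \<in> space M. \<forall>i<n. (T ^^ i) x \<in> F i}"
      unfolding B F_def using sp by (auto simp: itinerary_eq_iff)
    moreover have "x \<in> B" using x B by auto
    ultimately show "B \<in> ?L" by (auto simp: iterated_join_def)
  }
qed

lemma partition_entropy_iterated_join:
  "partition_entropy M (iterated_join M T (level_partition f) n) = ent M (itinerary T f n)"
proof -
  have "inj_on (\<lambda>u. itinerary T f n -` {u} \<inter> space M) (itinerary T f n ` space M)"
    by (auto simp: inj_on_def)
  then show ?thesis
    by (simp add: partition_entropy_def iterated_join_level_partition ent_def pr_def sum.reindex sum_negf)
qed

lemma entropy_wrt_level_partition:
  assumes f: "simple_function M f"
  shows "entropy_wrt M T (level_partition f) = entropy_rate f"
  unfolding entropy_wrt_def partition_entropy_iterated_join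
  by (rule limI[OF entropy_rate_LIMSEQ[OF f]])

text \<open>An \<open>f\<close>-itinerary of length \<open>n + N\<close> contains the
  \<open>N\<close>-block that starts at each time \<open>i < n\<close>. The \<open>N\<close> extra
  letters cost a constant, which vanishes after division by \<open>n\<close>.\<close>

lemma entropy_rate_le_cent:
  assumes f: "simple_function M f" and g: "simple_function M g"
  shows "entropy_rate g \<le> entropy_rate f + cent M g (itinerary T f N)"
proof (rule LIMSEQ_le)
  let ?c = "cent M g (itinerary T f N)"
  note S = simple_function_itinerary[OF f]
  show "(\<lambda>n. ent M (itinerary T g n) / real n) \<longlonglongrightarrow> entropy_rate g" by (rule entropy_rate_LIMSEQ[OF g])
  have "(\<lambda>n. ent M (itinerary T f n) / real n + ent M (itinerary T f N) / real n + ?c)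
      \<longlonglongrightarrow> entropy_rate f + 0 + ?c"
    by (intro tendsto_intros entropy_rate_LIMSEQ[OF f] lim_const_over_n)
  then show "(\<lambda>n. ent M (itinerary T f n) / real n + ent M (itinerary T f N) / real n + ?c)
      \<longlonglongrightarrow> entropy_rate f + ?c" by simp
  have "ent M (itinerary T g n) / real n \<le> ent M (itinerary T f n) / real n + ent M (itinerary T f N) / real n + ?c"
    if "n \<ge> 1" for n
  proof -
    have "ent M (itinerary T g n) \<le> ent M (itinerary T f (n + N)) + real n * ?c"
      by (rule ent_itinerary_le[OF g S S, of _ _ "\<lambda>i u. take N (drop i u)"])
        (simp add: drop_itinerary take_itinerary)
    also have "ent M (itinerary T f (n + N)) \<le> ent M (itinerary T f n) + ent M (itinerary T f N)"
      by (rule ent_itinerary_add[OF f])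
    finally show ?thesis using that by (simp add: field_simps)
  qed
  then show "\<exists>N'. \<forall>n\<ge>N'. ent M (itinerary T g n) / real n
      \<le> ent M (itinerary T f n) / real n + ent M (itinerary T f N) / real n + ?c" by blast
qed

text \<open>A pair of cells contributes \<open>a * (ln c - ln a)\<close> with
  \<open>a \<le> c\<close>, which is small when \<open>a\<close> is small and also when
  \<open>a\<close> is close to \<open>c\<close>. Whether \<open>u\<close> lies in \<open>S\<close>
  decides which of \<open>a\<close> and \<open>c - a\<close> is an error of the approximation. For
  one \<open>v\<close> the errors add up to at most \<open>e\<^sup>2\<close>; divided by
  \<open>e\<close> they leave \<open>e\<close>, and the terms \<open>e * c\<close> sum to another
  \<open>e\<close>.\<close>

lemma cent_le_if_approximable:
  assumes g: "simple_function M g" and b: "simple_function M b"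
    and e: "0 < e" "e \<le> 1"
    and approx: "\<And>v. v \<in> g ` space M \<Longrightarrow>
      \<exists>S. measure M {x \<in> space M. (g x = v) \<noteq> (b x \<in> S)} \<le> e\<^sup>2"
  shows "cent M g b \<le> real (card (g ` space M)) * (2 * e)"
proof -
  let ?P = "\<lambda>x. (g x, b x)"
  let ?p = "\<lambda>v u. pr M ?P (v, u)"
  have P: "simple_function M ?P" by (rule simple_function_Pair[OF g b])
  have fin: "finite (g ` space M)" "finite (b ` space M)" using g b by (auto simp: simple_function_def)
  have le: "?p v u \<le> pr M b u" for v u using pr_comp_ge[OF P, of "(v, u)" snd] by simp
  have bound: "?p v u * (ln (pr M b u) - ln (?p v u)) \<le> e * pr M b u + ?p v u / e" (is ?A)
    "?p v u * (ln (pr M b u) - ln (?p v u)) \<le> e * pr M b u + (pr M b u - ?p v u) / e" (is ?B) for v u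
  proof -
    have "?A \<and> ?B"
    proof (cases "?p v u = 0")
      case False
      define a c where "a = ?p v u" and "c = pr M b u"
      have a: "0 < a" using False pr_nonneg[of M ?P "(v, u)"] unfolding a_def by linarith
      have c: "a \<le> c" using le unfolding a_def c_def .
      \<comment> \<open>The square root leads to the bound \<open>2 * sqrt (a * c)\<close>, which
        the inequality of arithmetic and geometric means, weighted by \<open>e\<close>, splits into
        \<open>e * c + a / e\<close>.\<close>
      have "ln c - ln a = 2 * ln (sqrt (c / a))" using a c by (simp add: ln_sqrt ln_div)
      also have "\<dots> \<le> 2 * (sqrt (c / a) - 1)" using a c by (intro mult_left_mono ln_le_minus_one) auto
      finally have "a * (ln c - ln a) \<le> a * (2 * (sqrt (c / a) - 1))" using a by (intro mult_left_mono) auto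
      also have "\<dots> \<le> 2 * (a * sqrt (c / a))" using a by (simp add: algebra_simps)
      also have "a * sqrt (c / a) = sqrt ((e * c) * (a / e))"
        using a c e by (simp add: real_sqrt_mult real_sqrt_divide real_div_sqrt field_simps)
      also have "2 * \<dots> \<le> e * c + a / e"
        using arith_geo_mean_sqrt[of "e * c" "a / e"] a c e by simp
      finally have A: "a * (ln c - ln a) \<le> e * c + a / e" .
      have "ln c - ln a \<le> c / a - 1" using ln_le_minus_one[of "c / a"] a c by (simp add: ln_div)
      then have "a * (ln c - ln a) \<le> a * (c / a - 1)" using a by (intro mult_left_mono) auto
      also have "\<dots> = c - a" using a by (simp add: field_simps)
      also have "\<dots> \<le> (c - a) / e" using c e mult_left_le[of e "c - a"] by (simp add: pos_le_divide_eq)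
      also have "\<dots> \<le> e * c + (c - a) / e" using a c e by simp
      finally show ?thesis using A unfolding a_def c_def by simp
    qed (use e in simp)
    then show ?A ?B by auto
  qed
  have total: "(\<Sum>u\<in>b ` space M. pr M b u) = 1"
    using pr_comp_sum[OF b, of "\<lambda>_. ()" "()"] by (simp add: pr_def prob_space)
  have "cent M g b = (\<Sum>z\<in>g ` space M \<times> b ` space M.
      pr M ?P z * (ln (pr M b (snd z)) - ln (pr M ?P z)))"
    unfolding cent_formula[OF g b] using fin
    by (intro sum.mono_neutral_left) (auto simp: pr_outside)
  also have "\<dots> = (\<Sum>v\<in>g ` space M. \<Sum>u\<in>b ` space M. ?p v u * (ln (pr M b u) - ln (?p v u)))"
    by (simp add: sum.cartesian_product split_def)
  also have "\<dots> \<le> (\<Sum>v\<in>g ` space M. 2 * e)"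
  proof (rule sum_mono)
    fix v assume "v \<in> g ` space M"
    then obtain S where S: "measure M {x \<in> space M. (g x = v) \<noteq> (b x \<in> S)} \<le> e\<^sup>2"
      using approx by blast
    \<comment> \<open>The mass inside the cell \<open>b x = u\<close> on which
      \<open>g x = v\<close> and \<open>u \<in> S\<close> disagree.\<close>
    define m where "m u = (if u \<in> S then pr M b u - ?p v u else ?p v u)" for u
    have m: "m u = measure M {x \<in> space M. b x = u \<and> (g x = v) \<noteq> (u \<in> S)}" for u
    proof -
      have s1: "?P -` {(v, u)} \<inter> space M \<in> sets M" and s2: "b -` {u} \<inter> space M \<in> sets M"
        using simple_function_sets[OF P] simple_function_sets[OF b] by auto
      have eq: "{x \<in> space M. b x = u \<and> (g x = v) \<noteq> (u \<in> S)}
          = (if u \<in> S then (b -` {u} \<inter> space M) - (?P -` {(v, u)} \<inter> space M) else ?P -` {(v, u)} \<inter> space M)"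
        by auto
      have "measure M ((b -` {u} \<inter> space M) - (?P -` {(v, u)} \<inter> space M)) = pr M b u - ?p v u"
        unfolding pr_def using s1 s2 by (intro finite_measure_Diff) auto
      then show ?thesis unfolding m_def eq by (simp add: pr_def)
    qed
    have "(\<Sum>u\<in>b ` space M. ?p v u * (ln (pr M b u) - ln (?p v u)))
        \<le> (\<Sum>u\<in>b ` space M. e * pr M b u + m u / e)"
      unfolding m_def using bound by (intro sum_mono) auto
    also have "\<dots> = e + (\<Sum>u\<in>b ` space M. m u) / e"
      using total by (simp add: sum.distrib sum_distrib_left[symmetric] sum_divide_distrib)
    also have "(\<Sum>u\<in>b ` space M. m u)
        = measure M (\<Union>u\<in>b ` space M. {x \<in> space M. b x = u \<and> (g x = v) \<noteq> (u \<in> S)})"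
      unfolding m
    proof (rule finite_measure_finite_Union[symmetric, OF fin(2)])
      have "{x \<in> space M. b x = u \<and> (g x = v) \<noteq> (u \<in> S)} \<in> sets M" for u
      proof -
        have "{x \<in> space M. b x = u \<and> (g x = v) \<noteq> (u \<in> S)}
            = ?P -` {z. snd z = u \<and> (fst z = v) \<noteq> (u \<in> S)} \<inter> space M"
          by auto
        then show ?thesis by (simp only: simple_function_sets[OF P])
      qed
      then show "(\<lambda>u. {x \<in> space M. b x = u \<and> (g x = v) \<noteq> (u \<in> S)}) ` b ` space M \<subseteq> sets M"
        by blast
    qed (auto simp: disjoint_family_on_def)
    also have "(\<Union>u\<in>b ` space M. {x \<in> space M. b x = u \<and> (g x = v) \<noteq> (u \<in> S)})
        = {x \<in> space M. (g x = v) \<noteq> (b x \<in> S)}" by auto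
    also have "e + measure M {x \<in> space M. (g x = v) \<noteq> (b x \<in> S)} / e \<le> e + e\<^sup>2 / e"
      using S e by (intro add_left_mono divide_right_mono) auto
    also have "\<dots> = 2 * e" using e by (simp add: power2_eq_square)
    finally show "(\<Sum>u\<in>b ` space M. ?p v u * (ln (pr M b u) - ln (?p v u))) \<le> 2 * e" .
  qed
  finally show ?thesis by simp
qed

definition itinerary_sets :: "('a \<Rightarrow> 'b) \<Rightarrow> 'a set set" where
  "itinerary_sets f = {itinerary T f N -` S \<inter> space M |N S. True}"

text \<open>The sets with this approximation property form a sigma-algebra containing the
  generators. Asking for all large \<open>n\<close>, rather than for some \<open>n\<close>, lets
  finitely many sets be approximated with one common length.\<close>

lemma approximate_by_itinerary_sets:
  assumes f: "simple_function M f" and gen: "sets M = sigma_sets (space M) (itinerary_sets f)"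
    and A: "A \<in> sets M" and e: "0 < e"
  shows "\<exists>N. \<forall>n\<ge>N. \<exists>S. measure M {x \<in> space M. (x \<in> A) \<noteq> (itinerary T f n x \<in> S)} < e"
proof -
  note S = simple_function_itinerary[OF f]
  define D where "D A n S = {x \<in> space M. (x \<in> A) \<noteq> (itinerary T f n x \<in> S)}" for A n S
  have Dsets: "D A n S \<in> sets M" if "A \<in> sets M" for A n S
  proof -
    have "D A n S = (A - (itinerary T f n -` S \<inter> space M)) \<union> ((itinerary T f n -` S \<inter> space M) - A)"
      using sets.sets_into_space[OF that] by (auto simp: D_def)
    also have "\<dots> \<in> sets M" using that simple_function_sets[OF simple_function_itinerary[OF f]] by auto
    finally show ?thesis .
  qed
  have "A \<in> sigma_sets (space M) (itinerary_sets f)" using A gen by simp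
  then have "\<forall>e>0. \<exists>N. \<forall>n\<ge>N. \<exists>S. measure M (D A n S) < e"
  proof (induction rule: sigma_sets.induct)
    case (Basic A)
    then obtain N S where A: "A = itinerary T f N -` S \<inter> space M" by (auto simp: itinerary_sets_def)
    have "D A n {u. take N u \<in> S} = {}" if "n \<ge> N" for n
      unfolding D_def A using that by (auto simp: take_itinerary)
    then show ?case by (metis measure_empty)
  next
    case Empty
    have "D {} n {} = {}" for n by (auto simp: D_def)
    then show ?case by (metis measure_empty)
  next
    case (Compl A)
    have "D (space M - A) n (- S) = D A n S" for n S by (auto simp: D_def)
    then show ?case using Compl.IH by metis
  next
    case (Union A)
    have As: "A i \<in> sets M" for i using Union.hyps gen by simp
    show ?case
    proof (intro allI impI)
      fix e :: real assume e: "0 < e"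
      have "(\<lambda>n. measure M (\<Union>i<n. A i)) \<longlonglongrightarrow> measure M (\<Union>n. \<Union>i<n. A i)"
        using As by (intro finite_Lim_measure_incseq) (auto simp: incseq_def intro: less_le_trans)
      moreover have "(\<Union>n. \<Union>i<n. A i) = (\<Union>i. A i)" by auto
      ultimately have "(\<lambda>n. measure M (\<Union>i<n. A i)) \<longlonglongrightarrow> measure M (\<Union>i. A i)" by simp
      from order_tendstoD(1)[OF this, of "measure M (\<Union>i. A i) - e / 2"] e
      obtain k where k: "measure M (\<Union>i. A i) - e / 2 < measure M (\<Union>i<k. A i)"
        by (auto simp: eventually_sequentially)
      \<comment> \<open>The \<open>k\<close> errors share \<open>e / 2\<close>; the
        \<open>+ 1\<close> covers \<open>k = 0\<close>.\<close>
      define d where "d = e / 2 / (real k + 1)"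
      have d: "0 < d" using e by (simp add: d_def)
      have "\<exists>N. \<forall>n\<ge>N. \<exists>S. measure M (D (A i) n S) < d" for i using Union.IH d by blast
      then obtain N where N: "\<And>i n. n \<ge> N i \<Longrightarrow> \<exists>S. measure M (D (A i) n S) < d" by metis
      have "\<exists>S. measure M (D (\<Union>i. A i) n S) < e" if n: "n \<ge> Max (N ` {..<k} \<union> {0})" for n
      proof -
        have "\<exists>S. measure M (D (A i) n S) < d" if "i < k" for i
          using n that by (intro N) auto
        then obtain S where S: "\<And>i. i < k \<Longrightarrow> measure M (D (A i) n (S i)) < d" by metis
        have "D (\<Union>i. A i) n (\<Union>i<k. S i) \<subseteq> ((\<Union>i. A i) - (\<Union>i<k. A i)) \<union> (\<Union>i<k. D (A i) n (S i))"
          by (auto simp: D_def)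
        then have "measure M (D (\<Union>i. A i) n (\<Union>i<k. S i))
            \<le> measure M (((\<Union>i. A i) - (\<Union>i<k. A i)) \<union> (\<Union>i<k. D (A i) n (S i)))"
          using As Dsets by (intro finite_measure_mono) auto
        also have "\<dots> \<le> measure M ((\<Union>i. A i) - (\<Union>i<k. A i)) + measure M (\<Union>i<k. D (A i) n (S i))"
          using As Dsets by (intro measure_Un_le) auto
        also have "measure M ((\<Union>i. A i) - (\<Union>i<k. A i)) = measure M (\<Union>i. A i) - measure M (\<Union>i<k. A i)"
          using As by (intro finite_measure_Diff) auto
        also have "measure M (\<Union>i<k. D (A i) n (S i)) \<le> (\<Sum>i<k. measure M (D (A i) n (S i)))"
          using As Dsets by (intro finite_measure_subadditive_finite) auto
        also have "\<dots> \<le> (\<Sum>i<k. d)" using S by (intro sum_mono) (auto intro: less_imp_le)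
        also have "(\<Sum>i<k. d) \<le> e / 2" using e by (simp add: d_def field_simps)
        finally show ?thesis using k by (intro exI[of _ "\<Union>i<k. S i"]) linarith
      qed
      then show "\<exists>N. \<forall>n\<ge>N. \<exists>S. measure M (D (\<Union>i. A i) n S) < e" by blast
    qed
  qed
  then show ?thesis using e by (auto simp: D_def)
qed

text \<open>The Kolmogorov-Sinai generator theorem: the level sets of any finite-valued
  \<open>g\<close> are nearly unions of cells of a long \<open>f\<close>-itinerary, so the entropy
  rate of \<open>g\<close> exceeds that of \<open>f\<close> by an arbitrarily small amount.\<close>

theorem KS_entropy_generator:
  assumes f: "simple_function M f" and gen: "sets M = sigma_sets (space M) (itinerary_sets f)"
  shows "KS_entropy M T = ereal (entropy_rate f)"
proof (rule antisym)
  show "ereal (entropy_rate f) \<le> KS_entropy M T"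
    unfolding KS_entropy_def
    by (rule SUP_upper2[OF level_partition_finite_partitions[OF f]])
      (simp add: entropy_wrt_level_partition[OF f])
  show "KS_entropy M T \<le> ereal (entropy_rate f)"
    unfolding KS_entropy_def
  proof (rule SUP_least)
    fix P assume "P \<in> finite_partitions M"
    then obtain g :: "'a \<Rightarrow> 'a set" where g: "simple_function M g" and P: "P = level_partition g"
      by (rule finite_partition_is_level_partition)
    have fin: "finite (g ` space M)" using g by (simp add: simple_function_def)
    define r where "r = real (card (g ` space M))"
    have eps: "entropy_rate g \<le> entropy_rate f + r * (2 * e)" if e: "0 < e" "e \<le> 1" for e
    proof -
      have "\<forall>v. \<exists>N. \<forall>n\<ge>N. \<exists>S.
          measure M {x \<in> space M. (x \<in> g -` {v} \<inter> space M) \<noteq> (itinerary T f n x \<in> S)} < e\<^sup>2"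
        using simple_function_sets[OF g] e by (intro allI approximate_by_itinerary_sets[OF f gen]) auto
      from choice[OF this] obtain N where N: "\<forall>v. \<forall>n\<ge>N v. \<exists>S.
          measure M {x \<in> space M. (x \<in> g -` {v} \<inter> space M) \<noteq> (itinerary T f n x \<in> S)} < e\<^sup>2" ..
      define n where "n = Max (N ` g ` space M)"
      have "\<exists>S. measure M {x \<in> space M. (g x = v) \<noteq> (itinerary T f n x \<in> S)} \<le> e\<^sup>2"
        if "v \<in> g ` space M" for v
      proof -
        have "n \<ge> N v" unfolding n_def using fin that by (intro Max_ge) auto
        from N[rule_format, OF this] obtain S
          where "measure M {x \<in> space M. (x \<in> g -` {v} \<inter> space M) \<noteq> (itinerary T f n x \<in> S)} < e\<^sup>2" by blast
        moreover have "{x \<in> space M. (x \<in> g -` {v} \<inter> space M) \<noteq> (itinerary T f n x \<in> S)}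
          = {x \<in> space M. (g x = v) \<noteq> (itinerary T f n x \<in> S)}" by auto
        ultimately show ?thesis by (intro exI[of _ S]) simp
      qed
      then have "cent M g (itinerary T f n) \<le> r * (2 * e)"
        unfolding r_def by (intro cent_le_if_approximable[OF g simple_function_itinerary[OF f] e])
      then show ?thesis using entropy_rate_le_cent[OF f g, of n] by linarith
    qed
    have "entropy_rate g \<le> entropy_rate f"
    proof (rule field_le_epsilon)
      fix d :: real assume d: "0 < d"
      \<comment> \<open>The cap \<open>1\<close> is demanded by the approximation estimate, and the
        \<open>+ 1\<close> keeps the denominator positive.\<close>
      define e where "e = min 1 (d / (2 * r + 1))"
      have r: "0 \<le> r" by (simp add: r_def)
      have e: "0 < e" "e \<le> 1" "e \<le> d / (2 * r + 1)" using d r by (auto simp: e_def)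
      have "r * (2 * e) \<le> (2 * r + 1) * e" using e by (simp add: algebra_simps)
      also have "\<dots> \<le> d" using e(3) r by (simp add: field_simps)
      finally show "entropy_rate g \<le> entropy_rate f + d" using eps[OF e(1,2)] by linarith
    qed
    then show "ereal (entropy_wrt M T P) \<le> ereal (entropy_rate f)"
      unfolding P entropy_wrt_level_partition[OF g] by simp
  qed
qed

end

section \<open>Invariant measures on subshifts\<close>

definition pre :: "nat \<Rightarrow> (nat \<Rightarrow> nat) \<Rightarrow> nat list" where
  "pre n x = map x [0..<n]"

lemma length_pre [simp]: "length (pre n x) = n"
  by (simp add: pre_def)

lemma nth_pre [simp]: "i < n \<Longrightarrow> pre n x ! i = x i"
  by (simp add: pre_def)

lemma pre_0 [simp]: "pre 0 x = []"
  by (simp add: pre_def)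

lemma pre_Suc: "pre (Suc n) x = pre n x @ [x n]"
  by (simp add: pre_def)

lemma pre_eq_iff: "pre n x = w \<longleftrightarrow> length w = n \<and> (\<forall>i<n. x i = w ! i)"
  by (auto simp: list_eq_iff_nth_eq)

lemma funpow_shift: "(shift ^^ i) x = (\<lambda>j. x (i + j))"
  by (induction i) (auto simp: shift_def)

lemma pre_eq_itinerary: "pre n = itinerary shift (\<lambda>x. x 0) n"
  by (rule ext) (simp add: itinerary_def pre_def funpow_shift)

lemma take_pre: "m \<le> n \<Longrightarrow> take m (pre n x) = pre m x"
  by (auto simp: list_eq_iff_nth_eq)

lemma drop_pre: "drop m (pre n x) = pre (n - m) ((shift ^^ m) x)"
  by (auto simp: list_eq_iff_nth_eq funpow_shift)

lemma pre_Suc_shift: "pre (Suc n) x = x 0 # pre n (shift x)"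
  by (auto simp: list_eq_iff_nth_eq nth_Cons shift_def split: nat.split)

lemma cylinder_eq_pre: "cylinder X w = {x \<in> X. pre (length w) x = w}"
  by (auto simp: cylinder_def pre_eq_iff)

lemma coordinate_measurable [measurable]: "(\<lambda>x. x i) \<in> (borel :: (nat \<Rightarrow> nat) measure) \<rightarrow>\<^sub>M count_space UNIV"
  by (subst measurable_cong_sets[OF refl sets_borel_eq_count_space[symmetric]]) (rule measurable_product_coordinates)

lemma measurable_pre:
  fixes g :: "'a \<Rightarrow> nat \<Rightarrow> nat"
  assumes "\<And>i. (\<lambda>x. g x i) \<in> M \<rightarrow>\<^sub>M count_space UNIV"
  shows "(\<lambda>x. pre n (g x)) \<in> M \<rightarrow>\<^sub>M count_space UNIV"
proof (induction n)
  case (Suc n)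
  have "(\<lambda>x. u @ [a]) \<in> M \<rightarrow>\<^sub>M count_space UNIV" for u :: "nat list" and a by simp
  then have "(\<lambda>x. u @ [g x n]) \<in> M \<rightarrow>\<^sub>M count_space UNIV" for u
    by (rule measurable_compose_countable[OF _ assms])
  then show ?case unfolding pre_Suc by (rule measurable_compose_countable[OF _ Suc])
qed simp

lemma pre_measurable [measurable]: "pre n \<in> borel \<rightarrow>\<^sub>M count_space UNIV"
  by (rule measurable_pre[where g = "\<lambda>x. x"]) measurable

lemma pre_eq_borel: "{x. pre n x = w} \<in> sets borel"
  using measurable_sets[OF pre_measurable, of "{w}" n] by (simp add: vimage_def)

lemma measurable_into_sequences:
  fixes g :: "'a \<Rightarrow> nat \<Rightarrow> nat"
  assumes "\<And>i. (\<lambda>x. g x i) \<in> M \<rightarrow>\<^sub>M (count_space UNIV :: nat measure)"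
  shows "g \<in> borel_measurable M"
proof (rule measurable_coordinatewise_then_product)
  fix i
  show "(\<lambda>x. g x i) \<in> borel_measurable M"
    by (subst measurable_cong_sets[OF refl sets_borel_eq_count_space]) (rule assms)
qed

lemma shift_measurable [measurable]: "shift \<in> borel \<rightarrow>\<^sub>M borel"
  by (rule measurable_into_sequences) (simp add: shift_def)

text \<open>Tychonoff, for the subshift as well as for the cube of all functions from words to
  \<open>[0, 1]\<close>.\<close>

lemma compact_PiE_UNIV:
  assumes "\<And>i. compact (S i)"
  shows "compact (PiE UNIV S)"
  using assms compactin_PiE[of "\<lambda>_. euclidean" UNIV S] by (simp add: euclidean_product_topology)

text \<open>The probability of the cylinder of \<open>w\<close>. Invariant measures are compared,
  mixed and passed to limits through these numbers.\<close>

definition word_prob :: "(nat \<Rightarrow> nat) measure \<Rightarrow> nat list \<Rightarrow> real" where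
  "word_prob M w = pr M (pre (length w)) w"

lemma pr_pre: "pr M (pre n) w = (if length w = n then word_prob M w else 0)"
  by (auto simp: word_prob_def intro!: pr_outside)

locale one_sided_subshift =
  fixes k :: nat and X :: "(nat \<Rightarrow> nat) set"
  assumes subshift: "subshift k X"
begin

definition lang :: "nat \<Rightarrow> nat list set" where
  "lang n = pre n ` X"

lemma nonempty: "X \<noteq> {}" and letters: "x \<in> X \<Longrightarrow> x i \<in> {1..k}" and closed: "closed X"
  and shift_closed: "x \<in> X \<Longrightarrow> shift x \<in> X"
  using subshift by (auto simp: subshift_def)

lemma funpow_shift_closed: "x \<in> X \<Longrightarrow> (shift ^^ i) x \<in> X"
  by (induction i) (auto simp: shift_closed)

lemma k_pos: "1 \<le> k"
proof -
  obtain x where "x \<in> X" using nonempty by auto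
  then show ?thesis using letters[of x 0] by simp
qed

lemma compact: "compact X"
proof -
  have "X = X \<inter> PiE UNIV (\<lambda>_. {1..k})" using letters by auto
  moreover have "compact (X \<inter> PiE UNIV (\<lambda>_. {1..k}))"
    by (intro closed_Int_compact closed compact_PiE_UNIV finite_imp_compact) auto
  ultimately show ?thesis by simp
qed

lemma lang_words: "lang n \<subseteq> {w. set w \<subseteq> {1..k} \<and> length w = n}"
proof
  fix w assume "w \<in> lang n"
  then obtain x where x: "x \<in> X" "w = pre n x" by (auto simp: lang_def)
  then have "set w \<subseteq> {1..k}" using letters[OF x(1)] by (auto simp: pre_def simp del: atLeastAtMost_iff)
  then show "w \<in> {w. set w \<subseteq> {1..k} \<and> length w = n}" using x by simp
qed

lemma finite_lang: "finite (lang n)"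
  using lang_words finite_subset[OF _ finite_lists_length_eq[of "{1..k}" n]] by blast

lemma length_lang: "w \<in> lang n \<Longrightarrow> length w = n"
  using lang_words by auto

lemma card_lang_le: "card (lang n) \<le> k ^ n"
  using card_mono[OF finite_lists_length_eq[of "{1..k}" n] lang_words[of n]]
  by (simp add: card_lists_length_eq)

lemma space_borel_on [simp]: "space (borel_on X) = X"
  by (simp add: borel_on_def space_restrict_space)

lemma X_sets [simp]: "X \<in> sets borel"
  using closed by (rule borel_closed)

lemma sets_borel_on_iff: "A \<in> sets (borel_on X) \<longleftrightarrow> A \<subseteq> X \<and> A \<in> sets borel"
  unfolding borel_on_def by (subst sets_restrict_space_iff) auto

lemma pre_vimage_sets: "pre n -` S \<inter> X \<in> sets (borel_on X)"
proof -
  have "pre n -` S \<inter> space borel \<in> sets borel" by (rule measurable_sets[OF pre_measurable]) simp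
  then have "pre n -` S \<inter> X \<in> sets borel" using X_sets by (intro sets.Int) simp_all
  then show ?thesis by (simp add: sets_borel_on_iff)
qed

text \<open>Coordinates are functions of prefixes, so the prefix sets already make the inclusion of
  \<open>X\<close> measurable for the product Borel sets.\<close>

lemma sets_borel_on: "sets (borel_on X) = sigma_sets X {pre n -` S \<inter> X |n S. True}" (is "_ = sigma_sets X ?G")
proof (intro equalityI subsetI)
  fix A assume "A \<in> sigma_sets X ?G"
  then show "A \<in> sets (borel_on X)"
    using sets.sigma_sets_subset[of ?G "borel_on X"] pre_vimage_sets by auto
next
  fix A assume A: "A \<in> sets (borel_on X)"
  let ?S = "sigma X ?G"
  have G: "?G \<subseteq> Pow X" by auto
  have "(\<lambda>x. x i) \<in> ?S \<rightarrow>\<^sub>M count_space UNIV" for i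
  proof (rule measurableI)
    fix B :: "nat set"
    have "(\<lambda>x. x i) -` B \<inter> X = pre (Suc i) -` {w. w ! i \<in> B} \<inter> X" by auto
    also have "\<dots> \<in> ?G" by blast
    finally have "(\<lambda>x. x i) -` B \<inter> X \<in> sets ?S"
      unfolding sets_measure_of[OF G] by (rule sigma_sets.Basic)
    then show "(\<lambda>x. x i) -` B \<inter> space ?S \<in> sets ?S" using G by (simp add: space_measure_of)
  qed simp
  then have "(\<lambda>x. x) \<in> borel_measurable ?S" by (rule measurable_into_sequences)
  moreover have "A \<in> sets borel" "A \<subseteq> X" using A by (auto simp: sets_borel_on_iff)
  ultimately have "(\<lambda>x. x) -` A \<inter> space ?S \<in> sets ?S" by (intro measurable_sets)
  then show "A \<in> sigma_sets X ?G"
    using G \<open>A \<subseteq> X\<close> by (simp add: space_measure_of sets_measure_of Int_absorb2)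
qed

lemma measurable_borel_on:
  assumes "g \<in> borel_measurable M" "\<And>x. x \<in> space M \<Longrightarrow> g x \<in> X"
  shows "g \<in> M \<rightarrow>\<^sub>M borel_on X"
  unfolding borel_on_def using assms by (intro measurable_restrict_space2) auto

lemma shift_measurable_on: "shift \<in> borel_on X \<rightarrow>\<^sub>M borel_on X"
  using shift_closed unfolding borel_on_def
  by (intro measurable_restrict_space3) auto

lemma pre_measurable_on: "pre n \<in> borel_on X \<rightarrow>\<^sub>M count_space UNIV"
  unfolding borel_on_def by (intro measurable_restrict_space1) simp

lemma simple_function_pre:
  assumes M: "sets M = sets (borel_on X)"
  shows "simple_function M (pre n)"
proof -
  have sp: "space M = X" using sets_eq_imp_space_eq[OF M] by simp
  show ?thesis
    unfolding simple_function_def sp M using finite_lang[of n] pre_vimage_sets by (auto simp: lang_def)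
qed

lemma ent_pre:
  assumes M: "sets M = sets (borel_on X)"
  shows "ent M (pre n) = (\<Sum>w\<in>lang n. - (word_prob M w * ln (word_prob M w)))"
  unfolding ent_def sets_eq_imp_space_eq[OF M] space_borel_on lang_def[symmetric]
  by (intro sum.cong refl) (simp add: pr_pre length_lang)

text \<open>Prefix sets form a pi-system, because the longer of two prefixes determines the shorter
  one.\<close>

lemma measure_eqI_word_prob:
  assumes M: "prob_space M" "sets M = sets (borel_on X)" and N: "prob_space N" "sets N = sets (borel_on X)"
    and eq: "\<And>n w. w \<in> lang n \<Longrightarrow> word_prob M w = word_prob N w"
  shows "M = N"
proof (rule measure_eqI_generator_eq)
  let ?G = "{pre n -` S \<inter> X |n S. True}"
  interpret M: prob_space M by fact
  interpret N: prob_space N by fact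
  have sp: "space M = X" "space N = X" using sets_eq_imp_space_eq[OF M(2)] sets_eq_imp_space_eq[OF N(2)] by auto
  show "Int_stable ?G"
  proof (rule Int_stableI)
    fix A B assume "A \<in> ?G" "B \<in> ?G"
    then obtain n S m T where AB: "A = pre n -` S \<inter> X" "B = pre m -` T \<inter> X" by auto
    have "A \<inter> B = pre (max n m) -` {w. take n w \<in> S \<and> take m w \<in> T} \<inter> X"
      unfolding AB by (auto simp: take_pre)
    then show "A \<inter> B \<in> ?G" by blast
  qed
  show "?G \<subseteq> Pow X" by auto
  show "sets M = sigma_sets X ?G" "sets N = sigma_sets X ?G" using M(2) N(2) sets_borel_on by auto
  show "range (\<lambda>i::nat. X) \<subseteq> ?G" "(\<Union>i::nat. X) = X"
    by (auto intro!: exI[of _ 0] exI[of _ UNIV])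
  show "emeasure M X \<noteq> \<infinity>" for i :: nat by simp
  fix A assume "A \<in> ?G"
  then obtain n S where A: "A = pre n -` S \<inter> X" by auto
  have *: "measure Q A = (\<Sum>w\<in>{w \<in> lang n. w \<in> S}. word_prob Q w)"
    if Q: "finite_measure Q" "sets Q = sets (borel_on X)" for Q
  proof -
    interpret Q: finite_measure Q by fact
    have spQ: "space Q = X" using sets_eq_imp_space_eq[OF Q(2)] by simp
    have "measure Q A = pr Q (\<lambda>x. pre n x \<in> S) True"
      unfolding A pr_def spQ by (intro arg_cong[where f = "measure Q"]) auto
    also have "\<dots> = (\<Sum>w\<in>{w \<in> lang n. w \<in> S}. pr Q (pre n) w)"
      using Q.pr_comp_sum[OF simple_function_pre[OF Q(2), of n], of "\<lambda>w. w \<in> S" True]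
      by (simp add: spQ lang_def)
    finally show ?thesis by (simp add: pr_pre length_lang)
  qed
  show "emeasure M A = emeasure N A"
    unfolding M.emeasure_eq_measure N.emeasure_eq_measure
      *[OF M.finite_measure_axioms M(2)] *[OF N.finite_measure_axioms N(2)]
    by (intro arg_cong[where f = ennreal] sum.cong refl eq[of _ n]) simp
qed

lemma word_prob_append:
  assumes M: "prob_space M" "sets M = sets (borel_on X)"
  shows "word_prob M w = (\<Sum>a\<in>{1..k}. word_prob M (w @ [a]))"
proof -
  interpret prob_space M by fact
  have sp: "space M = X" using sets_eq_imp_space_eq[OF M(2)] by simp
  let ?n = "length w"
  have "word_prob M w = pr M (\<lambda>x. butlast (pre (Suc ?n) x)) w"
    unfolding word_prob_def by (intro pr_cong) (simp add: pre_Suc)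
  also have "\<dots> = (\<Sum>u\<in>{u \<in> pre (Suc ?n) ` space M. butlast u = w}. pr M (pre (Suc ?n)) u)"
    by (rule pr_comp_sum[OF simple_function_pre[OF M(2)]])
  also have "\<dots> = (\<Sum>u\<in>(\<lambda>a. w @ [a]) ` {1..k}. pr M (pre (Suc ?n)) u)"
  proof (rule sum.mono_neutral_left)
    show "{u \<in> pre (Suc ?n) ` space M. butlast u = w} \<subseteq> (\<lambda>a. w @ [a]) ` {1..k}"
    proof
      fix u assume "u \<in> {u \<in> pre (Suc ?n) ` space M. butlast u = w}"
      then obtain x where x: "x \<in> X" and u: "u = pre (Suc ?n) x" and w: "butlast u = w" by (auto simp: sp)
      have "u = w @ [x ?n]" using w unfolding u by (simp add: pre_Suc)
      then show "u \<in> (\<lambda>a. w @ [a]) ` {1..k}" using letters[OF x] by blast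
    qed
    show "\<forall>u\<in>(\<lambda>a. w @ [a]) ` {1..k} - {u \<in> pre (Suc ?n) ` space M. butlast u = w}. pr M (pre (Suc ?n)) u = 0"
      by (auto intro!: pr_outside) (metis butlast_snoc)
  qed simp
  also have "\<dots> = (\<Sum>a\<in>{1..k}. word_prob M (w @ [a]))"
    by (subst sum.reindex) (auto simp: inj_on_def pr_pre)
  finally show ?thesis .
qed

lemma word_prob_outside:
  assumes M: "sets M = sets (borel_on X)" and "w \<notin> lang (length w)"
  shows "word_prob M w = 0"
  using assms(2) sets_eq_imp_space_eq[OF M] unfolding word_prob_def by (intro pr_outside) (simp add: lang_def)

lemma word_prob_Nil:
  assumes M: "prob_space M"
  shows "word_prob M [] = 1"
proof -
  interpret prob_space M by fact
  have "pre 0 -` {[]} \<inter> space M = space M" by auto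
  then show ?thesis by (simp add: word_prob_def pr_def prob_space)
qed

lemma invariant_measures_iff:
  "M \<in> invariant_measures X \<longleftrightarrow> sets M = sets (borel_on X) \<and> measure_preserving M shift"
proof (intro iffI conjI)
  assume M: "M \<in> invariant_measures X"
  then show sets: "sets M = sets (borel_on X)" by (simp add: invariant_measures_def)
  have "shift \<in> M \<rightarrow>\<^sub>M M" using shift_measurable_on measurable_cong_sets[OF sets sets] by blast
  then show "measure_preserving M shift"
    using M by (auto simp: invariant_measures_def measure_preserving_def measure_preserving_axioms_def)
qed (auto simp: invariant_measures_def measure_preserving_def measure_preserving_axioms_def)

lemma
  assumes M: "M \<in> invariant_measures X"
  shows invariant_sets: "sets M = sets (borel_on X)" and invariant_space: "space M = X"
    and invariant_prob_space: "prob_space M" and invariant_measure_preserving: "measure_preserving M shift"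
  using M sets_eq_imp_space_eq[of M "borel_on X"] by (auto simp: invariant_measures_iff measure_preserving_def)

lemma pr_pre_shift:
  assumes M: "prob_space M" and sets: "sets M = sets (borel_on X)"
  shows "pr M (\<lambda>x. pre (length w) (shift x)) w = (\<Sum>a\<in>{1..k}. word_prob M (a # w))"
proof -
  interpret prob_space M by fact
  have sp: "space M = X" using sets_eq_imp_space_eq[OF sets] by simp
  let ?n = "length w"
  have "pr M (\<lambda>x. pre ?n (shift x)) w = pr M (\<lambda>x. tl (pre (Suc ?n) x)) w"
    by (intro pr_cong) (simp add: pre_Suc_shift)
  also have "\<dots> = (\<Sum>u\<in>{u \<in> pre (Suc ?n) ` space M. tl u = w}. pr M (pre (Suc ?n)) u)"
    by (rule pr_comp_sum[OF simple_function_pre[OF sets]])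
  also have "\<dots> = (\<Sum>u\<in>(\<lambda>a. a # w) ` {1..k}. pr M (pre (Suc ?n)) u)"
  proof (rule sum.mono_neutral_left)
    show "{u \<in> pre (Suc ?n) ` space M. tl u = w} \<subseteq> (\<lambda>a. a # w) ` {1..k}"
    proof
      fix u assume "u \<in> {u \<in> pre (Suc ?n) ` space M. tl u = w}"
      then obtain x where x: "x \<in> X" and u: "u = pre (Suc ?n) x" and w: "tl u = w" by (auto simp: sp)
      have "u = x 0 # w" using w unfolding u by (simp add: pre_Suc_shift)
      then show "u \<in> (\<lambda>a. a # w) ` {1..k}" using letters[OF x] by blast
    qed
    show "\<forall>u\<in>(\<lambda>a. a # w) ` {1..k} - {u \<in> pre (Suc ?n) ` space M. tl u = w}. pr M (pre (Suc ?n)) u = 0"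
      by (auto intro!: pr_outside) (metis list.sel(3))
  qed simp
  also have "\<dots> = (\<Sum>a\<in>{1..k}. word_prob M (a # w))"
    by (subst sum.reindex) (auto simp: inj_on_def pr_pre)
  finally show ?thesis .
qed

text \<open>The coordinate at \<open>0\<close> is a generator: its itineraries are the prefixes,
  which generate the Borel sets of \<open>X\<close>.\<close>

lemma h_eq_entropy_rate:
  assumes M: "M \<in> invariant_measures X"
  shows "h M = ereal (INF n\<in>{1..}. ent M (pre n) / real n)"
proof -
  interpret measure_preserving M shift by (rule invariant_measure_preserving[OF M])
  note sets = invariant_sets[OF M] and sp = invariant_space[OF M]
  have "simple_function M (\<lambda>x. hd (pre 1 x))"
    using simple_function_compose[OF simple_function_pre[OF sets, of 1], of hd] by (simp add: comp_def)
  then have f: "simple_function M (\<lambda>x. x 0)" by (simp add: pre_def)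
  have "itinerary_sets (\<lambda>x. x 0) = {pre n -` S \<inter> X |n S. True}"
    by (simp add: itinerary_sets_def pre_eq_itinerary sp)
  then have "KS_entropy M shift = ereal (entropy_rate (\<lambda>x. x 0))"
    using sets sets_borel_on sp by (intro KS_entropy_generator[OF f]) simp
  then show ?thesis by (simp add: entropy_rate_def pre_eq_itinerary)
qed

text \<open>What the word probabilities of an invariant measure on \<open>X\<close> satisfy: summing
  over a last letter is Kolmogorov consistency, summing over a first letter is invariance, and
  vanishing outside the language confines the measure to \<open>X\<close>.\<close>

definition consistent :: "(nat list \<Rightarrow> real) \<Rightarrow> bool" where
  "consistent c \<longleftrightarrow> (\<forall>w. 0 \<le> c w) \<and> c [] = 1 \<and> (\<forall>w. w \<notin> lang (length w) \<longrightarrow> c w = 0)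
    \<and> (\<forall>w. c w = (\<Sum>a\<in>{1..k}. c (w @ [a]))) \<and> (\<forall>w. c w = (\<Sum>a\<in>{1..k}. c (a # w)))"

end

section \<open>Measures with prescribed word probabilities\<close>

primrec random_word :: "(nat list \<Rightarrow> nat) \<Rightarrow> nat \<Rightarrow> nat list" where
  "random_word \<xi> 0 = []"
| "random_word \<xi> (Suc n) = random_word \<xi> n @ [\<xi> (random_word \<xi> n)]"

lemma length_random_word [simp]: "length (random_word \<xi> n) = n"
  by (induction n) auto

lemma pre_random_word: "pre n (\<lambda>i. \<xi> (random_word \<xi> i)) = random_word \<xi> n"
  by (induction n) (auto simp: pre_Suc)

lemma random_word_eq_iff:
  assumes "length w = n"
  shows "random_word \<xi> n = w \<longleftrightarrow> (\<forall>i<n. \<xi> (take i w) = w ! i)"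
  using assms
proof (induction n arbitrary: w)
  case (Suc n)
  then obtain u a where w: "w = u @ [a]" "length u = n"
    by (metis length_Suc_conv_rev)
  have "random_word \<xi> (Suc n) = w \<longleftrightarrow> random_word \<xi> n = u \<and> \<xi> u = a"
    unfolding w by auto
  also have "\<dots> \<longleftrightarrow> (\<forall>i<n. \<xi> (take i u) = u ! i) \<and> \<xi> u = a" by (simp add: Suc.IH[OF w(2)])
  also have "\<dots> \<longleftrightarrow> (\<forall>i<Suc n. \<xi> (take i w) = w ! i)"
    using w(2) by (auto simp: w(1) less_Suc_eq nth_append)
  finally show ?case .
qed simp

text \<open>Independent letters \<open>\<xi> w\<close> with law \<open>c (w @ [_]) / c w\<close>, one for every word \<open>w\<close>, give a random
  sequence by always reading the letter that belongs to the word produced so far.\<close>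

lemma exists_measure_with_word_probs:
  fixes c :: "nat list \<Rightarrow> real"
  assumes nonneg: "\<And>w. 0 \<le> c w" and Nil: "c [] = 1" and A: "finite A" "A \<noteq> {}"
    and outside: "\<And>w a. a \<notin> A \<Longrightarrow> c (w @ [a]) = 0"
    and append: "\<And>w. c w = (\<Sum>a\<in>A. c (w @ [a]))"
  shows "\<exists>N :: (nat \<Rightarrow> nat) measure. prob_space N \<and> sets N = sets borel \<and>
    (\<forall>w. measure N {x. pre (length w) x = w} = c w)"
proof -
  \<comment> \<open>After a word of probability \<open>0\<close> there is no conditional law to
    copy; the uniform law on \<open>A\<close> stands in, so that every \<open>f w\<close> is a
    probability distribution.\<close>
  define f where "f w a = (if a \<in> A then if c w = 0 then 1 / real (card A) else c (w @ [a]) / c w else 0)" for w a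
  define q where "q w = embed_pmf (f w)" for w
  have f_nonneg: "0 \<le> f w a" for w a using nonneg by (simp add: f_def)
  have pmf_q: "pmf (q w) a = f w a" for w a
    unfolding q_def
  proof (rule pmf_embed_pmf[OF f_nonneg])
    have "(\<integral>\<^sup>+ a. ennreal (f w a) \<partial>count_space UNIV) = (\<Sum>a\<in>A. ennreal (f w a))"
      using A by (intro nn_integral_count_space') (auto simp: f_def)
    also have "\<dots> = ennreal (\<Sum>a\<in>A. f w a)" using f_nonneg by simp
    also have "(\<Sum>a\<in>A. f w a) = 1"
      using A append[of w] by (cases "c w = 0") (simp_all add: f_def sum_divide_distrib[symmetric])
    finally show "(\<integral>\<^sup>+ a. ennreal (f w a) \<partial>count_space UNIV) = 1" by simp
  qed
  have c_f: "c (w @ [a]) = c w * f w a" for w a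
  proof (cases "c w = 0 \<and> a \<in> A")
    case True
    then have "c (w @ [a]) = 0"
      using append[of w] sum_nonneg_eq_0_iff[OF A(1), of "\<lambda>a. c (w @ [a])"] nonneg by auto
    then show ?thesis using True by simp
  qed (auto simp: f_def outside)
  have c_prod: "(\<Prod>i<length w. f (take i w) (w ! i)) = c w" for w
  proof (induction w rule: rev_induct)
    case (snoc a w)
    have "(\<Prod>i<length w. f (take i (w @ [a])) ((w @ [a]) ! i)) = (\<Prod>i<length w. f (take i w) (w ! i))"
      by (intro prod.cong) (auto simp: nth_append)
    then show ?case using snoc by (simp add: c_f)
  qed (simp add: Nil)
  interpret P: product_prob_space "\<lambda>w. measure_pmf (q w)" "UNIV :: nat list set" ..
  let ?P = "PiM UNIV (\<lambda>w. measure_pmf (q w))"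
  have P_space: "space ?P = UNIV" by (simp add: space_PiM)
  have comp: "(\<lambda>\<xi>. \<xi> w) \<in> ?P \<rightarrow>\<^sub>M count_space UNIV" for w
    using measurable_component_singleton[of w UNIV "\<lambda>w. measure_pmf (q w)"] by simp
  have rw: "(\<lambda>\<xi>. random_word \<xi> n) \<in> ?P \<rightarrow>\<^sub>M count_space UNIV" for n
  proof (induction n)
    case (Suc n)
    have "(\<lambda>\<xi>. u @ [a]) \<in> ?P \<rightarrow>\<^sub>M count_space UNIV" for u :: "nat list" and a by simp
    then have "(\<lambda>\<xi>. u @ [\<xi> u]) \<in> ?P \<rightarrow>\<^sub>M count_space UNIV" for u
      by (rule measurable_compose_countable[OF _ comp])
    then show ?case unfolding random_word.simps by (rule measurable_compose_countable[OF _ Suc])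
  qed simp
  have emb: "prod_emb UNIV (\<lambda>w. measure_pmf (q w)) J (PiE J (\<lambda>u. {g u})) = {\<xi>. \<forall>u\<in>J. \<xi> u = g u}" for J g
    by (rule set_eqI) (simp add: prod_emb_iff PiE_iff)
  let ?path = "\<lambda>\<xi> i. \<xi> (random_word \<xi> i)"
  have path: "?path \<in> ?P \<rightarrow>\<^sub>M borel"
    by (intro measurable_into_sequences measurable_compose_countable[OF comp rw])
  show ?thesis
  proof (intro exI conjI allI)
    show "prob_space (distr ?P borel ?path)" by (rule P.prob_space_distr[OF path])
    show "sets (distr ?P borel ?path) = sets borel" by simp
    fix w :: "nat list"
    let ?n = "length w" and ?J = "(\<lambda>i. take i w) ` {..<length w}"
    have inj: "inj_on (\<lambda>i. take i w) {..<length w}"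
      by (rule inj_onI) (metis length_take lessThan_iff min.absorb4)
    note meas = pre_eq_borel[of ?n w]
    have "measure (distr ?P borel ?path) {x. pre ?n x = w} = measure ?P (?path -` {x. pre ?n x = w} \<inter> space ?P)"
      by (rule measure_distr[OF path meas])
    also have "?path -` {x. pre ?n x = w} \<inter> space ?P = {\<xi>. \<forall>i<length w. \<xi> (take i w) = w ! i}"
      unfolding P_space by (simp add: pre_random_word random_word_eq_iff[OF refl] vimage_def)
    \<comment> \<open>The proper prefixes of \<open>w\<close> are distinct and their lengths recover
      the positions, so the event fixes finitely many independent letters.\<close>
    also have "\<dots> = {\<xi>. \<forall>u\<in>?J. \<xi> u = w ! length u}" by auto
    also have "\<dots> = prod_emb UNIV (\<lambda>w. measure_pmf (q w)) ?J (PiE ?J (\<lambda>u. {w ! length u}))"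
      by (rule emb[symmetric])
    also have "measure ?P \<dots> = (\<Prod>u\<in>?J. measure (measure_pmf (q u)) {w ! length u})"
      by (rule P.measure_PiM_emb) auto
    also have "\<dots> = (\<Prod>i<length w. f (take i w) (w ! i))"
      by (subst prod.reindex[OF inj]) (simp add: measure_pmf_single pmf_q)
    also have "\<dots> = c w" by (rule c_prod)
    finally show "measure (distr ?P borel ?path) {x. pre ?n x = w} = c w" .
  qed
qed

lemma tendsto_fun_componentwise:
  fixes f :: "'a \<Rightarrow> 'b \<Rightarrow> 'c::topological_space"
  assumes "\<And>i. ((\<lambda>n. f n i) \<longlongrightarrow> x i) F"
  shows "(f \<longlongrightarrow> x) F"
  using assms limitin_componentwise[of "\<lambda>_. euclidean" UNIV f x F]
  by (simp add: euclidean_product_topology)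

context one_sided_subshift
begin

text \<open>Points of \<open>X\<close> that share longer and longer prefixes with \<open>x\<close>
  converge to \<open>x\<close>, and \<open>X\<close> is closed.\<close>

lemma closed_eq_all_prefixes:
  assumes "\<And>n. pre n x \<in> lang n"
  shows "x \<in> X"
proof -
  have "\<forall>n. \<exists>y\<in>X. pre n y = pre n x"
  proof
    fix n
    obtain y where "y \<in> X" "pre n x = pre n y" using assms[of n] unfolding lang_def by blast
    then show "\<exists>y\<in>X. pre n y = pre n x" by (intro bexI[of _ y]) simp_all
  qed
  then obtain y where y: "\<And>n. y n \<in> X" "\<And>n. pre n (y n) = pre n x" by metis
  have "(\<lambda>n. y n i) \<longlonglongrightarrow> x i" for i
  proof (rule tendsto_eventually)
    have "y n i = x i" if "n > i" for n using y(2)[of n] that by (simp add: pre_eq_iff)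
    then show "\<forall>\<^sub>F n in sequentially. y n i = x i"
      unfolding eventually_sequentially by (intro exI[of _ "Suc i"]) simp
  qed
  then have "y \<longlonglongrightarrow> x" by (rule tendsto_fun_componentwise)
  then show ?thesis using closed_sequentially[OF closed] y(1) by blast
qed

text \<open>The measure is first built on all sequences. There are countably many words, and those
  outside the language have probability \<open>0\<close>, so almost every sequence has all its
  prefixes in the language and hence lies in \<open>X\<close>. Invariance is then checked on
  cylinders.\<close>

lemma exists_invariant_measure:
  assumes c: "consistent c"
  obtains M where "M \<in> invariant_measures X" "word_prob M = c"
proof -
  have nonneg: "0 \<le> c w" and Nil: "c [] = 1" and out: "w \<notin> lang (length w) \<Longrightarrow> c w = 0"
    and append: "c w = (\<Sum>a\<in>{1..k}. c (w @ [a]))" and Cons: "c w = (\<Sum>a\<in>{1..k}. c (a # w))" for w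
    using c unfolding consistent_def by blast+
  have out': "c (w @ [a]) = 0" if "a \<notin> {1..k}" for w a
    using lang_words[of "length (w @ [a])"] that by (intro out) auto
  have fin: "finite {1..k}" "{1..k} \<noteq> {}" using k_pos by auto
  obtain N :: "(nat \<Rightarrow> nat) measure" where N: "prob_space N" "sets N = sets borel"
    "\<And>w. measure N {x. pre (length w) x = w} = c w"
    using exists_measure_with_word_probs[of c "{1..k}", OF nonneg Nil fin out' append] by blast
  interpret N: prob_space N by fact
  have spN: "space N = UNIV" using sets_eq_imp_space_eq[OF N(2)] by simp
  have Ncyl: "{x. pre (length w) x = w} \<in> sets N" for w
    using pre_eq_borel N(2) by simp
  have AE_X: "AE x in N. x \<in> X"
  proof -
    have "AE x in N. \<forall>w. w \<notin> lang (length w) \<longrightarrow> pre (length w) x \<noteq> w"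
      unfolding AE_all_countable
    proof (intro allI)
      fix w :: "nat list"
      show "AE x in N. w \<notin> lang (length w) \<longrightarrow> pre (length w) x \<noteq> w"
      proof (cases "w \<in> lang (length w)")
        case False
        have "measure N {x. pre (length w) x = w} = 0" unfolding N(3)[rule_format] by (rule out[OF False])
        then have "emeasure N {x. pre (length w) x = w} = 0" unfolding N.emeasure_eq_measure by simp
        then have "{x. pre (length w) x = w} \<in> null_sets N" using Ncyl[of w] by (rule null_setsI)
        then show ?thesis by (rule AE_I') auto
      qed simp
    qed
    then show ?thesis
    proof eventually_elim
      case (elim x)
      have "pre n x \<in> lang n" for n using elim[rule_format, of "pre n x"] by auto
      then show ?case by (rule closed_eq_all_prefixes)
    qed
  qed
  then have N_X: "emeasure N X = 1"
    using N.AE_in_set_eq_1[of X] N(2) by (simp add: N.emeasure_eq_measure)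
  define M where "M = restrict_space N X"
  have XN: "X \<inter> space N \<in> sets N" using N(2) spN by simp
  have M_prob: "prob_space M"
    unfolding M_def using N_X N(2) by (intro prob_space_restrict_space) auto
  have M_sets: "sets M = sets (borel_on X)"
    unfolding M_def borel_on_def by (rule sets_restrict_space_cong[OF N(2)])
  have M_space: "space M = X" using sets_eq_imp_space_eq[OF M_sets] by simp
  have wp: "word_prob M w = c w" for w
  proof -
    have "word_prob M w = measure N ({x. pre (length w) x = w} \<inter> X)"
      unfolding word_prob_def pr_def M_space vimage_def
      unfolding M_def using XN by (subst measure_restrict_space) auto
    also have "\<dots> = measure N {x. pre (length w) x = w}"
    proof (rule N.finite_measure_eq_AE)
      show "AE x in N. (x \<in> {x. pre (length w) x = w} \<inter> X) = (x \<in> {x. pre (length w) x = w})"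
        using AE_X by eventually_elim simp
      show "{x. pre (length w) x = w} \<inter> X \<in> sets N"
        unfolding N(2) using Ncyl[of w] N(2) by (intro sets.Int) simp_all
    qed (rule Ncyl)
    also have "\<dots> = c w" by (rule N(3)[rule_format])
    finally show ?thesis .
  qed
  have meas: "shift \<in> M \<rightarrow>\<^sub>M M"
    using shift_measurable_on measurable_cong_sets[OF M_sets M_sets] by blast
  interpret M: prob_space M by (rule M_prob)
  have "distr M M shift = M"
  proof (rule measure_eqI_word_prob)
    show "prob_space (distr M M shift)" by (rule M.prob_space_distr[OF meas])
    fix n w assume "w \<in> lang n"
    have "word_prob (distr M M shift) w = measure M (shift -` (pre (length w) -` {w} \<inter> X) \<inter> X)"
      unfolding word_prob_def pr_def using pre_vimage_sets[of "length w" "{w}"] M_sets M_space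
      by (simp add: measure_distr[OF meas])
    also have "shift -` (pre (length w) -` {w} \<inter> X) \<inter> X
        = (\<Union>a\<in>{1..k}. pre (Suc (length w)) -` {a # w} \<inter> X)"
    proof (intro equalityI subsetI)
      fix x assume "x \<in> shift -` (pre (length w) -` {w} \<inter> X) \<inter> X"
      then have "x \<in> pre (Suc (length w)) -` {x 0 # w} \<inter> X" "x 0 \<in> {1..k}"
        using letters[of x 0] by (simp_all add: pre_Suc_shift)
      then show "x \<in> (\<Union>a\<in>{1..k}. pre (Suc (length w)) -` {a # w} \<inter> X)" by blast
    next
      fix x assume "x \<in> (\<Union>a\<in>{1..k}. pre (Suc (length w)) -` {a # w} \<inter> X)"
      then show "x \<in> shift -` (pre (length w) -` {w} \<inter> X) \<inter> X"
        using shift_closed[of x] by (auto simp: pre_Suc_shift)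
    qed
    also have "measure M \<dots> = (\<Sum>a\<in>{1..k}. measure M (pre (Suc (length w)) -` {a # w} \<inter> X))"
      using pre_vimage_sets M_sets by (intro M.finite_measure_finite_Union) (auto simp: disjoint_family_on_def)
    also have "\<dots> = (\<Sum>a\<in>{1..k}. word_prob M (a # w))"
      by (simp add: word_prob_def pr_def M_space)
    also have "\<dots> = word_prob M w" unfolding wp by (rule Cons[symmetric])
    finally show "word_prob (distr M M shift) w = word_prob M w" .
  qed (use M_prob M_sets in simp_all)
  then have "M \<in> invariant_measures X"
    unfolding invariant_measures_def using M_prob M_sets by simp
  then show thesis using that wp by blast
qed

end

section \<open>A maximal ergodic inequality\<close>

lemma (in prob_space) integrable_bounded:
  fixes f :: "'a \<Rightarrow> real"
  assumes "f \<in> borel_measurable M" "\<And>x. x \<in> space M \<Longrightarrow> \<bar>f x\<bar> \<le> B"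
  shows "integrable M f"
  using assms by (intro integrable_const_bound[where B = B]) auto

context measure_preserving
begin

lemma integral_comp:
  fixes f :: "'a \<Rightarrow> real"
  assumes "f \<in> borel_measurable M"
  shows "(\<integral>x. f (T x) \<partial>M) = (\<integral>x. f x \<partial>M)"
  using integral_distr[OF T_meas, of f] assms T_distr by simp

text \<open>\<open>f\<close> and \<open>f \<circ> T\<close> have the same integral, so their
  nonnegative difference vanishes almost everywhere.\<close>

lemma AE_invariant_of_le:
  fixes f :: "'a \<Rightarrow> real"
  assumes f: "f \<in> borel_measurable M" and B: "\<And>x. x \<in> space M \<Longrightarrow> \<bar>f x\<bar> \<le> B"
    and le: "\<And>x. x \<in> space M \<Longrightarrow> f x \<le> f (T x)"
  shows "AE x in M. f (T x) = f x"
proof -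
  have fT: "(\<lambda>x. f (T x)) \<in> borel_measurable M" by (rule measurable_compose[OF T_meas f])
  have int: "integrable M f" "integrable M (\<lambda>x. f (T x))"
    using B measurable_space[OF T_meas] by (auto intro!: integrable_bounded[of _ B] f fT)
  have "(\<integral>x. f (T x) - f x \<partial>M) = 0" using int integral_comp[OF f] by simp
  then have "AE x in M. f (T x) - f x = 0"
    using int le by (subst (asm) integral_nonneg_eq_0_iff_AE) auto
  then show ?thesis by eventually_elim simp
qed

text \<open>The maximum of the Birkhoff sums of lengths \<open>0\<close> to \<open>n\<close>, in the
  recursive form that Garsia's argument exploits.\<close>

primrec maximal_sum :: "('a \<Rightarrow> real) \<Rightarrow> nat \<Rightarrow> 'a \<Rightarrow> real" where
  "maximal_sum G 0 x = 0"
| "maximal_sum G (Suc n) x = max 0 (G x + maximal_sum G n (T x))"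

lemma maximal_sum_nonneg: "0 \<le> maximal_sum G n x"
  by (cases n) auto

lemma maximal_sum_mono: "maximal_sum G n x \<le> maximal_sum G (Suc n) x"
proof (induction n arbitrary: x)
  case (Suc n)
  have "max 0 (G x + maximal_sum G n (T x)) \<le> max 0 (G x + maximal_sum G (Suc n) (T x))"
    using Suc.IH[of "T x"] by (intro max.mono add_left_mono order_refl)
  then show ?case by (simp only: maximal_sum.simps(2))
qed simp

lemma birkhoff_sum_le_maximal_sum: "(\<Sum>i<n. G ((T ^^ i) x)) \<le> maximal_sum G n x"
proof (induction n arbitrary: x)
  case (Suc n)
  have "(\<Sum>i<Suc n. G ((T ^^ i) x)) = G x + (\<Sum>i<n. G ((T ^^ i) (T x)))"
    by (subst sum.lessThan_Suc_shift) (simp add: funpow_swap1)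
  then show ?case using Suc[of "T x"] by simp
qed simp

lemma maximal_sum_measurable:
  assumes [measurable]: "G \<in> borel_measurable M"
  shows "maximal_sum G n \<in> borel_measurable M"
proof (induction n)
  case (Suc n)
  then have [measurable]: "(\<lambda>x. maximal_sum G n (T x)) \<in> borel_measurable M"
    by (rule measurable_compose[OF T_meas])
  show ?case by simp
qed simp

lemma maximal_sum_le:
  assumes "\<And>x. x \<in> space M \<Longrightarrow> \<bar>G x\<bar> \<le> B" "x \<in> space M" "0 \<le> B"
  shows "maximal_sum G n x \<le> real n * B"
  using assms(2)
proof (induction n arbitrary: x)
  case (Suc n)
  have "T x \<in> space M" using measurable_space[OF T_meas] Suc.prems .
  then show ?case using Suc.IH[of "T x"] assms(1)[OF Suc.prems] assms(3) by (simp add: algebra_simps)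
qed simp

text \<open>Garsia's argument: where \<open>maximal_sum G (Suc n)\<close> is positive, it is at most
  \<open>G + maximal_sum G (Suc n) \<circ> T\<close>.\<close>

lemma integral_nonneg_if_birkhoff_sum_pos:
  fixes G :: "'a \<Rightarrow> real"
  assumes G: "G \<in> borel_measurable M" and B: "\<And>x. x \<in> space M \<Longrightarrow> \<bar>G x\<bar> \<le> B"
    and pos: "AE x in M. \<exists>n. 0 < (\<Sum>i<n. G ((T ^^ i) x))"
  shows "0 \<le> (\<integral>x. G x \<partial>M)"
proof -
  obtain x0 where "x0 \<in> space M" using not_empty by blast
  then have B0: "0 \<le> B" using B[of x0] abs_ge_zero[of "G x0"] by linarith
  note meas = maximal_sum_measurable[OF G]
  let ?m = "maximal_sum G" and ?E = "\<lambda>n. {x \<in> space M. 0 < maximal_sum G n x}"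
  have E: "?E n \<in> sets M" for n using meas by measurable
  have G_int: "integrable M (\<lambda>x. indicator (?E n) x * G x)" for n
    using B B0 G E by (intro integrable_bounded[of _ B]) (auto simp: indicator_def)
  have "0 \<le> (\<integral>x. indicator (?E (Suc n)) x * G x \<partial>M)" for n
  proof -
    have m: "\<bar>?m (Suc n) x\<bar> \<le> real (Suc n) * B" if "x \<in> space M" for x
    proof -
      have "?m (Suc n) x \<le> real (Suc n) * B" by (rule maximal_sum_le[where G = G, OF B that B0])
      then show ?thesis using maximal_sum_nonneg[of G "Suc n" x] by (simp del: maximal_sum.simps)
    qed
    have mT: "(\<lambda>x. ?m (Suc n) (T x)) \<in> borel_measurable M"
      by (rule measurable_compose[OF T_meas meas])
    have int: "integrable M (?m (Suc n))" "integrable M (\<lambda>x. ?m (Suc n) (T x))"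
      using m measurable_space[OF T_meas] by (intro integrable_bounded[of _ "real (Suc n) * B"] meas mT; blast)+
    have "0 = (\<integral>x. ?m (Suc n) x - ?m (Suc n) (T x) \<partial>M)"
      using int integral_comp[OF meas[where n = "Suc n"]] by (subst Bochner_Integration.integral_diff) (simp_all del: maximal_sum.simps)
    also have "\<dots> \<le> (\<integral>x. indicator (?E (Suc n)) x * G x \<partial>M)"
    proof (rule integral_mono[OF Bochner_Integration.integrable_diff[OF int] G_int])
      fix x assume x: "x \<in> space M"
      show "?m (Suc n) x - ?m (Suc n) (T x) \<le> indicator (?E (Suc n)) x * G x"
      proof (cases "0 < ?m (Suc n) x")
        case True
        then have "?m (Suc n) x = G x + ?m n (T x)" by (simp add: max_def split: if_splits)
        then show ?thesis using True x maximal_sum_mono[of G n "T x"] by (simp del: maximal_sum.simps)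
      next
        case False
        then show ?thesis using maximal_sum_nonneg[of G "Suc n" "T x"] by (simp del: maximal_sum.simps)
      qed
    qed
    finally show ?thesis .
  qed
  \<comment> \<open>By \<open>pos\<close> the sets \<open>?E n\<close> increase to almost all of the
    space, so the restriction to them disappears in the limit.\<close>
  moreover have "(\<lambda>n. \<integral>x. indicator (?E (Suc n)) x * G x \<partial>M) \<longlonglongrightarrow> (\<integral>x. G x \<partial>M)"
  proof (rule integral_dominated_convergence[where w = "\<lambda>_. B"])
    show "AE x in M. (\<lambda>n. indicator (?E (Suc n)) x * G x) \<longlonglongrightarrow> G x"
      using pos AE_space
    proof eventually_elim
      case (elim x)
      then obtain n where "0 < (\<Sum>i<n. G ((T ^^ i) x))" by auto
      then have "0 < ?m n x" using birkhoff_sum_le_maximal_sum[of G x n] by linarith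
      then have "0 < ?m j x" if "n \<le> j" for j
        using lift_Suc_mono_le[of "\<lambda>n. ?m n x", OF maximal_sum_mono that] by linarith
      then have "\<forall>\<^sub>F j in sequentially. indicator (?E (Suc j)) x * G x = G x"
        unfolding eventually_sequentially using elim(2)
        by (intro exI[of _ n]) (auto simp: indicator_def simp del: maximal_sum.simps)
      then show ?case by (rule tendsto_eventually)
    qed
    show "AE x in M. norm (indicator (?E (Suc n)) x * G x) \<le> B" for n
      using AE_space by eventually_elim (auto simp: indicator_def B B0)
    show "(\<lambda>x. indicator (?E (Suc n)) x * G x) \<in> borel_measurable M" for n
      by (rule borel_measurable_integrable[OF G_int])
  qed (use G in simp_all)
  ultimately show ?thesis by (intro LIMSEQ_le_const) auto
qed

text \<open>As \<open>f\<close> is almost everywhere constant along orbits, the Birkhoff sums of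
  \<open>G = g - f + e\<close> are those of \<open>g\<close> minus \<open>n * (f x - e)\<close>. The
  hypothesis \<open>avg\<close> with \<open>e / 2\<close> leaves the positive surplus
  \<open>n * (e / 2)\<close>, so the maximal inequality applies to \<open>G\<close>.\<close>

lemma integral_le_if_birkhoff_averages:
  fixes f g :: "'a \<Rightarrow> real"
  assumes f: "f \<in> borel_measurable M" and g: "g \<in> borel_measurable M"
    and B: "\<And>x. x \<in> space M \<Longrightarrow> \<bar>f x\<bar> \<le> B" "\<And>x. x \<in> space M \<Longrightarrow> \<bar>g x\<bar> \<le> B"
    and le: "\<And>x. x \<in> space M \<Longrightarrow> f x \<le> f (T x)"
    and avg: "\<And>x e. x \<in> space M \<Longrightarrow> 0 < e \<Longrightarrow> \<exists>n\<ge>1. real n * (f x - e) \<le> (\<Sum>i<n. g ((T ^^ i) x))"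
  shows "(\<integral>x. f x \<partial>M) \<le> (\<integral>x. g x \<partial>M)"
proof (rule field_le_epsilon)
  fix e :: real assume e: "0 < e"
  define G where "G x = g x - f x + e" for x
  have Gm: "G \<in> borel_measurable M" unfolding G_def using f g by simp
  have int: "integrable M f" "integrable M g" using f g B by (auto intro!: integrable_bounded[of _ B])
  have "0 \<le> (\<integral>x. G x \<partial>M)"
  proof (rule integral_nonneg_if_birkhoff_sum_pos[OF Gm])
    show "\<bar>G x\<bar> \<le> B + B + e" if "x \<in> space M" for x
      using B(1)[OF that] B(2)[OF that] e unfolding G_def by linarith
    have "AE x in M. \<forall>i. f ((T ^^ i) x) = f x"
      unfolding AE_all_countable
    proof
      fix i
      interpret Ti: measure_preserving M "T ^^ i" by (rule funpow_measure_preserving)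
      have "f x \<le> f ((T ^^ i) x)" if "x \<in> space M" for x
      proof (induction i)
        case (Suc i)
        have "(T ^^ i) x \<in> space M" using measurable_space[OF funpow_measurable that] .
        from le[OF this] Suc show ?case by simp
      qed simp
      then show "AE x in M. f ((T ^^ i) x) = f x" by (intro Ti.AE_invariant_of_le[OF f B(1)])
    qed
    then show "AE x in M. \<exists>n. 0 < (\<Sum>i<n. G ((T ^^ i) x))"
      using AE_space
    proof eventually_elim
      case (elim x)
      obtain n where n: "n \<ge> 1" "real n * (f x - e / 2) \<le> (\<Sum>i<n. g ((T ^^ i) x))"
        using avg[OF elim(2), of "e / 2"] e by auto
      have "(\<Sum>i<n. G ((T ^^ i) x)) = (\<Sum>i<n. g ((T ^^ i) x)) - real n * (f x - e)"
        unfolding G_def using elim(1) by (simp add: sum.distrib sum_subtractf algebra_simps)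
      also have "\<dots> \<ge> real n * (e / 2)" using n by (simp add: algebra_simps)
      finally have "real n * (e / 2) \<le> (\<Sum>i<n. G ((T ^^ i) x))" .
      moreover have "0 < real n * (e / 2)" using n e by simp
      ultimately show ?case by (intro exI[of _ n]) linarith
    qed
  qed
  also have "(\<integral>x. G x \<partial>M) = (\<integral>x. g x \<partial>M) - (\<integral>x. f x \<partial>M) + e"
    unfolding G_def using int by (simp add: prob_space)
  finally show "(\<integral>x. f x \<partial>M) \<le> (\<integral>x. g x \<partial>M) + e" by simp
qed

end

text \<open>Uniform bounds keep the upper limit in \<open>ereal\<close> finite, so its conversion to
  a real retains the usual characterisation.\<close>

lemma real_limsup_facts:
  fixes a :: "nat \<Rightarrow> real"
  assumes a: "\<And>n. 0 \<le> a n" "\<And>n. a n \<le> B"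
  defines "L \<equiv> real_of_ereal (limsup (\<lambda>n. ereal (a n)))"
  shows "0 \<le> L" "L \<le> B" "e > 0 \<Longrightarrow> \<forall>\<^sub>F n in sequentially. a n < L + e"
    "e > 0 \<Longrightarrow> \<exists>\<^sub>F n in sequentially. L - e < a n"
    "\<forall>\<^sub>F n in sequentially. a n \<le> c \<Longrightarrow> L \<le> c"
proof -
  let ?S = "limsup (\<lambda>n. ereal (a n))"
  have "?S \<le> ereal B" using a by (intro Limsup_bounded) auto
  moreover have "ereal 0 \<le> ?S" using a by (intro le_Limsup) auto
  ultimately have S: "?S = ereal L" unfolding L_def by (cases ?S) auto
  show "0 \<le> L" "L \<le> B" using \<open>?S \<le> ereal B\<close> \<open>ereal 0 \<le> ?S\<close> S by auto
  show "\<forall>\<^sub>F n in sequentially. a n < L + e" if "e > 0"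
    using Limsup_lessD[of sequentially "\<lambda>n. ereal (a n)" "ereal (L + e)"] S that by simp
  show L: "L \<le> c" if "\<forall>\<^sub>F n in sequentially. a n \<le> c" for c
    using Limsup_bounded[of "\<lambda>n. ereal (a n)" "ereal c" sequentially] S that by simp
  show "\<exists>\<^sub>F n in sequentially. L - e < a n" if "e > 0"
  proof (rule ccontr)
    assume "\<not> (\<exists>\<^sub>F n in sequentially. L - e < a n)"
    then have "\<forall>\<^sub>F n in sequentially. a n \<le> L - e" by (simp add: frequently_def not_less)
    then show False using L[of "L - e"] that by simp
  qed
qed

section \<open>Factor maps and the growth of fibres\<close>

lemma (in finite_measure) integral_simple_function:
  fixes \<psi> :: "'b \<Rightarrow> real"
  assumes g: "simple_function M g"
  shows "(\<integral>x. \<psi> (g x) \<partial>M) = (\<Sum>v\<in>g ` space M. pr M g v * \<psi> v)"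
proof -
  have fin: "finite (g ` space M)" using g by (simp add: simple_function_def)
  note sets = simple_function_sets[OF g]
  have "(\<integral>x. \<psi> (g x) \<partial>M) = (\<integral>x. (\<Sum>v\<in>g ` space M. indicator (g -` {v} \<inter> space M) x * \<psi> v) \<partial>M)"
  proof (rule Bochner_Integration.integral_cong[OF refl])
    fix x assume x: "x \<in> space M"
    have "(\<Sum>v\<in>g ` space M. indicator (g -` {v} \<inter> space M) x * \<psi> v)
        = (\<Sum>v\<in>g ` space M. if v = g x then \<psi> v else 0)"
      using x by (intro sum.cong) (auto simp: indicator_def)
    also have "\<dots> = \<psi> (g x)" using fin x by (simp add: sum.delta)
    finally show "\<psi> (g x) = (\<Sum>v\<in>g ` space M. indicator (g -` {v} \<inter> space M) x * \<psi> v)" ..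
  qed
  also have "\<dots> = (\<Sum>v\<in>g ` space M. \<integral>x. indicator (g -` {v} \<inter> space M) x * \<psi> v \<partial>M)"
    using sets by (intro Bochner_Integration.integral_sum integrable_mult_left) (simp add: emeasure_eq_measure)
  also have "\<dots> = (\<Sum>v\<in>g ` space M. pr M g v * \<psi> v)"
    using sets by (intro sum.cong) (simp_all add: pr_def)
  finally show ?thesis .
qed

lemma tendsto_fun_iff:
  fixes f :: "'a \<Rightarrow> 'b \<Rightarrow> 'c::topological_space"
  shows "(f \<longlongrightarrow> x) F \<longleftrightarrow> (\<forall>i. ((\<lambda>n. f n i) \<longlongrightarrow> x i) F)"
  using limitin_componentwise[of "\<lambda>_. euclidean" UNIV f x F]
  by (simp add: euclidean_product_topology)

locale factor = X: one_sided_subshift k X + Y: one_sided_subshift l Y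
  for k l :: nat and X Y :: "(nat \<Rightarrow> nat) set" +
  fixes p :: "(nat \<Rightarrow> nat) \<Rightarrow> (nat \<Rightarrow> nat)"
  assumes factor_map: "factor_map X Y p" and one_block: "one_block X p"
begin

lemma p_in: "x \<in> X \<Longrightarrow> p x \<in> Y" and p_surj: "y \<in> Y \<Longrightarrow> \<exists>x\<in>X. p x = y"
  and p_shift: "x \<in> X \<Longrightarrow> p (shift x) = shift (p x)"
  using factor_map by (auto simp: factor_map_def)

lemma p_funpow_shift: "x \<in> X \<Longrightarrow> p ((shift ^^ i) x) = (shift ^^ i) (p x)"
  by (induction i) (simp_all add: p_shift X.funpow_shift_closed)

text \<open>The letter code behind \<open>p\<close>, read off at coordinate \<open>0\<close> of some
  point of \<open>X\<close> that starts with \<open>a\<close>; equivariance carries it to all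
  coordinates.\<close>

definition letter_map :: "nat \<Rightarrow> nat" where
  "letter_map a = p (SOME x. x \<in> X \<and> x 0 = a) 0"

lemma p_letter:
  assumes x: "x \<in> X"
  shows "p x i = letter_map (x i)"
proof -
  let ?z = "(shift ^^ i) x" and ?s = "SOME z. z \<in> X \<and> z 0 = x i"
  have z: "?z \<in> X \<and> ?z 0 = x i" using X.funpow_shift_closed[OF x, of i] by (simp add: funpow_shift)
  then have s: "?s \<in> X \<and> ?s 0 = x i" by (rule someI[where P = "\<lambda>z. z \<in> X \<and> z 0 = x i"])
  have "p x i = p ?z 0" unfolding p_funpow_shift[OF x] by (simp add: funpow_shift)
  also have "\<dots> = p ?s 0" using one_block z s by (simp add: one_block_def)
  finally show ?thesis by (simp add: letter_map_def)
qed

lemma pre_p: "x \<in> X \<Longrightarrow> pre n (p x) = map letter_map (pre n x)"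
  by (simp add: list_eq_iff_nth_eq p_letter)

lemma p_measurable: "p \<in> borel_on X \<rightarrow>\<^sub>M borel_on Y"
proof (rule Y.measurable_borel_on[OF measurable_into_sequences])
  fix i
  have "(\<lambda>x. letter_map (x i)) \<in> borel_on X \<rightarrow>\<^sub>M count_space UNIV"
    unfolding borel_on_def
    by (rule measurable_restrict_space1[OF measurable_compose[OF coordinate_measurable]]) simp
  then show "(\<lambda>x. p x i) \<in> borel_on X \<rightarrow>\<^sub>M count_space UNIV"
    by (subst measurable_cong[where g = "\<lambda>x. letter_map (x i)"]) (simp_all add: p_letter)
qed (simp add: p_in)

lemma p_measurable': "sets M = sets (borel_on X) \<Longrightarrow> p \<in> M \<rightarrow>\<^sub>M borel_on Y"
  using p_measurable measurable_cong_sets by blast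

lemma simple_function_pre_p:
  assumes "sets M = sets (borel_on X)"
  shows "simple_function M (\<lambda>x. pre n (p x))"
  by (rule simple_function_comp_measurable[OF Y.simple_function_pre[OF refl] p_measurable'[OF assms]])

lemma ent_push_pre:
  assumes "sets M = sets (borel_on X)"
  shows "ent (push Y p M) (pre n) = ent M (\<lambda>x. pre n (p x))"
  unfolding push_def by (rule ent_distr[OF p_measurable'[OF assms] Y.simple_function_pre[OF refl]])

lemma word_prob_push:
  assumes M: "prob_space M" "sets M = sets (borel_on X)"
  shows "word_prob (push Y p M) v = (\<Sum>u\<in>{u \<in> X.lang (length v). map letter_map u = v}. word_prob M u)"
proof -
  interpret prob_space M by fact
  have sp: "space M = X" using sets_eq_imp_space_eq[OF M(2)] by simp
  have "word_prob (push Y p M) v = pr M (\<lambda>x. pre (length v) (p x)) v"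
    unfolding word_prob_def push_def
    by (rule pr_distr[OF p_measurable'[OF M(2)] Y.simple_function_pre[OF refl]])
  also have "\<dots> = pr M (\<lambda>x. map letter_map (pre (length v) x)) v"
    by (intro pr_cong) (simp add: pre_p sp)
  also have "\<dots> = (\<Sum>u\<in>{u \<in> pre (length v) ` space M. map letter_map u = v}. pr M (pre (length v)) u)"
    by (rule pr_comp_sum[OF X.simple_function_pre[OF M(2)]])
  finally show ?thesis by (auto simp: sp X.lang_def pr_pre intro!: sum.cong)
qed

lemma push_invariant:
  assumes M: "M \<in> invariant_measures X"
  shows "push Y p M \<in> invariant_measures Y"
proof -
  interpret measure_preserving M shift by (rule X.invariant_measure_preserving[OF M])
  note sets = X.invariant_sets[OF M] and sp = X.invariant_space[OF M]
  note pm = p_measurable'[OF sets]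
  let ?N = "distr M (borel_on Y) p"
  have "distr ?N ?N shift = distr ?N (borel_on Y) shift" by (rule distr_cong) simp_all
  also have "\<dots> = distr M (borel_on Y) (shift \<circ> p)" by (rule distr_distr[OF Y.shift_measurable_on pm])
  also have "\<dots> = distr M (borel_on Y) (p \<circ> shift)"
    by (rule distr_cong) (simp_all add: sp p_shift)
  also have "\<dots> = distr (distr M M shift) (borel_on Y) p" by (rule distr_distr[OF pm T_meas, symmetric])
  also have "\<dots> = ?N" by (simp add: T_distr)
  finally show ?thesis
    using prob_space_distr[OF pm] by (simp add: invariant_measures_def push_def)
qed

text \<open>The words whose cylinders meet the fibre over \<open>y\<close>, that is, those
  represented in \<open>D n y\<close>.\<close>

definition fibre_words :: "nat \<Rightarrow> (nat \<Rightarrow> nat) \<Rightarrow> nat list set" where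
  "fibre_words n y = {pre n x |x. x \<in> X \<and> p x = y}"

text \<open>A relaxation of \<open>fibre_words\<close>: only the first \<open>length v\<close>
  letters of the image are prescribed. It depends on a finite block, so it can enter entropy
  estimates and is measurable in \<open>y\<close>.\<close>

definition fibre_words_over :: "nat \<Rightarrow> nat list \<Rightarrow> nat list set" where
  "fibre_words_over n v = {pre n x |x. x \<in> X \<and> pre (length v) (p x) = v}"

lemma fibre_words_subset: "fibre_words n y \<subseteq> fibre_words_over n (pre r y)"
  by (auto simp: fibre_words_def fibre_words_over_def)

lemma fibre_words_over_subset: "fibre_words_over n v \<subseteq> X.lang n"
  by (auto simp: fibre_words_over_def X.lang_def)

lemma finite_fibre_words: "finite (fibre_words n y)" "finite (fibre_words_over n v)"
  using fibre_words_over_subset X.finite_lang fibre_words_subset finite_subset by metis+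

lemma fibre_words_over_antimono: "r \<le> s \<Longrightarrow> fibre_words_over n (pre s y) \<subseteq> fibre_words_over n (pre r y)"
proof
  fix w assume "r \<le> s" "w \<in> fibre_words_over n (pre s y)"
  then obtain x where x: "x \<in> X" "w = pre n x" "pre s (p x) = pre s y" by (auto simp: fibre_words_over_def)
  then have "pre r (p x) = pre r y" using \<open>r \<le> s\<close> by (metis take_pre)
  then show "w \<in> fibre_words_over n (pre r y)" using x by (auto simp: fibre_words_over_def)
qed

text \<open>A word compatible with every block of \<open>y\<close> comes from points whose images
  share longer and longer prefixes with \<open>y\<close>; by compactness a limit point lies in the
  fibre and still starts with the word. As only finitely many words are involved, the decreasing
  sets become constant.\<close>

lemma fibre_words_over_eventually:
  "\<exists>R. \<forall>r\<ge>R. fibre_words_over n (pre r y) = fibre_words n y"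
proof -
  have "\<exists>R. w \<notin> fibre_words_over n (pre R y)" if w: "w \<notin> fibre_words n y" for w
  proof (rule ccontr)
    assume "\<nexists>R. w \<notin> fibre_words_over n (pre R y)"
    have "\<forall>r. \<exists>x. x \<in> X \<and> pre n x = w \<and> pre r (p x) = pre r y"
    proof
      fix r
      have "w \<in> fibre_words_over n (pre r y)"
        using \<open>\<nexists>R. w \<notin> fibre_words_over n (pre R y)\<close> by blast
      then show "\<exists>x. x \<in> X \<and> pre n x = w \<and> pre r (p x) = pre r y"
        unfolding fibre_words_over_def length_pre by blast
    qed
    from choice[OF this] obtain \<xi> where
      \<xi>: "\<And>r. \<xi> r \<in> X" "\<And>r. pre n (\<xi> r) = w" "\<And>r. pre r (p (\<xi> r)) = pre r y" by blast
    have "seq_compact X" by (rule compact_imp_seq_compact[OF X.compact])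
    then obtain x s where x: "x \<in> X" "strict_mono (s :: nat \<Rightarrow> nat)" "(\<xi> \<circ> s) \<longlonglongrightarrow> x"
      using seq_compactE \<xi>(1) by metis
    have coord: "\<forall>\<^sub>F j in sequentially. \<xi> (s j) i = x i" for i
      using x(3) unfolding tendsto_fun_iff tendsto_discrete by (simp add: comp_def)
    have "pre n x = w"
    proof -
      have "\<forall>\<^sub>F j in sequentially. \<forall>i\<in>{..<n}. \<xi> (s j) i = x i"
        using coord by (intro eventually_ball_finite) auto
      then obtain j where j: "\<forall>i\<in>{..<n}. \<xi> (s j) i = x i"
        using eventually_happens'[OF sequentially_bot] by blast
      have "pre n x = pre n (\<xi> (s j))" by (rule nth_equalityI) (use j in simp_all)
      then show ?thesis unfolding \<xi>(2) .
    qed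
    moreover have "p x = y"
    proof
      fix i
      have "\<forall>\<^sub>F j in sequentially. \<xi> (s j) i = x i \<and> Suc i \<le> j"
        using coord eventually_ge_at_top by (intro eventually_conj) auto
      then obtain j where j: "\<xi> (s j) i = x i" "Suc i \<le> j"
        using eventually_happens'[OF sequentially_bot] by blast
      have "i < s j" using j(2) seq_suble[OF x(2), of j] by simp
      then have "p (\<xi> (s j)) i = y i" using \<xi>(3)[of "s j"] by (simp add: pre_eq_iff)
      then show "p x i = y i" using j(1) by (simp add: p_letter \<xi>(1) x(1))
    qed
    ultimately show False using w x(1) by (auto simp: fibre_words_def)
  qed
  then obtain R where R: "\<And>w. w \<notin> fibre_words n y \<Longrightarrow> w \<notin> fibre_words_over n (pre (R w) y)" by metis
  have "fibre_words_over n (pre r y) = fibre_words n y" if r: "r \<ge> Max (insert 0 (R ` X.lang n))" for r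
  proof (intro equalityI fibre_words_subset subsetI)
    fix w assume w: "w \<in> fibre_words_over n (pre r y)"
    then have "w \<in> X.lang n" using fibre_words_over_subset by blast
    then have "R w \<le> r" using r X.finite_lang by (meson Max_ge finite_imageI finite_insert imageI insertI2 le_trans)
    then show "w \<in> fibre_words n y" using w R fibre_words_over_antimono by blast
  qed
  then show ?thesis by blast
qed

lemma card_fibre_words_over_le: "card (fibre_words_over n v) \<le> k ^ n"
  using card_mono[OF X.finite_lang fibre_words_over_subset] X.card_lang_le le_trans by blast

lemma card_fibre_words_le: "card (fibre_words n y) \<le> k ^ n"
  using card_mono[OF finite_fibre_words(2) fibre_words_subset] card_fibre_words_over_le le_trans by blast

lemma card_fibre_words_pos: "y \<in> Y \<Longrightarrow> 0 < card (fibre_words n y)"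
  using p_surj finite_fibre_words by (auto simp: card_gt_0_iff fibre_words_def)

lemma card_fibre_words_over_pos: "y \<in> Y \<Longrightarrow> 0 < card (fibre_words_over n (pre r y))"
  using card_fibre_words_pos[of y n] card_mono[OF finite_fibre_words(2) fibre_words_subset, of n y r] by simp

lemma ln_card_bound:
  assumes "0 < c" "c \<le> k ^ n"
  shows "0 \<le> ln (real c)" "ln (real c) \<le> real n * ln (real k)"
proof -
  show "0 \<le> ln (real c)" using assms by simp
  have "real c \<le> real k ^ n" using assms(2) by (metis of_nat_le_iff of_nat_power)
  then have "ln (real c) \<le> ln (real k ^ n)" using assms(1) X.k_pos by simp
  also have "\<dots> = real n * ln (real k)" using X.k_pos by (simp add: ln_realpow)
  finally show "ln (real c) \<le> real n * ln (real k)" .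
qed

text \<open>The map \<open>pre n\<close> is a bijection from the selected points to the fibre words,
  so the count is the same for every admissible selection.\<close>

lemma card_fibre_selection:
  assumes S: "fibre_selection X p n y S" and y: "y \<in> Y"
  shows "card S = card (fibre_words n y)"
proof (rule bij_betw_same_card[of "pre n"], rule bij_betw_imageI)
  have S_sub: "S \<subseteq> {x \<in> X. p x = y}"
    and S_ex1: "\<And>w. length w = n \<Longrightarrow> {x \<in> X. p x = y} \<inter> cylinder X w \<noteq> {} \<Longrightarrow> \<exists>!x. x \<in> S \<and> x \<in> cylinder X w"
    using S by (auto simp: fibre_selection_def)
  have cyl: "x \<in> cylinder X (pre n x)" if "x \<in> X" for x using that by (simp add: cylinder_eq_pre)
  show "inj_on (pre n) S"
  proof (rule inj_onI)
    fix a b assume ab: "a \<in> S" "b \<in> S" "pre n a = pre n b"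
    have X: "a \<in> X" "b \<in> X" "p a = y" using ab S_sub by auto
    have "\<exists>!x. x \<in> S \<and> x \<in> cylinder X (pre n a)"
      using X cyl[OF X(1)] by (intro S_ex1) auto
    moreover have "a \<in> cylinder X (pre n a)" "b \<in> cylinder X (pre n a)"
      using cyl[OF X(1)] cyl[OF X(2)] ab(3) by auto
    ultimately show "a = b" using ab by blast
  qed
  show "pre n ` S = fibre_words n y"
  proof (intro equalityI subsetI)
    fix w assume "w \<in> fibre_words n y"
    then obtain x where x: "x \<in> X" "p x = y" "w = pre n x" by (auto simp: fibre_words_def)
    then obtain z where "z \<in> S" "z \<in> cylinder X w" using S_ex1[of w] cyl[of x] by auto
    then have "w = pre n z" using x by (simp add: cylinder_eq_pre)
    then show "w \<in> pre n ` S" using \<open>z \<in> S\<close> by blast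
  qed (use S_sub in \<open>auto simp: fibre_words_def\<close>)
qed

definition fibre_rate :: "nat \<Rightarrow> (nat \<Rightarrow> nat) \<Rightarrow> real" where
  "fibre_rate n y = 1 / real n * ln (real (card (fibre_words n y)))"

definition fibre_entropy :: "(nat \<Rightarrow> nat) \<Rightarrow> real" where
  "fibre_entropy y = real_of_ereal (limsup (\<lambda>n. ereal (fibre_rate n y)))"

lemma fibre_growth_eq:
  assumes "\<And>n y. n \<ge> 1 \<Longrightarrow> y \<in> Y \<Longrightarrow> fibre_selection X p n y (D n y)" "y \<in> Y"
  shows "fibre_growth D y = fibre_entropy y"
proof -
  \<comment> \<open>At \<open>n = 0\<close> both sides are \<open>0\<close> by the convention for
    division by \<open>0\<close>, which fits admissibility being assumed from \<open>n = 1\<close>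
    on.\<close>
  have "1 / real n * ln (real (card (D n y))) = fibre_rate n y" for n
    using assms card_fibre_selection[of n y "D n y"] by (cases "n = 0") (auto simp: fibre_rate_def)
  then show ?thesis by (simp add: fibre_growth_def fibre_entropy_def)
qed

lemma fibre_rate_bounds:
  assumes "y \<in> Y"
  shows "0 \<le> fibre_rate n y" "fibre_rate n y \<le> ln (real k)"
proof -
  note b = ln_card_bound[OF card_fibre_words_pos[OF assms] card_fibre_words_le, of n]
  show "0 \<le> fibre_rate n y" using b by (simp add: fibre_rate_def)
  show "fibre_rate n y \<le> ln (real k)"
    using b X.k_pos by (cases "n = 0") (simp_all add: fibre_rate_def field_simps)
qed

lemma fibre_entropy_facts:
  assumes y: "y \<in> Y"
  shows "0 \<le> fibre_entropy y" "fibre_entropy y \<le> ln (real k)"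
    "e > 0 \<Longrightarrow> \<forall>\<^sub>F n in sequentially. fibre_rate n y < fibre_entropy y + e"
    "e > 0 \<Longrightarrow> \<exists>\<^sub>F n in sequentially. fibre_entropy y - e < fibre_rate n y"
    "\<forall>\<^sub>F n in sequentially. fibre_rate n y \<le> c \<Longrightarrow> fibre_entropy y \<le> c"
  using real_limsup_facts[where a = "\<lambda>n. fibre_rate n y" and B = "ln (real k)",
      OF fibre_rate_bounds(1)[OF y] fibre_rate_bounds(2)[OF y], folded fibre_entropy_def]
  by blast+

text \<open>Approximating the fibre count by functions of finitely many letters makes
  \<open>fibre_rate\<close> and \<open>fibre_entropy\<close> measurable; it also drives the limit in
  \<open>r\<close> of the upper bound.\<close>

lemma card_fibre_words_LIMSEQ:
  "(\<lambda>r. ln (real (card (fibre_words_over n (pre r y))))) \<longlonglongrightarrow> ln (real (card (fibre_words n y)))"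
proof (rule tendsto_eventually)
  show "\<forall>\<^sub>F r in sequentially. ln (real (card (fibre_words_over n (pre r y)))) = ln (real (card (fibre_words n y)))"
    using fibre_words_over_eventually[of n y] unfolding eventually_sequentially by force
qed

lemma fibre_words_over_measurable:
  "(\<lambda>y. ln (real (card (fibre_words_over n (pre r y))))) \<in> borel_measurable (borel_on Y)"
  by (rule measurable_compose[OF Y.pre_measurable_on]) simp

lemma fibre_words_measurable: "(\<lambda>y. ln (real (card (fibre_words n y)))) \<in> borel_measurable (borel_on Y)"
  by (rule borel_measurable_LIMSEQ_real[OF card_fibre_words_LIMSEQ fibre_words_over_measurable])

lemma fibre_rate_measurable: "fibre_rate n \<in> borel_measurable (borel_on Y)"
  unfolding fibre_rate_def[abs_def] using fibre_words_measurable by simp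

lemma fibre_entropy_measurable: "fibre_entropy \<in> borel_measurable (borel_on Y)"
  unfolding fibre_entropy_def[abs_def] using fibre_rate_measurable by measurable

end

text \<open>The real-valued counterpart of \<open>h\<close>, with which it agrees on invariant
  measures.\<close>

definition word_entropy :: "(nat \<Rightarrow> nat) measure \<Rightarrow> real" where
  "word_entropy M = (INF n\<in>{1..}. ent M (pre n) / real n)"

context one_sided_subshift
begin

lemma h_eq_word_entropy: "M \<in> invariant_measures X \<Longrightarrow> h M = ereal (word_entropy M)"
  unfolding word_entropy_def by (rule h_eq_entropy_rate)

lemma simple_function_coordinate:
  assumes M: "sets M = sets (borel_on X)"
  shows "simple_function M (\<lambda>x. x 0)"
  using simple_function_compose[OF simple_function_pre[OF M, of 1], of hd] by (simp add: comp_def pre_def)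

lemma ent_pre_add_le:
  assumes M: "M \<in> invariant_measures X"
  shows "ent M (pre (m + n)) \<le> ent M (pre m) + ent M (pre n)"
  unfolding pre_eq_itinerary
  by (rule measure_preserving.ent_itinerary_add[OF invariant_measure_preserving[OF M]
        simple_function_coordinate[OF invariant_sets[OF M]]])

lemma ent_pre_nonneg: "M \<in> invariant_measures X \<Longrightarrow> 0 \<le> ent M (pre n)"
  by (rule prob_space.ent_nonneg[OF invariant_prob_space])

lemma word_entropy_LIMSEQ:
  assumes M: "M \<in> invariant_measures X"
  shows "(\<lambda>n. ent M (pre n) / real n) \<longlonglongrightarrow> word_entropy M"
  unfolding word_entropy_def by (rule fekete[OF ent_pre_add_le[OF M] ent_pre_nonneg[OF M]])

lemma word_entropy_le:
  assumes M: "M \<in> invariant_measures X"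
  shows "real n * word_entropy M \<le> ent M (pre n)"
proof (cases "n = 0")
  case False
  then have "word_entropy M \<le> ent M (pre n) / real n"
    unfolding word_entropy_def by (intro fekete_lower ent_pre_nonneg M) simp
  then show ?thesis using False by (simp add: field_simps)
qed (use ent_pre_nonneg[OF M] in simp)

lemma ent_pre_le:
  assumes M: "prob_space M" "sets M = sets (borel_on X)"
  shows "ent M (pre n) \<le> real n * ln (real k)"
proof -
  interpret prob_space M by fact
  have sp: "space M = X" using sets_eq_imp_space_eq[OF M(2)] by simp
  have "ent M (pre n) \<le> ln (real (card (lang n)))"
    by (rule ent_le_card[OF simple_function_pre[OF M(2)] finite_lang]) (simp add: sp lang_def)
  also have "\<dots> \<le> ln (real k ^ n)"
  proof -
    have "0 < card (lang n)" using nonempty finite_lang by (simp add: card_gt_0_iff lang_def)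
    moreover have "real (card (lang n)) \<le> real k ^ n"
      using card_lang_le[of n] by (metis of_nat_le_iff of_nat_power)
    ultimately show ?thesis using k_pos by simp
  qed
  also have "\<dots> = real n * ln (real k)" using k_pos by (simp add: ln_realpow)
  finally show ?thesis .
qed

end

lemma ln_of_nat_mono: "0 < a \<Longrightarrow> a \<le> b \<Longrightarrow> ln (real a) \<le> ln (real b)"
  by simp

section \<open>The upper bound for the relative entropy\<close>

text \<open>A prefix cut into \<open>n\<close>-blocks is an itinerary of \<open>shift ^^ n\<close>,
  so estimates by blocks become estimates for that map.\<close>

lemma pre_mult_eq_concat: "pre (n * j) x = concat (itinerary (shift ^^ n) (pre n) j x)"
proof (induction j)
  case (Suc j)
  have "pre (n * Suc j) x = take (n * j) (pre (n * Suc j) x) @ drop (n * j) (pre (n * Suc j) x)" by simp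
  also have "\<dots> = pre (n * j) x @ pre n ((shift ^^ (n * j)) x)"
    by (subst take_pre) (simp_all add: drop_pre)
  finally show ?case by (simp add: Suc itinerary_Suc funpow_mult)
qed simp

context factor
begin

lemma integral_push:
  fixes \<psi> :: "(nat \<Rightarrow> nat) \<Rightarrow> real"
  assumes M: "sets M = sets (borel_on X)" and \<psi>: "\<psi> \<in> borel_measurable (borel_on Y)"
  shows "(\<integral>y. \<psi> y \<partial>push Y p M) = (\<integral>x. \<psi> (p x) \<partial>M)"
  unfolding push_def by (rule integral_distr[OF p_measurable'[OF M] \<psi>])

lemma cent_pre_le_integral:
  assumes M: "M \<in> invariant_measures X"
  shows "cent M (pre n) (\<lambda>x. pre r (p x))
    \<le> (\<integral>y. ln (real (card (fibre_words_over n (pre r y)))) \<partial>push Y p M)"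
proof -
  interpret M: prob_space M by (rule X.invariant_prob_space[OF M])
  note sets = X.invariant_sets[OF M] and sp = X.invariant_space[OF M]
  let ?g = "\<lambda>x. pre r (p x)"
  have "cent M (pre n) ?g \<le> (\<Sum>v\<in>?g ` space M. pr M ?g v * ln (real (card (fibre_words_over n v))))"
    by (rule M.cent_le_card[OF X.simple_function_pre[OF sets] simple_function_pre_p[OF sets] finite_fibre_words(2)])
      (auto simp: sp fibre_words_over_def)
  also have "\<dots> = (\<integral>x. ln (real (card (fibre_words_over n (?g x)))) \<partial>M)"
    by (rule M.integral_simple_function[OF simple_function_pre_p[OF sets], symmetric])
  also have "\<dots> = (\<integral>y. ln (real (card (fibre_words_over n (pre r y)))) \<partial>push Y p M)"
    by (rule integral_push[OF sets fibre_words_over_measurable, symmetric])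
  finally show ?thesis .
qed

text \<open>A prefix of length \<open>n * j\<close> is cut into \<open>j\<close> blocks. The image
  prefix of length \<open>n * j + r\<close> contains the \<open>r\<close> image letters from the
  start of each block on, so every block costs at most its conditional entropy \<open>C\<close>
  given these. The \<open>r\<close> surplus letters cost the constant \<open>E\<close>, which
  vanishes as \<open>j\<close> grows.\<close>

lemma word_entropy_le_over:
  assumes M: "M \<in> invariant_measures X" and n: "1 \<le> n"
  shows "word_entropy M \<le> word_entropy (push Y p M)
    + (\<integral>y. ln (real (card (fibre_words_over n (pre r y)))) \<partial>push Y p M) / real n"
proof -
  interpret M: measure_preserving M shift by (rule X.invariant_measure_preserving[OF M])
  interpret Mn: measure_preserving M "shift ^^ n" by (rule M.funpow_measure_preserving)
  note sets = X.invariant_sets[OF M] and sp = X.invariant_space[OF M] and N = push_invariant[OF M]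
  note S = X.simple_function_pre[OF sets] simple_function_pre_p[OF sets]
  let ?N = "push Y p M" and ?g = "\<lambda>x. pre r (p x)"
  define C where "C = cent M (pre n) ?g"
  define E where "E = ent ?N (pre r)"
  have main: "ent M (pre (n * j)) \<le> ent ?N (pre (n * j)) + E + real j * C" for j
  proof -
    have "ent M (pre (n * j)) \<le> ent M (itinerary (shift ^^ n) (pre n) j)"
      by (rule M.ent_le_if_determined[OF Mn.simple_function_itinerary[OF S(1)]]) (rule pre_mult_eq_concat)
    also have "\<dots> \<le> ent M (\<lambda>x. pre (n * j + r) (p x)) + real j * C"
      unfolding C_def
    proof (rule Mn.ent_itinerary_le[OF S(1) S(2) S(2), where k = "\<lambda>i u. take r (drop (n * i) u)"])
      fix i x assume i: "i < j" and x: "x \<in> space M"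
      have "n * i \<le> n * j" using i by simp
      then have "take r (drop (n * i) (pre (n * j + r) (p x))) = pre r ((shift ^^ (n * i)) (p x))"
        unfolding drop_pre by (intro take_pre) linarith
      then show "pre r (p (((shift ^^ n) ^^ i) x)) = take r (drop (n * i) (pre (n * j + r) (p x)))"
        using x by (simp add: funpow_mult p_funpow_shift sp)
    qed
    also have "ent M (\<lambda>x. pre (n * j + r) (p x)) = ent ?N (pre (n * j + r))"
      by (rule ent_push_pre[OF sets, symmetric])
    also have "\<dots> \<le> ent ?N (pre (n * j)) + E" unfolding E_def by (rule Y.ent_pre_add_le[OF N])
    finally show ?thesis by simp
  qed
  have "(\<lambda>j. ent ?N (pre (n * j)) / real (n * j)) \<longlonglongrightarrow> word_entropy ?N"
    using LIMSEQ_subseq_LIMSEQ[OF Y.word_entropy_LIMSEQ[OF N], of "\<lambda>j. n * j"] n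
    by (simp add: comp_def strict_mono_def)
  moreover have "(\<lambda>j. E / real n / real j) \<longlonglongrightarrow> 0" by (rule lim_const_over_n)
  ultimately have "(\<lambda>j. ent ?N (pre (n * j)) / real (n * j) + E / real n / real j + C / real n)
      \<longlonglongrightarrow> word_entropy ?N + 0 + C / real n" by (intro tendsto_intros)
  moreover have "\<exists>j0. \<forall>j\<ge>j0. word_entropy M \<le> ent ?N (pre (n * j)) / real (n * j) + E / real n / real j + C / real n"
  proof (intro exI allI impI)
    fix j :: nat assume j: "1 \<le> j"
    have "real (n * j) * word_entropy M \<le> ent ?N (pre (n * j)) + E + real j * C"
      using X.word_entropy_le[OF M, of "n * j"] main[of j] by linarith
    then show "word_entropy M \<le> ent ?N (pre (n * j)) / real (n * j) + E / real n / real j + C / real n"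
      using n j by (simp add: field_simps)
  qed
  ultimately have "word_entropy M \<le> word_entropy ?N + C / real n"
    by (intro LIMSEQ_le_const[of _ _ "word_entropy M"]) simp_all
  also have "C / real n \<le> (\<integral>y. ln (real (card (fibre_words_over n (pre r y)))) \<partial>?N) / real n"
    unfolding C_def by (intro divide_right_mono cent_pre_le_integral[OF M]) simp
  finally show ?thesis by simp
qed

text \<open>The maximum with the upper limit turns it into a genuine limit, so that dominated
  convergence can serve as a reverse Fatou lemma.\<close>

lemma fibre_rate_max_LIMSEQ:
  assumes y: "y \<in> Y"
  shows "(\<lambda>n. max (fibre_rate n y) (fibre_entropy y)) \<longlonglongrightarrow> fibre_entropy y"
proof (rule LIMSEQ_I)
  fix e :: real assume e: "0 < e"
  have "\<forall>\<^sub>F n in sequentially. fibre_rate n y < fibre_entropy y + e"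
    by (rule fibre_entropy_facts(3)[OF y e])
  then show "\<exists>n0. \<forall>n\<ge>n0. norm (max (fibre_rate n y) (fibre_entropy y) - fibre_entropy y) < e"
    unfolding eventually_sequentially using e by (force simp: max_def)
qed

text \<open>Two limits in this order: \<open>r\<close> tends to infinity at fixed \<open>n\<close>,
  which replaces relaxed counts by fibre counts, and then \<open>n\<close> does, where the integral
  of the rates is bounded through their maxima with \<open>fibre_entropy\<close>.\<close>

theorem word_entropy_le_fibre_entropy:
  assumes M: "M \<in> invariant_measures X"
  shows "word_entropy M \<le> word_entropy (push Y p M) + (\<integral>y. fibre_entropy y \<partial>push Y p M)"
proof -
  note N = push_invariant[OF M]
  let ?N = "push Y p M"
  interpret N: prob_space ?N by (rule Y.invariant_prob_space[OF N])
  note sets = Y.invariant_sets[OF N] and sp = Y.invariant_space[OF N]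
  have meas: "\<psi> \<in> borel_measurable ?N" if "\<psi> \<in> borel_measurable (borel_on Y)" for \<psi> :: "_ \<Rightarrow> real"
    using that measurable_cong_sets[OF sets refl] by blast
  have rate: "word_entropy M \<le> word_entropy ?N + (\<integral>y. fibre_rate n y \<partial>?N)" if n: "1 \<le> n" for n
  proof -
    have "(\<lambda>r. \<integral>y. ln (real (card (fibre_words_over n (pre r y)))) \<partial>?N)
        \<longlonglongrightarrow> (\<integral>y. ln (real (card (fibre_words n y))) \<partial>?N)"
    proof (rule integral_dominated_convergence[where w = "\<lambda>_. real n * ln (real k)"])
      show "AE y in ?N. norm (ln (real (card (fibre_words_over n (pre r y))))) \<le> real n * ln (real k)" for r
      proof (rule AE_I2)
        fix y assume "y \<in> space ?N"
        then have "0 < card (fibre_words_over n (pre r y))" by (simp add: sp card_fibre_words_over_pos)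
        from ln_card_bound[OF this card_fibre_words_over_le]
        show "norm (ln (real (card (fibre_words_over n (pre r y))))) \<le> real n * ln (real k)" by simp
      qed
    qed (auto intro!: meas fibre_words_measurable fibre_words_over_measurable card_fibre_words_LIMSEQ)
    then have "(\<lambda>r. word_entropy ?N + (\<integral>y. ln (real (card (fibre_words_over n (pre r y)))) \<partial>?N) / real n)
        \<longlonglongrightarrow> word_entropy ?N + (\<integral>y. ln (real (card (fibre_words n y))) \<partial>?N) / real n"
      using n by (intro tendsto_intros) simp_all
    then have "word_entropy M \<le> word_entropy ?N + (\<integral>y. ln (real (card (fibre_words n y))) \<partial>?N) / real n"
      by (rule LIMSEQ_le_const) (use word_entropy_le_over[OF M n] in blast)
    also have "(\<integral>y. ln (real (card (fibre_words n y))) \<partial>?N) / real n = (\<integral>y. fibre_rate n y \<partial>?N)"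
      by (simp add: fibre_rate_def)
    finally show ?thesis .
  qed
  have m: "(\<lambda>y. max (fibre_rate n y) (fibre_entropy y)) \<in> borel_measurable ?N" for n
    by (intro meas borel_measurable_max fibre_rate_measurable fibre_entropy_measurable)
  have bound: "norm (max (fibre_rate n y) (fibre_entropy y)) \<le> ln (real k)" if "y \<in> Y" for n y
    using fibre_rate_bounds[OF that, of n] fibre_entropy_facts(1,2)[OF that] by (simp add: max_def)
  have "(\<lambda>n. \<integral>y. max (fibre_rate n y) (fibre_entropy y) \<partial>?N) \<longlonglongrightarrow> (\<integral>y. fibre_entropy y \<partial>?N)"
  proof (rule integral_dominated_convergence[where w = "\<lambda>_. ln (real k)"])
    show "AE y in ?N. (\<lambda>n. max (fibre_rate n y) (fibre_entropy y)) \<longlonglongrightarrow> fibre_entropy y"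
      by (rule AE_I2) (simp add: sp fibre_rate_max_LIMSEQ)
    show "AE y in ?N. norm (max (fibre_rate n y) (fibre_entropy y)) \<le> ln (real k)" for n
      using bound by (intro AE_I2) (simp add: sp)
  qed (auto intro!: m meas fibre_entropy_measurable)
  then have "(\<lambda>n. word_entropy ?N + (\<integral>y. max (fibre_rate n y) (fibre_entropy y) \<partial>?N))
      \<longlonglongrightarrow> word_entropy ?N + (\<integral>y. fibre_entropy y \<partial>?N)"
    by (intro tendsto_intros)
  then show ?thesis
  proof (rule LIMSEQ_le_const, intro exI allI impI)
    fix n :: nat assume n: "1 \<le> n"
    have "(\<integral>y. fibre_rate n y \<partial>?N) \<le> (\<integral>y. max (fibre_rate n y) (fibre_entropy y) \<partial>?N)"
    proof (rule integral_mono)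
      show "integrable ?N (fibre_rate n)"
        using fibre_rate_bounds by (intro N.integrable_bounded[of _ "ln (real k)"] meas fibre_rate_measurable) (simp add: sp)
      show "integrable ?N (\<lambda>y. max (fibre_rate n y) (fibre_entropy y))"
        using bound by (intro N.integrable_bounded[of _ "ln (real k)"] m) (simp add: sp)
    qed simp
    then show "word_entropy M \<le> word_entropy ?N + (\<integral>y. max (fibre_rate n y) (fibre_entropy y) \<partial>?N)"
      using rate[OF n] by linarith
  qed
qed

subsection \<open>Subadditivity along the fibres\<close>

lemma card_fibre_words_Suc_le: "card (fibre_words (Suc n) y) \<le> k * card (fibre_words n (shift y))"
proof -
  have "inj_on (\<lambda>w. (hd w, tl w)) (fibre_words (Suc n) y)"
    by (rule inj_onI) (auto simp: fibre_words_def pre_Suc_shift)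
  moreover have "(\<lambda>w. (hd w, tl w)) ` fibre_words (Suc n) y \<subseteq> {1..k} \<times> fibre_words n (shift y)"
  proof
    fix z assume "z \<in> (\<lambda>w. (hd w, tl w)) ` fibre_words (Suc n) y"
    then obtain x where x: "x \<in> X" "p x = y" "z = (x 0, pre n (shift x))"
      by (auto simp: fibre_words_def pre_Suc_shift)
    then have "pre n (shift x) \<in> fibre_words n (shift y)"
      using X.shift_closed[OF x(1)] p_shift[OF x(1)] by (auto simp: fibre_words_def)
    then show "z \<in> {1..k} \<times> fibre_words n (shift y)" unfolding x(3) using X.letters[OF x(1), of 0] by simp
  qed
  ultimately have "card (fibre_words (Suc n) y) \<le> card ({1..k} \<times> fibre_words n (shift y))"
    using finite_fibre_words(1) by (intro card_inj_on_le) auto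
  then show ?thesis by (simp add: card_cartesian_product)
qed

lemma card_fibre_words_mono: "m \<le> n \<Longrightarrow> card (fibre_words m y) \<le> card (fibre_words n y)"
proof -
  assume "m \<le> n"
  then have "fibre_words m y \<subseteq> take m ` fibre_words n y"
    by (auto simp: fibre_words_def image_iff) (metis take_pre)
  then show ?thesis using finite_fibre_words(1) surj_card_le by blast
qed

text \<open>The head stays in the fibre over \<open>y\<close>, whereas the tail only keeps the
  \<open>q\<close> image letters that it covers. The second factor is thus a function of one
  \<open>q\<close>-block, the same observable that governs the entropy of the uniform lift.\<close>

lemma card_fibre_words_add_le:
  "card (fibre_words (m + q) y) \<le> card (fibre_words m y) * card (fibre_words_over q (pre q ((shift ^^ m) y)))"
proof -
  let ?B = "fibre_words m y \<times> fibre_words_over q (pre q ((shift ^^ m) y))"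
  have "inj_on (\<lambda>w. (take m w, drop m w)) (fibre_words (m + q) y)"
    by (rule inj_onI) (metis append_take_drop_id prod.inject)
  moreover have "(\<lambda>w. (take m w, drop m w)) ` fibre_words (m + q) y \<subseteq> ?B"
  proof
    fix z assume "z \<in> (\<lambda>w. (take m w, drop m w)) ` fibre_words (m + q) y"
    then obtain x where x: "x \<in> X" "p x = y" "z = (pre m x, pre q ((shift ^^ m) x))"
      by (auto simp: fibre_words_def take_pre drop_pre)
    have "pre q ((shift ^^ m) x) \<in> fibre_words_over q (pre q ((shift ^^ m) y))"
      unfolding fibre_words_over_def using X.funpow_shift_closed[OF x(1), of m] p_funpow_shift[OF x(1), of m] x(2) by auto
    moreover have "pre m x \<in> fibre_words m y" using x by (auto simp: fibre_words_def)
    ultimately show "z \<in> ?B" using x(3) by simp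
  qed
  ultimately have "card (fibre_words (m + q) y) \<le> card ?B"
    using finite_fibre_words by (intro card_inj_on_le) auto
  then show ?thesis by (simp add: card_cartesian_product)
qed

text \<open>Prepending a letter multiplies the count by at most \<open>k\<close>, which is invisible
  at the exponential scale. The inequality has one direction because a point over
  \<open>shift y\<close> may fail to extend to the left to a point over \<open>y\<close>.\<close>

lemma fibre_entropy_shift:
  assumes y: "y \<in> Y"
  shows "fibre_entropy y \<le> fibre_entropy (shift y)"
proof (rule field_le_epsilon)
  fix e :: real assume e: "0 < e"
  have sy: "shift y \<in> Y" by (rule Y.shift_closed[OF y])
  have "(\<lambda>n. ln (real k) / real n) \<longlonglongrightarrow> 0" by (rule lim_const_over_n)
  then have "\<forall>\<^sub>F n in sequentially. ln (real k) / real n < e / 2" using e by (intro order_tendstoD(2)[of _ 0]) auto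
  moreover have "\<forall>\<^sub>F n in sequentially. fibre_rate n (shift y) < fibre_entropy (shift y) + e / 2"
    using e by (intro fibre_entropy_facts(3)[OF sy]) simp
  ultimately have "\<forall>\<^sub>F n in sequentially. fibre_rate (Suc n) y \<le> fibre_entropy (shift y) + e"
    using eventually_ge_at_top[of 1]
  proof eventually_elim
    case (elim n)
    let ?a = "card (fibre_words (Suc n) y)" and ?b = "card (fibre_words n (shift y))"
    note b = ln_card_bound[OF card_fibre_words_pos[OF sy] card_fibre_words_le, of n]
    have "ln (real ?a) \<le> ln (real (k * ?b))"
      by (rule ln_of_nat_mono[OF card_fibre_words_pos[OF y] card_fibre_words_Suc_le])
    also have "\<dots> = ln (real k) + ln (real ?b)"
      using X.k_pos card_fibre_words_pos[OF sy, of n] by (simp add: ln_mult)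
    finally have a: "ln (real ?a) \<le> ln (real k) + ln (real ?b)" .
    have "fibre_rate (Suc n) y \<le> (ln (real k) + ln (real ?b)) / real (Suc n)"
      unfolding fibre_rate_def using a by (simp add: divide_right_mono)
    also have "\<dots> \<le> (ln (real k) + ln (real ?b)) / real n"
      using b X.k_pos elim(3) by (intro divide_left_mono) auto
    also have "\<dots> = ln (real k) / real n + fibre_rate n (shift y)" by (simp add: fibre_rate_def add_divide_distrib)
    finally show ?case using elim(1,2) by linarith
  qed
  then have "\<forall>\<^sub>F n in sequentially. fibre_rate n y \<le> fibre_entropy (shift y) + e"
    by (subst (asm) eventually_sequentially_Suc)
  then show "fibre_entropy y \<le> fibre_entropy (shift y) + e" by (rule fibre_entropy_facts(5)[OF y])
qed

lemma ln_card_fibre_words_mult_le: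
  assumes y: "y \<in> Y"
  shows "ln (real (card (fibre_words (q * t) y)))
    \<le> (\<Sum>i<t. ln (real (card (fibre_words_over q (pre q (((shift ^^ q) ^^ i) y))))))"
proof (induction t)
  case 0
  have "fibre_words 0 y \<subseteq> {[]}" by (auto simp: fibre_words_def)
  then have "card (fibre_words 0 y) \<le> 1" using card_mono[of "{[]}" "fibre_words 0 y"] by simp
  then show ?case using card_fibre_words_pos[OF y, of 0] by simp
next
  case (Suc t)
  let ?z = "((shift ^^ q) ^^ t) y"
  have z: "?z = (shift ^^ (q * t)) y" by (simp add: funpow_mult)
  have zY: "?z \<in> Y" unfolding z by (rule Y.funpow_shift_closed[OF y])
  have "ln (real (card (fibre_words (q * Suc t) y)))
      \<le> ln (real (card (fibre_words (q * t) y) * card (fibre_words_over q (pre q ?z))))"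
  proof (rule ln_of_nat_mono[OF card_fibre_words_pos[OF y]])
    show "card (fibre_words (q * Suc t) y)
        \<le> card (fibre_words (q * t) y) * card (fibre_words_over q (pre q ?z))"
      using card_fibre_words_add_le[of "q * t" q y] unfolding z by (simp add: add.commute)
  qed
  also have "\<dots> = ln (real (card (fibre_words (q * t) y))) + ln (real (card (fibre_words_over q (pre q ?z))))"
    using card_fibre_words_pos[OF y] card_fibre_words_over_pos[OF zY] by (simp add: ln_mult)
  finally show ?case using Suc.IH by simp
qed

text \<open>The upper limit is reached along lengths \<open>n\<close> that need not be multiples of
  \<open>q\<close>. Rounding \<open>n\<close> up to \<open>q * t\<close> is harmless, as the counts
  increase with the length and the overshoot is at most \<open>q\<close>.\<close>

lemma fibre_entropy_frequently:
  assumes y: "y \<in> Y" and q: "1 \<le> q" and e: "0 < e"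
  shows "\<exists>t\<ge>1. real t * (real q * fibre_entropy y - e) \<le> ln (real (card (fibre_words (q * t) y)))"
proof -
  let ?F = "fibre_entropy y"
  have F0: "0 \<le> ?F" by (rule fibre_entropy_facts(1)[OF y])
  \<comment> \<open>Of the allowance \<open>t * e\<close>, which equals
    \<open>t * q * (2 * d)\<close>, one half pays for the slack in the upper limit and the other for
    the rounding.\<close>
  define d where "d = e / (2 * real q)"
  have d: "0 < d" using e q by (simp add: d_def)
  \<comment> \<open>Beyond this length the overshoot \<open>q * ?F\<close> is at most
    \<open>n * d\<close>.\<close>
  obtain N :: nat where N: "real q * ?F / d \<le> real N" using real_arch_simple by blast
  have "\<exists>\<^sub>F n in sequentially. ?F - d < fibre_rate n y" by (rule fibre_entropy_facts(4)[OF y d])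
  then obtain n where n: "max N 1 \<le> n" "?F - d < fibre_rate n y"
    unfolding frequently_sequentially by blast
  \<comment> \<open>The \<open>+ 1\<close> rounds up and ensures \<open>t \<ge> 1\<close> even for
    \<open>n < q\<close>.\<close>
  define t where "t = n div q + 1"
  have tq: "n \<le> q * t" "real t * real q \<le> real n + real q" "real n \<le> real t * real q"
  proof -
    note nn = mult_div_mod_eq[of q n]
    have qt: "q * t = q + q * (n div q)" by (simp add: t_def)
    have "n mod q < q" using q by simp
    then show *: "n \<le> q * t" using nn qt by linarith
    have "q * t \<le> n + q" using nn qt by linarith
    then show "real t * real q \<le> real n + real q" by (metis mult.commute of_nat_add of_nat_le_iff of_nat_mult)
    show "real n \<le> real t * real q" using * by (metis mult.commute of_nat_le_iff of_nat_mult)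
  qed
  have "real n * (?F - d) \<le> real n * fibre_rate n y" using n by (intro mult_left_mono) auto
  also have "\<dots> = ln (real (card (fibre_words n y)))" using n by (simp add: fibre_rate_def)
  also have "\<dots> \<le> ln (real (card (fibre_words (q * t) y)))"
    by (rule ln_of_nat_mono[OF card_fibre_words_pos[OF y] card_fibre_words_mono[OF tq(1)]])
  finally have 1: "real n * (?F - d) \<le> ln (real (card (fibre_words (q * t) y)))" .
  have "real t * (real q * ?F - e) = (real t * real q) * ?F - (real t * real q) * (2 * d)"
    using q by (simp add: d_def field_simps)
  also have "\<dots> \<le> (real n + real q) * ?F - real n * (2 * d)"
    using tq F0 d by (intro diff_mono mult_right_mono) auto
  also have "\<dots> \<le> real n * (?F - d)"
  proof -
    have "real q * ?F \<le> real N * d" using N d by (simp add: field_simps)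
    also have "\<dots> \<le> real n * d" using n d by (intro mult_right_mono) auto
    finally show ?thesis by (simp add: algebra_simps)
  qed
  finally show ?thesis using 1 by (intro exI[of _ t]) (simp add: t_def)
qed

text \<open>The maximal inequality for \<open>shift ^^ q\<close> with \<open>f = q * F\<close> and
  \<open>g\<close> the logarithm of the relaxed count: the orbit sums of \<open>g\<close> dominate
  the logarithm of the fibre count at length \<open>q * t\<close>, which reaches
  \<open>t * (q * F y - e)\<close> for some \<open>t \<ge> 1\<close>.\<close>

theorem integral_fibre_entropy_le:
  assumes m: "m \<in> invariant_measures Y" and q: "1 \<le> q"
  shows "real q * (\<integral>y. fibre_entropy y \<partial>m) \<le> (\<integral>y. ln (real (card (fibre_words_over q (pre q y)))) \<partial>m)"
proof -
  interpret S: measure_preserving m shift by (rule Y.invariant_measure_preserving[OF m])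
  interpret Sq: measure_preserving m "shift ^^ q" by (rule S.funpow_measure_preserving)
  note sets = Y.invariant_sets[OF m] and sp = Y.invariant_space[OF m]
  have meas: "\<psi> \<in> borel_measurable m" if "\<psi> \<in> borel_measurable (borel_on Y)" for \<psi> :: "_ \<Rightarrow> real"
    using that measurable_cong_sets[OF sets refl] by blast
  have iter: "fibre_entropy y \<le> fibre_entropy ((shift ^^ i) y)" if "y \<in> Y" for y i
    using fibre_entropy_shift[OF Y.funpow_shift_closed[OF that]] by (induction i) (auto intro: order_trans)
  have "(\<integral>y. real q * fibre_entropy y \<partial>m) \<le> (\<integral>y. ln (real (card (fibre_words_over q (pre q y)))) \<partial>m)"
  proof (rule Sq.integral_le_if_birkhoff_averages[where B = "real q * ln (real k)"])
    show "(\<lambda>y. real q * fibre_entropy y) \<in> borel_measurable m"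
      by (intro meas borel_measurable_times fibre_entropy_measurable) simp
    show "(\<lambda>y. ln (real (card (fibre_words_over q (pre q y))))) \<in> borel_measurable m"
      by (rule meas[OF fibre_words_over_measurable])
    fix y assume "y \<in> space m"
    then have y: "y \<in> Y" by (simp add: sp)
    show "\<bar>real q * fibre_entropy y\<bar> \<le> real q * ln (real k)"
      using fibre_entropy_facts(1,2)[OF y] by (simp add: abs_mult mult_left_mono)
    show "\<bar>ln (real (card (fibre_words_over q (pre q y))))\<bar> \<le> real q * ln (real k)"
      using ln_card_bound[OF card_fibre_words_over_pos[OF y] card_fibre_words_over_le] by simp
    show "real q * fibre_entropy y \<le> real q * fibre_entropy ((shift ^^ q) y)"
      by (intro mult_left_mono iter y) simp
    fix e :: real assume "0 < e"
    from fibre_entropy_frequently[OF y q this] ln_card_fibre_words_mult_le[OF y, of q]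
    show "\<exists>t\<ge>1. real t * (real q * fibre_entropy y - e)
        \<le> (\<Sum>i<t. ln (real (card (fibre_words_over q (pre q (((shift ^^ q) ^^ i) y))))))"
      by (meson order_trans)
  qed
  then show ?thesis by simp
qed

end

section \<open>Limits of averaged measures\<close>

lemma abs_mult_ln_le:
  fixes y :: real
  assumes "0 \<le> y" "y \<le> 1"
  shows "\<bar>y * ln y\<bar> \<le> 2 * sqrt y"
proof (cases "y = 0")
  case False
  then have y: "0 < y" using assms by simp
  have "- ln y = 2 * ln (1 / sqrt y)" using y by (simp add: ln_div ln_sqrt)
  also have "\<dots> \<le> 2 * (1 / sqrt y - 1)" using y by (intro mult_left_mono ln_le_minus_one) auto
  finally have "y * (- ln y) \<le> y * (2 * (1 / sqrt y))" using y by (intro mult_left_mono) auto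
  also have "\<dots> = 2 * (y / sqrt y)" by simp
  also have "y / sqrt y = sqrt y" using y by (intro real_div_sqrt) simp
  finally have "- (y * ln y) \<le> 2 * sqrt y" by simp
  moreover have "y * ln y \<le> 0" using y assms by (simp add: mult_le_0_iff)
  ultimately show ?thesis by simp
qed simp

text \<open>Continuity of \<open>x * ln x\<close> has to be argued separately at \<open>0\<close>,
  where the bound by \<open>2 * sqrt x\<close> forces the limit.\<close>

lemma tendsto_mult_ln:
  fixes f :: "'a \<Rightarrow> real"
  assumes f: "(f \<longlongrightarrow> x) F" and nonneg: "\<And>t. 0 \<le> f t" and x: "0 \<le> x"
  shows "((\<lambda>t. f t * ln (f t)) \<longlongrightarrow> x * ln x) F"
proof (cases "x = 0")
  case False
  then show ?thesis using x by (intro tendsto_intros f) auto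
next
  case True
  have "\<forall>\<^sub>F t in F. f t < 1" using f True by (intro order_tendstoD(2)[of _ 0]) auto
  then have ev: "\<forall>\<^sub>F t in F. norm (f t * ln (f t)) \<le> 2 * sqrt (f t)"
    by eventually_elim (use abs_mult_ln_le nonneg in \<open>simp add: less_imp_le\<close>)
  have "((\<lambda>t. 2 * sqrt (f t)) \<longlongrightarrow> 2 * sqrt 0) F" using f True by (intro tendsto_intros) simp
  then have "((\<lambda>t. 2 * sqrt (f t)) \<longlongrightarrow> 0) F" by simp
  then show ?thesis using True Lim_null_comparison[OF ev] by simp
qed

context one_sided_subshift
begin

definition shifted :: "(nat \<Rightarrow> nat) measure \<Rightarrow> nat \<Rightarrow> (nat \<Rightarrow> nat) measure" where
  "shifted M i = distr M (borel_on X) (shift ^^ i)"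

lemma funpow_shift_measurable:
  assumes "sets M = sets (borel_on X)"
  shows "shift ^^ i \<in> M \<rightarrow>\<^sub>M borel_on X"
proof -
  have "shift ^^ i \<in> borel_on X \<rightarrow>\<^sub>M borel_on X"
  proof (induction i)
    case (Suc i)
    then show ?case using measurable_comp[OF Suc shift_measurable_on] by (simp add: comp_def)
  qed (simp add: id_def)
  then show ?thesis using measurable_cong_sets[OF assms refl] by blast
qed

lemma sets_shifted [simp]: "sets (shifted M i) = sets (borel_on X)"
  by (simp add: shifted_def)

lemma prob_space_shifted:
  assumes "prob_space M" "sets M = sets (borel_on X)"
  shows "prob_space (shifted M i)"
  unfolding shifted_def by (rule prob_space.prob_space_distr[OF assms(1) funpow_shift_measurable[OF assms(2)]])

lemma pr_shifted:
  assumes "sets M = sets (borel_on X)" "simple_function (borel_on X) f"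
  shows "pr (shifted M i) f v = pr M (\<lambda>x. f ((shift ^^ i) x)) v"
  unfolding shifted_def by (rule pr_distr[OF funpow_shift_measurable[OF assms(1)] assms(2)])

lemma ent_shifted:
  assumes "sets M = sets (borel_on X)" "simple_function (borel_on X) f"
  shows "ent (shifted M i) f = ent M (\<lambda>x. f ((shift ^^ i) x))"
  unfolding shifted_def by (rule ent_distr[OF funpow_shift_measurable[OF assms(1)] assms(2)])

lemma word_prob_shifted_Suc:
  assumes M: "prob_space M" "sets M = sets (borel_on X)"
  shows "word_prob (shifted M (Suc i)) w = (\<Sum>a\<in>{1..k}. word_prob (shifted M i) (a # w))"
proof -
  have f: "simple_function (borel_on X) (\<lambda>x. pre (length w) (shift x))"
    by (rule simple_function_comp_measurable[OF simple_function_pre[OF refl] shift_measurable_on])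
  have "word_prob (shifted M (Suc i)) w = pr (shifted M i) (\<lambda>x. pre (length w) (shift x)) w"
    unfolding word_prob_def by (simp add: pr_shifted[OF M(2)] simple_function_pre f)
  then show ?thesis using pr_pre_shift[OF prob_space_shifted[OF M] sets_shifted, of i w] by simp
qed

text \<open>The word probabilities of the average of the first \<open>n\<close> shifted measures.
  They are kept as numbers, because the limit measure is built from their limits.\<close>

definition averaged :: "(nat \<Rightarrow> nat) measure \<Rightarrow> nat \<Rightarrow> nat list \<Rightarrow> real" where
  "averaged M n w = (\<Sum>i<n. word_prob (shifted M i) w) / real n"

lemma word_prob_nonneg [simp]: "0 \<le> word_prob M w"
  by (simp add: word_prob_def)

lemma word_prob_le_1: "prob_space M \<Longrightarrow> word_prob M w \<le> 1"
  unfolding word_prob_def by (rule prob_space.pr_le_1)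

lemma averaged_nonneg [simp]: "0 \<le> averaged M n w"
  unfolding averaged_def by (intro divide_nonneg_nonneg sum_nonneg) auto

lemma averaged_le_1:
  assumes M: "prob_space M" "sets M = sets (borel_on X)"
  shows "averaged M n w \<le> 1"
proof -
  have "(\<Sum>i<n. word_prob (shifted M i) w) \<le> (\<Sum>i<n. 1)"
    by (intro sum_mono word_prob_le_1 prob_space_shifted M)
  then show ?thesis by (cases "n = 0") (simp_all add: averaged_def)
qed

text \<open>The sum over a first letter replaces the shifts \<open>0\<close> to \<open>n - 1\<close>
  by \<open>1\<close> to \<open>n\<close>; the difference telescopes to two terms.\<close>

lemma averaged_Cons:
  assumes M: "prob_space M" "sets M = sets (borel_on X)"
  shows "\<bar>averaged M n w - (\<Sum>a\<in>{1..k}. averaged M n (a # w))\<bar> \<le> 1 / real n"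
proof -
  let ?b = "\<lambda>i. word_prob (shifted M i) w"
  have "(\<Sum>a\<in>{1..k}. averaged M n (a # w)) = (\<Sum>a\<in>{1..k}. \<Sum>i<n. word_prob (shifted M i) (a # w)) / real n"
    unfolding averaged_def by (rule sum_divide_distrib[symmetric])
  also have "(\<Sum>a\<in>{1..k}. \<Sum>i<n. word_prob (shifted M i) (a # w)) = (\<Sum>i<n. ?b (Suc i))"
    unfolding word_prob_shifted_Suc[OF M] by (rule sum.swap)
  finally have "averaged M n w - (\<Sum>a\<in>{1..k}. averaged M n (a # w)) = - (\<Sum>i<n. ?b (Suc i) - ?b i) / real n"
    by (simp add: averaged_def sum_subtractf diff_divide_distrib)
  also have "\<dots> = (?b 0 - ?b n) / real n" by (subst sum_lessThan_telescope) simp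
  finally have eq: "averaged M n w - (\<Sum>a\<in>{1..k}. averaged M n (a # w)) = (?b 0 - ?b n) / real n" .
  have "\<bar>?b 0 - ?b n\<bar> \<le> 1"
    using word_prob_le_1[OF prob_space_shifted[OF M, of 0], of w] word_prob_le_1[OF prob_space_shifted[OF M, of n], of w]
      word_prob_nonneg[of "shifted M 0" w] word_prob_nonneg[of "shifted M n" w]
    unfolding abs_le_iff by linarith
  then show ?thesis unfolding eq abs_divide by (simp add: divide_right_mono)
qed

text \<open>Sequential compactness of the cube of functions from words to \<open>[0, 1]\<close>
  plays the part of weak compactness of measures. Consistency is inherited from each average, and
  invariance appears in the limit since its defect is at most \<open>1 / n\<close>.\<close>

lemma exists_averaged_limit:
  assumes M: "\<And>n. prob_space (M n)" "\<And>n. sets (M n) = sets (borel_on X)"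
  shows "\<exists>N\<in>invariant_measures X. \<exists>r::nat \<Rightarrow> nat. strict_mono r \<and>
    (\<forall>w. (\<lambda>j. averaged (M (r j)) (r j) w) \<longlonglongrightarrow> word_prob N w)"
proof -
  let ?c = "\<lambda>n. averaged (M n) n"
  have "compact (PiE UNIV (\<lambda>_. {0..1}) :: (nat list \<Rightarrow> real) set)"
    by (rule compact_PiE_UNIV) (rule compact_Icc)
  then have "seq_compact (PiE UNIV (\<lambda>_. {0..1}) :: (nat list \<Rightarrow> real) set)" by (rule compact_imp_seq_compact)
  moreover have "\<forall>n. ?c n \<in> PiE UNIV (\<lambda>_. {0..1})" using averaged_le_1[OF M] by auto
  ultimately obtain c r where r: "strict_mono (r :: nat \<Rightarrow> nat)" and lim: "(?c \<circ> r) \<longlonglongrightarrow> c"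
    by (rule seq_compactE)
  have lim: "(\<lambda>j. averaged (M (r j)) (r j) w) \<longlonglongrightarrow> c w" for w
    using lim unfolding tendsto_fun_iff comp_def by simp
  have r_pos: "\<forall>\<^sub>F j in sequentially. 1 \<le> r j"
    unfolding eventually_sequentially using seq_suble[OF r] by (intro exI[of _ 1]) (meson le_trans)
  have inv: "(\<lambda>j. 1 / real (r j)) \<longlonglongrightarrow> 0"
    using LIMSEQ_subseq_LIMSEQ[OF lim_const_over_n[of "1::real"] r] by (simp add: comp_def)
  have "consistent c"
    unfolding consistent_def
  proof (intro conjI allI impI)
    fix w
    show "0 \<le> c w" by (rule LIMSEQ_le_const[OF lim]) simp
    show "c w = (\<Sum>a\<in>{1..k}. c (w @ [a]))"
    proof (rule LIMSEQ_unique[OF lim])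
      have "averaged (M n) n w = (\<Sum>a\<in>{1..k}. averaged (M n) n (w @ [a]))" for n
      proof -
        have "(\<Sum>i<n. word_prob (shifted (M n) i) w) = (\<Sum>i<n. \<Sum>a\<in>{1..k}. word_prob (shifted (M n) i) (w @ [a]))"
          by (intro sum.cong refl word_prob_append prob_space_shifted M sets_shifted)
        also have "\<dots> = (\<Sum>a\<in>{1..k}. \<Sum>i<n. word_prob (shifted (M n) i) (w @ [a]))" by (rule sum.swap)
        finally show ?thesis unfolding averaged_def by (simp add: sum_divide_distrib)
      qed
      moreover have "(\<lambda>j. \<Sum>a\<in>{1..k}. averaged (M (r j)) (r j) (w @ [a])) \<longlonglongrightarrow> (\<Sum>a\<in>{1..k}. c (w @ [a]))"
        by (intro tendsto_sum lim)
      ultimately show "(\<lambda>j. averaged (M (r j)) (r j) w) \<longlonglongrightarrow> (\<Sum>a\<in>{1..k}. c (w @ [a]))" by simp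
    qed
    show "c w = (\<Sum>a\<in>{1..k}. c (a # w))"
    proof -
      have "(\<lambda>j. averaged (M (r j)) (r j) w - (\<Sum>a\<in>{1..k}. averaged (M (r j)) (r j) (a # w)))
          \<longlonglongrightarrow> c w - (\<Sum>a\<in>{1..k}. c (a # w))" by (intro tendsto_diff tendsto_sum lim)
      moreover have "(\<lambda>j. averaged (M (r j)) (r j) w - (\<Sum>a\<in>{1..k}. averaged (M (r j)) (r j) (a # w))) \<longlonglongrightarrow> 0"
        by (rule Lim_null_comparison[OF _ inv], rule always_eventually, unfold real_norm_def)
          (intro allI averaged_Cons M)
      ultimately show ?thesis using LIMSEQ_unique by fastforce
    qed
    show "c w = 0" if "w \<notin> lang (length w)"
    proof (rule LIMSEQ_unique[OF lim])
      have "averaged (M n) n w = 0" for n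
        unfolding averaged_def using that by (simp add: word_prob_outside)
      then show "(\<lambda>j. averaged (M (r j)) (r j) w) \<longlonglongrightarrow> 0" by simp
    qed
  next
    show "c [] = 1"
    proof (rule LIMSEQ_unique[OF lim], rule tendsto_eventually)
      show "\<forall>\<^sub>F j in sequentially. averaged (M (r j)) (r j) [] = 1"
        using r_pos by eventually_elim (simp add: averaged_def word_prob_Nil prob_space_shifted M)
    qed
  qed
  then obtain N where "N \<in> invariant_measures X" "word_prob N = c" by (rule exists_invariant_measure)
  then show ?thesis using r lim by blast
qed

text \<open>The Krylov-Bogolyubov argument, starting from a point mass.\<close>

lemma invariant_measures_nonempty: "invariant_measures X \<noteq> {}"
proof -
  obtain x where x: "x \<in> X" using nonempty by auto
  have "prob_space (return (borel_on X) x)" using x by (intro prob_space_return) simp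
  from exists_averaged_limit[of "\<lambda>_. return (borel_on X) x", OF this] show ?thesis by auto
qed

lemma sum_word_prob_lang:
  assumes "prob_space M" "sets M = sets (borel_on X)"
  shows "(\<Sum>w\<in>lang n. word_prob M w) = 1"
proof -
  interpret prob_space M by fact
  have sp: "space M = X" using sets_eq_imp_space_eq[OF assms(2)] by simp
  have "1 = pr M (\<lambda>x. ()) ()" by (simp add: pr_def prob_space)
  also have "\<dots> = (\<Sum>w\<in>{w \<in> pre n ` space M. () = ()}. pr M (pre n) w)"
    by (rule pr_comp_sum[OF simple_function_pre[OF assms(2)]])
  also have "\<dots> = (\<Sum>w\<in>lang n. word_prob M w)"
    by (intro sum.cong) (auto simp: sp lang_def pr_pre)
  finally show ?thesis by simp
qed

lemma ent_pre_Suc_diff: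
  assumes M: "prob_space M" "sets M = sets (borel_on X)"
  shows "ent M (pre (Suc q)) - ent M (pre q)
    = (\<Sum>u\<in>lang (Suc q). word_prob M u * (ln (word_prob M (butlast u)) - ln (word_prob M u)))"
proof -
  interpret prob_space M by fact
  have sp: "space M = X" using sets_eq_imp_space_eq[OF M(2)] by simp
  have b: "butlast (pre (Suc q) x) = pre q x" for x by (simp add: pre_Suc)
  show ?thesis
    using ent_diff_formula[OF simple_function_pre[OF M(2), of "Suc q"], of butlast]
    unfolding b sp lang_def[symmetric]
    by (simp add: pr_pre length_lang cong: sum.cong)
qed

text \<open>The left side is the entropy of the letter at \<open>q + i\<close> given all earlier
  ones. Forgetting the first \<open>i\<close> letters raises it to the entropy given
  \<open>q\<close> letters, which is computed in the measure shifted by \<open>i\<close>.\<close>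

lemma ent_pre_Suc_le_shifted:
  assumes M: "prob_space M" "sets M = sets (borel_on X)"
  shows "ent M (pre (Suc (q + i))) - ent M (pre (q + i))
    \<le> ent (shifted M i) (pre (Suc q)) - ent (shifted M i) (pre q)"
proof -
  interpret prob_space M by fact
  note S = simple_function_pre[OF M(2)]
  let ?f = "\<lambda>x. last (pre (Suc (q + i)) x)" and ?g = "\<lambda>x. pre q ((shift ^^ i) x)"
  have f: "simple_function M ?f" using simple_function_compose[OF S, of last "Suc (q + i)"] by (simp add: comp_def)
  have g: "simple_function M (\<lambda>x. pre n ((shift ^^ i) x))" for n
    by (rule simple_function_comp_measurable[OF simple_function_pre[OF refl] funpow_shift_measurable[OF M(2)]])
  have "ent M (pre (Suc (q + i))) = ent M (\<lambda>x. (?f x, pre (q + i) x))"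
    by (rule ent_eq_if_determined[OF S simple_function_Pair[OF f S], where k = "\<lambda>w. (last w, butlast w)" and l = "\<lambda>(a, w). w @ [a]"])
      (simp_all add: pre_Suc)
  then have "ent M (pre (Suc (q + i))) - ent M (pre (q + i)) = cent M ?f (pre (q + i))" by (simp add: cent_def)
  also have "\<dots> \<le> cent M ?f ?g"
    by (rule cent_antimono'[OF f S, where k = "drop i"]) (simp add: drop_pre)
  also have "ent M (\<lambda>x. (?f x, ?g x)) = ent M (\<lambda>x. pre (Suc q) ((shift ^^ i) x))"
    by (rule ent_eq_if_determined[OF simple_function_Pair[OF f g] g, where k = "\<lambda>(a, w). w @ [a]" and l = "\<lambda>w. (last w, butlast w)"])
      (simp_all add: pre_Suc funpow_shift add.commute)
  then have "cent M ?f ?g = ent M (\<lambda>x. pre (Suc q) ((shift ^^ i) x)) - ent M ?g" by (simp add: cent_def)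
  finally show ?thesis by (simp add: ent_shifted[OF M(2) simple_function_pre])
qed

text \<open>Misiurewicz's estimate in conditional form: the block entropy telescopes into entropies
  of one letter given \<open>q\<close> letters in the shifted measures, and the log sum inequality,
  as concavity in the measure, collects them into that of the average. The initial \<open>q\<close>
  letters cost at most \<open>q * ln k\<close>.\<close>

lemma ent_pre_le_averaged:
  assumes M: "prob_space M" "sets M = sets (borel_on X)" and n: "1 \<le> n"
  shows "ent M (pre n) \<le> real q * ln (real k)
    + real n * (\<Sum>u\<in>lang (Suc q). averaged M n u * (ln (averaged M n (butlast u)) - ln (averaged M n u)))"
proof -
  interpret prob_space M by fact
  note S = simple_function_pre[OF M(2)] and P = prob_space_shifted[OF M]
  let ?t = "\<lambda>i u. word_prob (shifted M i) u * (ln (word_prob (shifted M i) (butlast u)) - ln (word_prob (shifted M i) u))"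
  \<comment> \<open>Lengthening the block by \<open>q\<close> gives each of the \<open>n\<close>
    increments a past of at least \<open>q\<close> letters.\<close>
  have "ent M (pre n) \<le> ent M (pre (q + n))"
    by (rule ent_le_if_determined[OF S, where k = "take n"]) (simp add: take_pre)
  also have "\<dots> = ent M (pre q) + (\<Sum>i<n. ent M (pre (Suc (q + i))) - ent M (pre (q + i)))"
    using sum_lessThan_telescope[of "\<lambda>i. ent M (pre (q + i))" n] by simp
  also have "ent M (pre q) \<le> real q * ln (real k)" by (rule ent_pre_le[OF M])
  also have "(\<Sum>i<n. ent M (pre (Suc (q + i))) - ent M (pre (q + i))) \<le> (\<Sum>i<n. \<Sum>u\<in>lang (Suc q). ?t i u)"
    using ent_pre_Suc_le_shifted[OF M] ent_pre_Suc_diff[OF P sets_shifted] by (intro sum_mono) simp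
  also have "\<dots> = (\<Sum>u\<in>lang (Suc q). \<Sum>i<n. ?t i u)" by (rule sum.swap)
  also have "\<dots> \<le> (\<Sum>u\<in>lang (Suc q). real n * (averaged M n u * (ln (averaged M n (butlast u)) - ln (averaged M n u))))"
  proof (rule sum_mono)
    fix u assume u: "u \<in> lang (Suc q)"
    let ?A = "\<Sum>i<n. word_prob (shifted M i) u" and ?B = "\<Sum>i<n. word_prob (shifted M i) (butlast u)"
    have le: "word_prob (shifted M i) u \<le> word_prob (shifted M i) (butlast u)" for i
    proof -
      interpret Pi: prob_space "shifted M i" by (rule P)
      have lu: "length u = Suc q" "length (butlast u) = q" using length_lang[OF u] by auto
      have "pr (shifted M i) (pre (Suc q)) u \<le> pr (shifted M i) (\<lambda>x. butlast (pre (Suc q) x)) (butlast u)"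
        by (rule Pi.pr_comp_ge[OF simple_function_pre[OF sets_shifted]])
      then show ?thesis by (simp add: word_prob_def lu pre_Suc)
    qed
    have "(\<Sum>i<n. ?t i u) \<le> ?A * (ln ?B - ln ?A)"
    proof (rule log_sum_inequality)
      fix i assume "word_prob (shifted M i) (butlast u) = 0"
      then show "word_prob (shifted M i) u = 0" using le[of i] word_prob_nonneg[of "shifted M i" u] by linarith
    qed auto
    also have "\<dots> = real n * (averaged M n u * (ln (averaged M n (butlast u)) - ln (averaged M n u)))"
    proof (cases "?A = 0")
      case True
      then show ?thesis by (simp add: averaged_def)
    next
      case False
      then have A: "0 < ?A" using sum_nonneg[of "{..<n}" "\<lambda>i. word_prob (shifted M i) u"] by fastforce
      moreover have "?A \<le> ?B" by (intro sum_mono le)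
      ultimately show ?thesis using n by (simp add: averaged_def ln_div)
    qed
    finally show "(\<Sum>i<n. ?t i u) \<le> real n * (averaged M n u * (ln (averaged M n (butlast u)) - ln (averaged M n u)))" .
  qed
  finally show ?thesis by (simp add: sum_distrib_left)
qed

text \<open>The conditional entropy of one letter given the previous \<open>q\<close> letters survives in the limit; it
  only has to be bounded from below, so the terms whose weight tends to 0 need no lower bound.\<close>

lemma word_entropy_averaged_limit:
  assumes M: "\<And>n. prob_space (M n)" "\<And>n. sets (M n) = sets (borel_on X)"
    and s: "\<And>n. 1 \<le> n \<Longrightarrow> real n * s \<le> ent (M n) (pre n)"
    and N: "N \<in> invariant_measures X" and r: "strict_mono (r :: nat \<Rightarrow> nat)"
    and lim: "\<And>w. (\<lambda>j. averaged (M (r j)) (r j) w) \<longlonglongrightarrow> word_prob N w"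
  shows "s \<le> word_entropy N"
proof -
  note N' = invariant_prob_space[OF N] invariant_sets[OF N]
  have incr: "s \<le> ent N (pre (Suc q)) - ent N (pre q)" for q
  proof -
    let ?a = "\<lambda>j. averaged (M (r j)) (r j)"
    \<comment> \<open>If the limit weight of \<open>u\<close> is \<open>0\<close>,
      \<open>ln (?a j (butlast u))\<close> may tend to minus infinity; being at most
      \<open>0\<close>, it is dropped from the term.\<close>
    define \<tau> where "\<tau> j u = (if word_prob N u = 0 then - (?a j u * ln (?a j u))
      else ?a j u * (ln (?a j (butlast u)) - ln (?a j u)))" for j u
    have "s - real q * ln (real k) / real (r j) \<le> (\<Sum>u\<in>lang (Suc q). \<tau> j u)" if j: "1 \<le> r j" for j
    proof -
      have "real (r j) * s \<le> real q * ln (real k) + real (r j) * (\<Sum>u\<in>lang (Suc q). ?a j u * (ln (?a j (butlast u)) - ln (?a j u)))"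
        using s[OF j] ent_pre_le_averaged[OF M(1)[of "r j"] M(2)[of "r j"] j, of q] by (rule order_trans)
      then have "s - real q * ln (real k) / real (r j) \<le> (\<Sum>u\<in>lang (Suc q). ?a j u * (ln (?a j (butlast u)) - ln (?a j u)))"
        using j by (simp add: field_simps)
      also have "\<dots> \<le> (\<Sum>u\<in>lang (Suc q). \<tau> j u)"
      proof (rule sum_mono)
        fix u
        have "ln (?a j (butlast u)) \<le> 0"
        proof (cases "?a j (butlast u) = 0")
          case False
          then have "0 < ?a j (butlast u)" using averaged_nonneg[of "M (r j)" "r j" "butlast u"] by linarith
          then show ?thesis using averaged_le_1[OF M(1)[of "r j"] M(2)[of "r j"], of "r j" "butlast u"] by simp
        qed simp
        then have "?a j u * ln (?a j (butlast u)) \<le> 0" by (simp add: mult_nonneg_nonpos)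
        then show "?a j u * (ln (?a j (butlast u)) - ln (?a j u)) \<le> \<tau> j u"
          by (simp add: \<tau>_def algebra_simps)
      qed
      finally show ?thesis .
    qed
    moreover have "\<exists>j0. \<forall>j\<ge>j0. 1 \<le> r j" using seq_suble[OF r] by (intro exI[of _ 1]) (meson le_trans)
    ultimately have ev: "\<exists>j0. \<forall>j\<ge>j0. s - real q * ln (real k) / real (r j) \<le> (\<Sum>u\<in>lang (Suc q). \<tau> j u)" by blast
    have "(\<lambda>j. real q * ln (real k) / real (r j)) \<longlonglongrightarrow> 0"
      using LIMSEQ_subseq_LIMSEQ[OF lim_const_over_n[of "real q * ln (real k)"] r] by (simp add: comp_def)
    then have "(\<lambda>j. s - real q * ln (real k) / real (r j)) \<longlonglongrightarrow> s - 0" by (intro tendsto_intros)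
    moreover have "(\<lambda>j. \<Sum>u\<in>lang (Suc q). \<tau> j u) \<longlonglongrightarrow>
        (\<Sum>u\<in>lang (Suc q). word_prob N u * (ln (word_prob N (butlast u)) - ln (word_prob N u)))"
    proof (rule tendsto_sum)
      fix u assume u: "u \<in> lang (Suc q)"
      show "(\<lambda>j. \<tau> j u) \<longlonglongrightarrow> word_prob N u * (ln (word_prob N (butlast u)) - ln (word_prob N u))"
      proof (cases "word_prob N u = 0")
        case True
        have "(\<lambda>j. - (?a j u * ln (?a j u))) \<longlonglongrightarrow> - (word_prob N u * ln (word_prob N u))"
          by (intro tendsto_minus tendsto_mult_ln lim) simp_all
        then show ?thesis using True by (simp add: \<tau>_def)
      next
        case False
        have lu: "length u = Suc q" "length (butlast u) = q" using length_lang[OF u] by auto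
        interpret N: prob_space N by (rule N')
        have "pr N (pre (Suc q)) u \<le> pr N (\<lambda>x. butlast (pre (Suc q) x)) (butlast u)"
          by (rule N.pr_comp_ge[OF simple_function_pre[OF N'(2)]])
        then have "word_prob N u \<le> word_prob N (butlast u)" by (simp add: word_prob_def lu pre_Suc)
        moreover have "0 < word_prob N u" using False word_prob_nonneg[of N u] by linarith
        ultimately show ?thesis using False unfolding \<tau>_def by (simp, intro tendsto_intros lim) auto
      qed
    qed
    ultimately have "s - 0 \<le> (\<Sum>u\<in>lang (Suc q). word_prob N u * (ln (word_prob N (butlast u)) - ln (word_prob N u)))"
      by (rule LIMSEQ_le[OF _ _ ev])
    then show ?thesis by (simp add: ent_pre_Suc_diff[OF N'])
  qed
  have "real n * s \<le> ent N (pre n)" for n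
  proof (induction n)
    case (Suc n)
    then show ?case using incr[of n] by (simp add: algebra_simps)
  qed (use ent_pre_nonneg[OF N, of 0] in \<open>simp del: pre_0\<close>)
  then show ?thesis unfolding word_entropy_def by (intro cINF_greatest) (auto simp: field_simps)
qed

end

section \<open>The lower bound for the relative entropy\<close>

context factor
begin

lemma letter_map_lang: "map letter_map ` X.lang n = Y.lang n"
proof -
  have "map letter_map ` X.lang n = (\<lambda>x. pre n (p x)) ` X" by (auto simp: X.lang_def pre_p image_image)
  also have "\<dots> = pre n ` p ` X" by (simp add: image_image)
  also have "p ` X = Y" using factor_map by (simp add: factor_map_def)
  finally show ?thesis by (simp add: Y.lang_def)
qed

lemma fibre_words_over_eq:
  assumes "length v = n"
  shows "fibre_words_over n v = {w \<in> X.lang n. map letter_map w = v}"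
  using assms by (auto simp: fibre_words_over_def X.lang_def pre_p)

lemma sum_lang_fibres:
  fixes g :: "nat list \<Rightarrow> real"
  shows "(\<Sum>w\<in>X.lang n. g w) = (\<Sum>v\<in>Y.lang n. \<Sum>w\<in>fibre_words_over n v. g w)"
proof -
  have "(\<Sum>w\<in>X.lang n. g w) = (\<Sum>v\<in>map letter_map ` X.lang n. \<Sum>w\<in>{w \<in> X.lang n. map letter_map w = v}. g w)"
    by (rule sum.image_gen[OF X.finite_lang])
  also have "\<dots> = (\<Sum>v\<in>Y.lang n. \<Sum>w\<in>fibre_words_over n v. g w)"
    unfolding letter_map_lang
    by (intro sum.cong refl arg_cong[where f = "sum g"]) (simp add: fibre_words_over_eq Y.length_lang)
  finally show ?thesis .
qed

lemma card_fibre_words_over_lang_pos: "v \<in> Y.lang n \<Longrightarrow> 0 < card (fibre_words_over n v)"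
  using card_fibre_words_over_pos[of _ n n] by (auto simp: Y.lang_def)

text \<open>Choose a word \<open>v\<close> with law \<open>m\<close>, then one of the words over \<open>v\<close> uniformly, and extend it to a point.\<close>

lemma exists_uniform_lift:
  assumes m: "prob_space m" "sets m = sets (borel_on Y)"
  obtains N where "prob_space N" "sets N = sets (borel_on X)"
    "\<And>w. w \<in> X.lang n \<Longrightarrow> word_prob N w
      = word_prob m (map letter_map w) / real (card (fibre_words_over n (map letter_map w)))"
proof -
  define D where "D w = word_prob m (map letter_map w) / real (card (fibre_words_over n (map letter_map w)))" for w
  define f where "f w = (if w \<in> X.lang n then D w else 0)" for w
  have D0: "0 \<le> D w" for w unfolding D_def by simp
  have f0: "0 \<le> f w" for w using D0 by (simp add: f_def)
  have sum_D: "(\<Sum>w\<in>X.lang n. D w) = 1"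
  proof -
    have "(\<Sum>w\<in>X.lang n. D w) = (\<Sum>v\<in>Y.lang n. \<Sum>w\<in>fibre_words_over n v. D w)" by (rule sum_lang_fibres)
    also have "\<dots> = (\<Sum>v\<in>Y.lang n. word_prob m v)"
    proof (rule sum.cong[OF refl])
      fix v assume v: "v \<in> Y.lang n"
      have "(\<Sum>w\<in>fibre_words_over n v. D w) = (\<Sum>w\<in>fibre_words_over n v. word_prob m v / real (card (fibre_words_over n v)))"
        by (intro sum.cong refl) (auto simp: D_def fibre_words_over_eq Y.length_lang[OF v])
      also have "\<dots> = word_prob m v" using card_fibre_words_over_lang_pos[OF v] by simp
      finally show "(\<Sum>w\<in>fibre_words_over n v. D w) = word_prob m v" .
    qed
    finally show ?thesis using Y.sum_word_prob_lang[OF m] by simp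
  qed
  define P where "P = embed_pmf f"
  have pmf_P: "pmf P w = f w" for w
    unfolding P_def
  proof (rule pmf_embed_pmf[OF f0])
    have "(\<integral>\<^sup>+ w. ennreal (f w) \<partial>count_space UNIV) = (\<Sum>w\<in>X.lang n. ennreal (f w))"
      by (intro nn_integral_count_space') (auto simp: f_def X.finite_lang)
    also have "\<dots> = ennreal (\<Sum>w\<in>X.lang n. f w)" using f0 by simp
    also have "(\<Sum>w\<in>X.lang n. f w) = 1" using sum_D by (simp add: f_def)
    finally show "(\<integral>\<^sup>+ w. ennreal (f w) \<partial>count_space UNIV) = 1" by simp
  qed
  have supp: "set_pmf P \<subseteq> X.lang n" by (auto simp: set_pmf_iff pmf_P f_def split: if_splits)
  \<comment> \<open>Words outside the language are sent to some point of \<open>X\<close> as well,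
    so that the map takes all words into \<open>X\<close>.\<close>
  define \<xi> where "\<xi> w = (SOME x. x \<in> X \<and> (w \<in> X.lang n \<longrightarrow> pre n x = w))" for w
  have \<xi>: "\<xi> w \<in> X \<and> (w \<in> X.lang n \<longrightarrow> pre n (\<xi> w) = w)" for w
    unfolding \<xi>_def
  proof (rule someI_ex[where P = "\<lambda>x. x \<in> X \<and> (w \<in> X.lang n \<longrightarrow> pre n x = w)"])
    show "\<exists>x. x \<in> X \<and> (w \<in> X.lang n \<longrightarrow> pre n x = w)"
      using X.nonempty by (cases "w \<in> X.lang n") (auto simp: X.lang_def)
  qed
  define N where "N = distr (measure_pmf P) (borel_on X) \<xi>"
  have \<xi>_X: "\<xi> w \<in> X" and \<xi>_pre: "w \<in> X.lang n \<Longrightarrow> pre n (\<xi> w) = w" for w using \<xi> by blast+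
  have meas: "\<xi> \<in> measure_pmf P \<rightarrow>\<^sub>M borel_on X"
    unfolding measurable_pmf_measure1 by (simp add: \<xi>_X)
  show thesis
  proof (rule that)
    show "prob_space N" unfolding N_def by (rule measure_pmf.prob_space_distr[OF meas])
    show "sets N = sets (borel_on X)" by (simp add: N_def)
    fix w assume w: "w \<in> X.lang n"
    have "word_prob N w = pr (measure_pmf P) (\<lambda>u. pre n (\<xi> u)) w"
      unfolding word_prob_def N_def X.length_lang[OF w] by (rule pr_distr[OF meas X.simple_function_pre[OF refl]])
    also have "\<dots> = measure (measure_pmf P) ((\<lambda>u. pre n (\<xi> u)) -` {w} \<inter> set_pmf P)"
      by (simp add: pr_def measure_Int_set_pmf)
    also have "(\<lambda>u. pre n (\<xi> u)) -` {w} \<inter> set_pmf P = {w} \<inter> set_pmf P"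
      using supp \<xi>_pre by auto
    also have "measure (measure_pmf P) \<dots> = D w"
      using w by (simp add: measure_Int_set_pmf measure_pmf_single pmf_P f_def)
    finally show "word_prob N w = word_prob m (map letter_map w) / real (card (fibre_words_over n (map letter_map w)))"
      by (simp add: D_def)
  qed
qed

text \<open>Given the image word, the law on the words over it is uniform, so its conditional
  entropy is exactly the logarithm of their number.\<close>

lemma ent_uniform_lift:
  assumes m: "prob_space m" "sets m = sets (borel_on Y)" and N: "sets N = sets (borel_on X)"
    and lift: "\<And>w. w \<in> X.lang n \<Longrightarrow> word_prob N w
      = word_prob m (map letter_map w) / real (card (fibre_words_over n (map letter_map w)))"
  shows "ent N (pre n) = ent m (pre n) + (\<integral>y. ln (real (card (fibre_words_over n (pre n y)))) \<partial>m)"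
proof -
  interpret prob_space m by fact
  have sp: "space m = Y" using sets_eq_imp_space_eq[OF m(2)] by simp
  let ?c = "\<lambda>v. real (card (fibre_words_over n v))"
  have "ent N (pre n) = (\<Sum>v\<in>Y.lang n. \<Sum>w\<in>fibre_words_over n v. - (word_prob N w * ln (word_prob N w)))"
    unfolding X.ent_pre[OF N] by (rule sum_lang_fibres)
  also have "\<dots> = (\<Sum>v\<in>Y.lang n. - (word_prob m v * ln (word_prob m v)) + word_prob m v * ln (?c v))"
  proof (rule sum.cong[OF refl])
    fix v assume v: "v \<in> Y.lang n"
    note c = card_fibre_words_over_lang_pos[OF v]
    have "(\<Sum>w\<in>fibre_words_over n v. - (word_prob N w * ln (word_prob N w)))
        = (\<Sum>w\<in>fibre_words_over n v. - (word_prob m v / ?c v * ln (word_prob m v / ?c v)))"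
      by (intro sum.cong refl) (auto simp: lift fibre_words_over_eq Y.length_lang[OF v])
    also have "\<dots> = - (word_prob m v * ln (word_prob m v / ?c v))" using c by simp
    also have "\<dots> = - (word_prob m v * ln (word_prob m v)) + word_prob m v * ln (?c v)"
    proof (cases "word_prob m v = 0")
      case False
      then have "0 < word_prob m v" using Y.word_prob_nonneg[of m v] by linarith
      then show ?thesis using c by (simp add: ln_div algebra_simps)
    qed simp
    finally show "(\<Sum>w\<in>fibre_words_over n v. - (word_prob N w * ln (word_prob N w)))
        = - (word_prob m v * ln (word_prob m v)) + word_prob m v * ln (?c v)" .
  qed
  also have "\<dots> = ent m (pre n) + (\<Sum>v\<in>Y.lang n. word_prob m v * ln (?c v))"
    unfolding Y.ent_pre[OF m(2)] by (rule sum.distrib)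
  also have "(\<Sum>v\<in>Y.lang n. word_prob m v * ln (?c v)) = (\<Sum>v\<in>pre n ` space m. pr m (pre n) v * ln (?c v))"
    unfolding sp Y.lang_def[symmetric] by (intro sum.cong refl) (simp add: pr_pre Y.length_lang)
  also have "\<dots> = (\<integral>y. ln (?c (pre n y)) \<partial>m)"
    by (rule integral_simple_function[OF Y.simple_function_pre[OF m(2)], symmetric])
  finally show ?thesis .
qed

text \<open>The lift is tied to \<open>m\<close> through the first \<open>n\<close> letters, so
  agreement of the image with \<open>m\<close> is claimed for functions of these.\<close>

lemma pr_push_uniform_lift:
  assumes m: "prob_space m" "sets m = sets (borel_on Y)" and N: "prob_space N" "sets N = sets (borel_on X)"
    and lift: "\<And>w. w \<in> X.lang n \<Longrightarrow> word_prob N w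
      = word_prob m (map letter_map w) / real (card (fibre_words_over n (map letter_map w)))"
  shows "pr (push Y p N) (\<lambda>y. g (pre n y)) v = pr m (\<lambda>y. g (pre n y)) v"
proof -
  interpret m: prob_space m by fact
  interpret N: prob_space N by fact
  have sets: "sets (push Y p N) = sets (borel_on Y)" by (simp add: push_def)
  have sp: "space m = Y" "space (push Y p N) = Y"
    using sets_eq_imp_space_eq[OF m(2)] sets_eq_imp_space_eq[OF sets] by auto
  have push: "prob_space (push Y p N)"
    unfolding push_def by (rule N.prob_space_distr[OF p_measurable'[OF N(2)]])
  interpret P: prob_space "push Y p N" by (rule push)
  have eq: "word_prob (push Y p N) u = word_prob m u" if u: "u \<in> Y.lang n" for u
  proof -
    have "word_prob (push Y p N) u = (\<Sum>w\<in>fibre_words_over n u. word_prob N w)"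
      unfolding word_prob_push[OF N] by (simp add: fibre_words_over_eq Y.length_lang[OF u])
    also have "\<dots> = (\<Sum>w\<in>fibre_words_over n u. word_prob m u / real (card (fibre_words_over n u)))"
      by (intro sum.cong refl) (auto simp: lift fibre_words_over_eq Y.length_lang[OF u])
    also have "\<dots> = word_prob m u" using card_fibre_words_over_lang_pos[OF u] by simp
    finally show ?thesis .
  qed
  have "pr (push Y p N) (\<lambda>y. g (pre n y)) v = (\<Sum>u\<in>{u \<in> Y.lang n. g u = v}. pr (push Y p N) (pre n) u)"
    using P.pr_comp_sum[OF Y.simple_function_pre[OF sets, of n], of g v] by (simp add: sp Y.lang_def)
  also have "\<dots> = (\<Sum>u\<in>{u \<in> Y.lang n. g u = v}. pr m (pre n) u)"
    by (intro sum.cong refl) (simp add: pr_pre Y.length_lang eq)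
  also have "\<dots> = pr m (\<lambda>y. g (pre n y)) v"
    using m.pr_comp_sum[OF Y.simple_function_pre[OF m(2), of n], of g v] by (simp add: sp Y.lang_def)
  finally show ?thesis .
qed

text \<open>A window of length \<open>length v\<close> that starts at \<open>i\<close> and ends
  within the first \<open>n\<close> letters has the law prescribed by \<open>m\<close>, by
  invariance of \<open>m\<close>. At most \<open>length v\<close> starting positions violate this,
  each with an error of at most \<open>1\<close>.\<close>

lemma sum_averaged_uniform_lift:
  assumes m: "m \<in> invariant_measures Y" and N: "prob_space N" "sets N = sets (borel_on X)"
    and lift: "\<And>w. w \<in> X.lang n \<Longrightarrow> word_prob N w
      = word_prob m (map letter_map w) / real (card (fibre_words_over n (map letter_map w)))"
    and n: "1 \<le> n"
  shows "\<bar>(\<Sum>u\<in>{u \<in> X.lang (length v). map letter_map u = v}. X.averaged N n u) - word_prob m v\<bar>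
    \<le> real (length v) / real n"
proof -
  note m' = Y.invariant_prob_space[OF m] Y.invariant_sets[OF m]
  let ?j = "length v"
  define b where "b i = word_prob (push Y p (X.shifted N i)) v" for i
  have b: "0 \<le> b i" "b i \<le> 1" for i
  proof -
    have "prob_space (push Y p (X.shifted N i))"
      unfolding push_def by (rule prob_space.prob_space_distr[OF X.prob_space_shifted[OF N] p_measurable'[OF X.sets_shifted]])
    then show "0 \<le> b i" "b i \<le> 1" unfolding b_def by (simp_all add: Y.word_prob_le_1)
  qed
  have bm: "0 \<le> word_prob m v" "word_prob m v \<le> 1" by (simp_all add: Y.word_prob_le_1 m')
  have b_eq: "b i = word_prob m v" if i: "i + ?j \<le> n" for i
  proof -
    interpret S: measure_preserving m shift by (rule Y.invariant_measure_preserving[OF m])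
    interpret Si: measure_preserving m "shift ^^ i" by (rule S.funpow_measure_preserving)
    have pre_eq: "pre ?j ((shift ^^ i) y) = take ?j (drop i (pre n y))" for y
      using i by (simp add: drop_pre take_pre)
    have S: "simple_function (borel_on X) (\<lambda>x. pre ?j (p x))" by (rule simple_function_pre_p) simp
    have "b i = pr (X.shifted N i) (\<lambda>x. pre ?j (p x)) v"
      unfolding b_def word_prob_def push_def
      by (rule pr_distr[OF p_measurable'[OF X.sets_shifted] Y.simple_function_pre[OF refl]])
    also have "\<dots> = pr N (\<lambda>x. pre ?j (p ((shift ^^ i) x))) v" by (rule X.pr_shifted[OF N(2) S])
    also have "\<dots> = pr N (\<lambda>x. take ?j (drop i (pre n (p x)))) v"
      using sets_eq_imp_space_eq[OF N(2)] by (intro pr_cong) (simp add: p_funpow_shift pre_eq)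
    also have "\<dots> = pr (push Y p N) (\<lambda>y. take ?j (drop i (pre n y))) v"
    proof -
      have "simple_function (borel_on Y) (\<lambda>y. take ?j (drop i (pre n y)))"
        using simple_function_compose[OF Y.simple_function_pre[OF refl, of n], of "\<lambda>u. take ?j (drop i u)"]
        by (simp add: comp_def)
      from pr_distr[OF p_measurable'[OF N(2)] this] show ?thesis by (simp add: push_def)
    qed
    also have "\<dots> = pr m (\<lambda>y. take ?j (drop i (pre n y))) v"
      by (rule pr_push_uniform_lift[OF m' N lift])
    also have "\<dots> = pr m (\<lambda>y. pre ?j ((shift ^^ i) y)) v" by (simp add: pre_eq)
    also have "\<dots> = word_prob m v"
      unfolding word_prob_def by (rule Si.pr_comp[OF Y.simple_function_pre[OF m'(2)]])
    finally show ?thesis .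
  qed
  have "(\<Sum>u\<in>{u \<in> X.lang ?j. map letter_map u = v}. X.averaged N n u)
      = (\<Sum>u\<in>{u \<in> X.lang ?j. map letter_map u = v}. \<Sum>i<n. word_prob (X.shifted N i) u) / real n"
    unfolding X.averaged_def by (rule sum_divide_distrib[symmetric])
  also have "\<dots> = (\<Sum>i<n. b i) / real n"
    unfolding b_def word_prob_push[OF X.prob_space_shifted[OF N] X.sets_shifted] by (subst sum.swap) (rule refl)
  finally have "(\<Sum>u\<in>{u \<in> X.lang ?j. map letter_map u = v}. X.averaged N n u) - word_prob m v
      = (\<Sum>i<n. b i - word_prob m v) / real n"
    using n by (simp add: sum_subtractf diff_divide_distrib)
  also have "\<bar>\<dots>\<bar> \<le> real ?j / real n"
  proof -
    have "\<bar>\<Sum>i<n. b i - word_prob m v\<bar> \<le> (\<Sum>i<n. \<bar>b i - word_prob m v\<bar>)" by (rule sum_abs)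
    also have "\<dots> \<le> (\<Sum>i<n. if i \<in> {n - ?j..<n} then 1 else 0)"
    proof (rule sum_mono)
      fix i assume i: "i \<in> {..<n}"
      show "\<bar>b i - word_prob m v\<bar> \<le> (if i \<in> {n - ?j..<n} then 1 else 0)"
      proof (cases "i + ?j \<le> n")
        case True
        then show ?thesis using b_eq by simp
      next
        case False
        then have "i \<in> {n - ?j..<n}" using i by auto
        moreover have "\<bar>b i - word_prob m v\<bar> \<le> 1" using b[of i] bm unfolding abs_le_iff by linarith
        ultimately show ?thesis by simp
      qed
    qed
    also have "\<dots> = (\<Sum>i\<in>{..<n} \<inter> {n - ?j..<n}. 1)" by (rule sum.inter_restrict[symmetric]) simp
    also have "\<dots> = real (card ({..<n} \<inter> {n - ?j..<n}))" by simp
    also have "\<dots> \<le> real ?j"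
    proof -
      have "card ({..<n} \<inter> {n - ?j..<n}) \<le> card {n - ?j..<n}" by (intro card_mono) auto
      then show ?thesis by simp
    qed
    finally show ?thesis by (simp add: abs_divide divide_right_mono)
  qed
  finally show ?thesis .
qed

text \<open>The uniform lifts have block entropy at least \<open>n\<close> times
  \<open>h m + \<integral> F dm\<close> for every \<open>n \<ge> 1\<close>, by the maximal
  inequality, and this linear lower bound survives averaging and the limit. The limit projects to
  \<open>m\<close> because the averages do so up to \<open>length v / n\<close>.\<close>

theorem exists_lift_of_full_entropy:
  assumes m: "m \<in> invariant_measures Y"
  obtains M where "M \<in> invariant_measures X" "push Y p M = m"
    "word_entropy m + (\<integral>y. fibre_entropy y \<partial>m) \<le> word_entropy M"
proof -
  note m' = Y.invariant_prob_space[OF m] Y.invariant_sets[OF m]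
  have "\<forall>n. \<exists>N. prob_space N \<and> sets N = sets (borel_on X) \<and> (\<forall>w\<in>X.lang n. word_prob N w
      = word_prob m (map letter_map w) / real (card (fibre_words_over n (map letter_map w))))"
    using exists_uniform_lift[OF m'] by metis
  from choice[OF this] obtain N where N: "\<And>n. prob_space (N n)" "\<And>n. sets (N n) = sets (borel_on X)"
    and lift: "\<And>n w. w \<in> X.lang n \<Longrightarrow> word_prob (N n) w
      = word_prob m (map letter_map w) / real (card (fibre_words_over n (map letter_map w)))" by blast
  obtain M r where M: "M \<in> invariant_measures X" and r: "strict_mono (r :: nat \<Rightarrow> nat)"
    and lim: "\<And>w. (\<lambda>j. X.averaged (N (r j)) (r j) w) \<longlonglongrightarrow> word_prob M w"
    using X.exists_averaged_limit[where M = N, OF N] by blast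
  note M' = X.invariant_prob_space[OF M] X.invariant_sets[OF M]
  have "push Y p M = m"
  proof (rule Y.measure_eqI_word_prob)
    fix n v assume "v \<in> Y.lang n"
    let ?U = "{u \<in> X.lang (length v). map letter_map u = v}"
    have "(\<lambda>j. real (length v) / real (r j)) \<longlonglongrightarrow> 0"
      using LIMSEQ_subseq_LIMSEQ[OF lim_const_over_n[of "real (length v)"] r] by (simp add: comp_def)
    then have "(\<lambda>j. (\<Sum>u\<in>?U. X.averaged (N (r j)) (r j) u) - word_prob m v) \<longlonglongrightarrow> 0"
    proof (rule Lim_null_comparison[rotated])
      have "1 \<le> r j" if "1 \<le> j" for j using seq_suble[OF r, of j] that by simp
      then show "\<forall>\<^sub>F j in sequentially.
          norm ((\<Sum>u\<in>?U. X.averaged (N (r j)) (r j) u) - word_prob m v) \<le> real (length v) / real (r j)"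
        unfolding eventually_sequentially real_norm_def
        by (intro exI[of _ 1] allI impI sum_averaged_uniform_lift[OF m N lift]) simp_all
    qed
    moreover have "(\<lambda>j. (\<Sum>u\<in>?U. X.averaged (N (r j)) (r j) u) - word_prob m v)
        \<longlonglongrightarrow> (\<Sum>u\<in>?U. word_prob M u) - word_prob m v"
      by (intro tendsto_diff tendsto_sum lim tendsto_const)
    ultimately have "(\<Sum>u\<in>?U. word_prob M u) - word_prob m v = 0" using LIMSEQ_unique by blast
    then show "word_prob (push Y p M) v = word_prob m v" by (simp add: word_prob_push[OF M'])
  qed (use m' Y.invariant_prob_space[OF push_invariant[OF M]] Y.invariant_sets[OF push_invariant[OF M]] in auto)
  moreover have "word_entropy m + (\<integral>y. fibre_entropy y \<partial>m) \<le> word_entropy M"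
  proof (rule X.word_entropy_averaged_limit[OF N _ M r lim])
    fix n :: nat assume n: "1 \<le> n"
    have "ent (N n) (pre n) = ent m (pre n) + (\<integral>y. ln (real (card (fibre_words_over n (pre n y)))) \<partial>m)"
      by (rule ent_uniform_lift[OF m' N(2) lift])
    then show "real n * (word_entropy m + (\<integral>y. fibre_entropy y \<partial>m)) \<le> ent (N n) (pre n)"
      using Y.word_entropy_le[OF m, of n] integral_fibre_entropy_le[OF m n] by (simp add: algebra_simps)
  qed
  ultimately show thesis using that M by blast
qed

end

section \<open>Ergodic maximizers\<close>

lemma mult_ln_add_ge:
  fixes x y :: real
  assumes "0 \<le> x" "0 \<le> y"
  shows "x * ln x + y * ln y \<le> (x + y) * ln (x + y)"
proof -
  have "a * ln a \<le> a * ln (a + b)" if "0 \<le> a" "0 \<le> b" for a b :: real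
    using that by (cases "a = 0") (auto intro!: mult_left_mono)
  from this[OF assms] this[OF assms(2,1)] show ?thesis by (simp add: algebra_simps)
qed

lemma (in measure_preserving) uniform_measure_invariant:
  assumes B: "B \<in> sets M" "T -` B \<inter> space M = B" and pos: "measure M B > 0"
  shows "measure_preserving (uniform_measure M B) T"
proof -
  have B0: "emeasure M B \<noteq> 0" "emeasure M B \<noteq> \<infinity>" using pos by (auto simp: emeasure_eq_measure)
  interpret U: prob_space "uniform_measure M B" by (rule prob_space_uniform_measure[OF B0])
  have T: "T \<in> uniform_measure M B \<rightarrow>\<^sub>M uniform_measure M B" using T_meas by simp
  have "distr (uniform_measure M B) (uniform_measure M B) T = uniform_measure M B"
  proof (rule measure_eqI)
    fix A assume "A \<in> sets (distr (uniform_measure M B) (uniform_measure M B) T)"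
    then have A: "A \<in> sets M" by simp
    have TA: "T -` A \<inter> space M \<in> sets M" by (rule measurable_sets[OF T_meas A])
    have "emeasure (distr (uniform_measure M B) (uniform_measure M B) T) A
        = emeasure (uniform_measure M B) (T -` A \<inter> space M)"
      using A by (subst emeasure_distr[OF T]) simp_all
    also have "\<dots> = emeasure M (B \<inter> (T -` A \<inter> space M)) / emeasure M B"
      by (rule emeasure_uniform_measure[OF B(1) TA])
    also have "B \<inter> (T -` A \<inter> space M) = T -` (B \<inter> A) \<inter> space M"
      by (subst (1) B(2)[symmetric]) auto
    also have "emeasure M \<dots> = emeasure (distr M M T) (B \<inter> A)"
      using A B(1) by (intro emeasure_distr[OF T_meas, symmetric]) simp
    also have "\<dots> = emeasure M (B \<inter> A)" by (simp add: T_distr)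
    finally show "emeasure (distr (uniform_measure M B) (uniform_measure M B) T) A = emeasure (uniform_measure M B) A"
      using emeasure_uniform_measure[OF B(1) A] by simp
  qed simp
  then show ?thesis using T by unfold_locales
qed

context one_sided_subshift
begin

text \<open>The two components are the measure conditioned on an invariant set of intermediate
  probability and on its complement; the value at that set tells them apart.\<close>

lemma measure_not_ergodic_split:
  assumes M: "M \<in> invariant_measures X" and "\<not> ergodic M"
  obtains t M1 M2 where "0 < t" "t < 1" "M1 \<in> invariant_measures X" "M2 \<in> invariant_measures X"
    "M1 \<noteq> M2" "\<And>w. word_prob M w = t * word_prob M1 w + (1 - t) * word_prob M2 w"
proof -
  interpret measure_preserving M shift by (rule invariant_measure_preserving[OF M])
  note sets = invariant_sets[OF M] and sp = invariant_space[OF M]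
  obtain B where B: "B \<in> sets M" "shift -` B \<inter> space M = B" and "measure M B \<noteq> 0" "measure M B \<noteq> 1"
    using assms(2) unfolding ergodic_def by blast
  then have t: "0 < measure M B" "measure M B < 1"
    using measure_nonneg[of M B] prob_le_1[of B] by (auto simp: less_le)
  let ?B' = "space M - B"
  have "shift -` ?B' \<inter> space M = space M - (shift -` B \<inter> space M)"
    using measurable_space[OF T_meas] by auto
  then have B': "?B' \<in> sets M" "shift -` ?B' \<inter> space M = ?B'" using B by auto
  have t': "measure M ?B' = 1 - measure M B" by (rule prob_compl[OF B(1)])
  let ?M1 = "uniform_measure M B" and ?M2 = "uniform_measure M ?B'"
  have nz: "emeasure M B \<noteq> 0" "emeasure M B \<noteq> \<infinity>" "emeasure M ?B' \<noteq> 0" "emeasure M ?B' \<noteq> \<infinity>"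
    using t t' by (auto simp: emeasure_eq_measure)
  show thesis
  proof (rule that[OF t])
    show "?M1 \<in> invariant_measures X" "?M2 \<in> invariant_measures X"
      using uniform_measure_invariant[OF B] uniform_measure_invariant[OF B'] t t' sets
      by (simp_all add: invariant_measures_iff)
    have "measure ?M1 B = 1" "measure ?M2 B = 0"
      using B(1) t by (simp_all add: measure_uniform_measure nz Diff_Int_distrib2)
    then show "?M1 \<noteq> ?M2" by auto
    fix w
    let ?C = "pre (length w) -` {w} \<inter> X"
    have C: "?C \<in> sets M" using pre_vimage_sets sets by simp
    have wp: "word_prob Q w = measure Q ?C" if "space Q = X" for Q
      by (simp add: word_prob_def pr_def that)
    have sp': "space ?M1 = X" "space ?M2 = X" using sp by simp_all
    have "measure M B * word_prob ?M1 w = measure M (B \<inter> ?C)"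
      unfolding wp[OF sp'(1)] measure_uniform_measure[OF nz(1,2) C] using t by simp
    moreover have "(1 - measure M B) * word_prob ?M2 w = measure M (?B' \<inter> ?C)"
      unfolding wp[OF sp'(2)] measure_uniform_measure[OF nz(3,4) C] t' using t by simp
    moreover have "measure M ?C = measure M (B \<inter> ?C) + measure M (?B' \<inter> ?C)"
    proof -
      have "?C = (B \<inter> ?C) \<union> (?B' \<inter> ?C)" by (auto simp: sp)
      then show ?thesis
        using C B(1) B'(1) by (subst (1) \<open>?C = (B \<inter> ?C) \<union> (?B' \<inter> ?C)\<close>, intro finite_measure_Union) auto
    qed
    ultimately show "word_prob M w = measure M B * word_prob ?M1 w + (1 - measure M B) * word_prob ?M2 w"
      by (simp add: word_prob_def pr_def sp)
  qed
qed

text \<open>The excess is the entropy of the choice between the two components. It does not depend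
  on \<open>n\<close>, so it disappears from the entropy rate.\<close>

lemma ent_pre_mixture_le:
  assumes M: "sets M = sets (borel_on X)"
    and M1: "prob_space M1" "sets M1 = sets (borel_on X)"
    and M2: "prob_space M2" "sets M2 = sets (borel_on X)"
    and t: "0 < t" "t < 1"
    and mix: "\<And>w. word_prob M w = t * word_prob M1 w + (1 - t) * word_prob M2 w"
  shows "ent M (pre n) \<le> t * ent M1 (pre n) + (1 - t) * ent M2 (pre n) - (t * ln t + (1 - t) * ln (1 - t))"
proof -
  have scale: "(s * a) * ln (s * a) = s * (a * ln a) + (s * ln s) * a" if "0 < s" "0 \<le> a" for s a :: real
    using that by (cases "a = 0") (simp_all add: ln_mult algebra_simps)
  have "ent M (pre n) \<le> (\<Sum>w\<in>lang n. t * - (word_prob M1 w * ln (word_prob M1 w)) + (1 - t) * - (word_prob M2 w * ln (word_prob M2 w))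
      - (t * ln t) * word_prob M1 w - ((1 - t) * ln (1 - t)) * word_prob M2 w)"
    unfolding ent_pre[OF M]
  proof (rule sum_mono)
    fix w
    have "(t * word_prob M1 w) * ln (t * word_prob M1 w) + ((1 - t) * word_prob M2 w) * ln ((1 - t) * word_prob M2 w)
        \<le> word_prob M w * ln (word_prob M w)"
      unfolding mix using t by (intro mult_ln_add_ge) simp_all
    then show "- (word_prob M w * ln (word_prob M w)) \<le> t * - (word_prob M1 w * ln (word_prob M1 w)) + (1 - t) * - (word_prob M2 w * ln (word_prob M2 w))
      - (t * ln t) * word_prob M1 w - ((1 - t) * ln (1 - t)) * word_prob M2 w"
      using t by (simp add: scale)
  qed
  also have "\<dots> = t * ent M1 (pre n) + (1 - t) * ent M2 (pre n) - (t * ln t) * (\<Sum>w\<in>lang n. word_prob M1 w)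
      - ((1 - t) * ln (1 - t)) * (\<Sum>w\<in>lang n. word_prob M2 w)"
    unfolding ent_pre[OF M1(2)] ent_pre[OF M2(2)] by (simp only: sum_subtractf sum.distrib sum_distrib_left)
  also have "\<dots> = t * ent M1 (pre n) + (1 - t) * ent M2 (pre n) - (t * ln t + (1 - t) * ln (1 - t))"
    by (simp add: sum_word_prob_lang M1 M2)
  finally show ?thesis .
qed

text \<open>Averaging leaves an invariant measure unchanged, so compactness is a special case of the
  limits of averages.\<close>

lemma invariant_measures_subsequence:
  assumes M: "\<And>n. M n \<in> invariant_measures X"
  shows "\<exists>N\<in>invariant_measures X. \<exists>r::nat \<Rightarrow> nat. strict_mono r \<and>
    (\<forall>w. (\<lambda>j. word_prob (M (r j)) w) \<longlonglongrightarrow> word_prob N w)"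
proof -
  obtain N r where N: "N \<in> invariant_measures X" and r: "strict_mono (r :: nat \<Rightarrow> nat)"
    and lim: "\<And>w. (\<lambda>j. averaged (M (r j)) (r j) w) \<longlonglongrightarrow> word_prob N w"
    using exists_averaged_limit[of M, OF invariant_prob_space[OF M] invariant_sets[OF M]] by blast
  have "averaged (M n) j w = word_prob (M n) w" if "1 \<le> j" for n j w
  proof -
    interpret measure_preserving "M n" shift by (rule invariant_measure_preserving[OF M])
    have "word_prob (shifted (M n) i) w = word_prob (M n) w" for i
    proof -
      interpret Ti: measure_preserving "M n" "shift ^^ i" by (rule funpow_measure_preserving)
      show ?thesis
        unfolding word_prob_def
        using pr_shifted[OF invariant_sets[OF M] simple_function_pre[OF refl], of n i "length w" w]
          Ti.pr_comp[OF simple_function_pre[OF invariant_sets[OF M]], of "length w" w] by simp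
    qed
    then show ?thesis using that by (simp add: averaged_def)
  qed
  then have ev: "\<forall>\<^sub>F j in sequentially. averaged (M (r j)) (r j) w = word_prob (M (r j)) w" for w
    unfolding eventually_sequentially using seq_suble[OF r] by (intro exI[of _ 1]) (meson le_trans)
  have "(\<lambda>j. word_prob (M (r j)) w) \<longlonglongrightarrow> word_prob N w" for w
    by (rule Lim_transform_eventually[OF lim ev])
  then show ?thesis using N r by blast
qed

lemma ent_pre_LIMSEQ:
  assumes M: "\<And>j. sets (M j) = sets (borel_on X)" and N: "sets N = sets (borel_on X)"
    and lim: "\<And>w. (\<lambda>j. word_prob (M j) w) \<longlonglongrightarrow> word_prob N w"
  shows "(\<lambda>j. ent (M j) (pre n)) \<longlonglongrightarrow> ent N (pre n)"
  unfolding ent_pre[OF M] ent_pre[OF N]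
  by (intro tendsto_sum tendsto_minus tendsto_mult_ln lim word_prob_nonneg)

text \<open>A strictly convex functional that is continuous in the word probabilities.\<close>

definition quadratic_functional :: "(nat \<Rightarrow> nat) measure \<Rightarrow> real" where
  "quadratic_functional M = (\<Sum>i. (1 / 2) ^ i * (word_prob M (from_nat i))\<^sup>2)"

lemma quadratic_functional_summable:
  assumes "prob_space M"
  shows "summable (\<lambda>i. (1 / 2) ^ i * (word_prob M (from_nat i))\<^sup>2)"
proof (rule summable_comparison_test)
  show "\<exists>N. \<forall>i\<ge>N. norm ((1 / 2) ^ i * (word_prob M (from_nat i))\<^sup>2) \<le> (1 / 2 :: real) ^ i"
    using word_prob_le_1[OF assms] by (intro exI[of _ 0]) (simp add: power_le_one)
qed (simp add: summable_geometric)

lemma quadratic_functional_bounds: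
  assumes "prob_space M"
  shows "0 \<le> quadratic_functional M" "quadratic_functional M \<le> 2"
proof -
  show "0 \<le> quadratic_functional M"
    unfolding quadratic_functional_def by (intro suminf_nonneg quadratic_functional_summable assms) simp
  have "quadratic_functional M \<le> (\<Sum>i. (1 / 2) ^ i)"
    unfolding quadratic_functional_def using word_prob_le_1[OF assms]
    by (intro suminf_le quadratic_functional_summable assms) (simp_all add: power_le_one summable_geometric)
  then show "quadratic_functional M \<le> 2" by (simp add: suminf_geometric)
qed

lemma quadratic_functional_LIMSEQ:
  assumes M: "\<And>j. prob_space (M j)" and lim: "\<And>w. (\<lambda>j. word_prob (M j) w) \<longlonglongrightarrow> word_prob N w"
  shows "(\<lambda>j. quadratic_functional (M j)) \<longlonglongrightarrow> quadratic_functional N"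
  unfolding quadratic_functional_def
proof (rule tannerys_theorem[where M = "\<lambda>i. (1 / 2) ^ i", THEN conjunct2, THEN conjunct2])
  show "(\<lambda>j. (1 / 2) ^ i * (word_prob (M j) (from_nat i))\<^sup>2) \<longlonglongrightarrow> (1 / 2) ^ i * (word_prob N (from_nat i))\<^sup>2" for i
    by (intro tendsto_intros lim)
  show "\<forall>\<^sub>F (i, j) in at_top \<times>\<^sub>F sequentially. norm ((1 / 2) ^ i * (word_prob (M j) (from_nat i))\<^sup>2) \<le> (1 / 2) ^ i"
    using word_prob_le_1[OF M] by (intro always_eventually) (auto simp: power_le_one)
qed (simp_all add: summable_geometric)

text \<open>The convexity defect of the square at \<open>a\<close>, \<open>b\<close> is
  \<open>t * (1 - t) * (a - b)\<^sup>2\<close>, and distinct measures differ on some word, whose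
  weight in the series is positive.\<close>

lemma quadratic_functional_strict_convex:
  assumes M: "M \<in> invariant_measures X" "M1 \<in> invariant_measures X" "M2 \<in> invariant_measures X"
    and t: "0 < t" "t < 1" and ne: "M1 \<noteq> M2"
    and mix: "\<And>w. word_prob M w = t * word_prob M1 w + (1 - t) * word_prob M2 w"
  shows "quadratic_functional M < t * quadratic_functional M1 + (1 - t) * quadratic_functional M2"
proof -
  note P = invariant_prob_space[OF M(1)] invariant_prob_space[OF M(2)] invariant_prob_space[OF M(3)]
  note S = quadratic_functional_summable[OF P(1)] quadratic_functional_summable[OF P(2)] quadratic_functional_summable[OF P(3)]
  let ?d = "\<lambda>i. (1 / 2) ^ i * (t * (1 - t) * (word_prob M1 (from_nat i) - word_prob M2 (from_nat i))\<^sup>2)"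
  have eq: "?d i = t * ((1 / 2) ^ i * (word_prob M1 (from_nat i))\<^sup>2) + (1 - t) * ((1 / 2) ^ i * (word_prob M2 (from_nat i))\<^sup>2)
      - (1 / 2) ^ i * (word_prob M (from_nat i))\<^sup>2" for i
  proof -
    have "c * (t * (1 - t) * (a - b)\<^sup>2) = t * (c * a\<^sup>2) + (1 - t) * (c * b\<^sup>2) - c * (t * a + (1 - t) * b)\<^sup>2"
      for a b c :: real
      by (simp add: power2_eq_square algebra_simps)
    then show ?thesis unfolding mix .
  qed
  have "?d sums (t * quadratic_functional M1 + (1 - t) * quadratic_functional M2 - quadratic_functional M)"
    unfolding eq quadratic_functional_def by (intro sums_diff sums_add sums_mult summable_sums S)
  then have d: "summable ?d" "suminf ?d = t * quadratic_functional M1 + (1 - t) * quadratic_functional M2 - quadratic_functional M"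
    by (auto simp: sums_iff)
  have "\<exists>w. word_prob M1 w \<noteq> word_prob M2 w"
    using ne measure_eqI_word_prob[OF P(2) invariant_sets[OF M(2)] P(3) invariant_sets[OF M(3)]] by blast
  then obtain w where w: "word_prob M1 w \<noteq> word_prob M2 w" by blast
  have "0 < suminf ?d"
    using w t by (intro suminf_pos2[OF d(1), of "to_nat w"]) simp_all
  then show ?thesis using d(2) by simp
qed

end

context factor
begin

section \<open>The weighted entropy functional\<close>

lemma ent_push_LIMSEQ:
  assumes M: "\<And>j. M j \<in> invariant_measures X" and N: "N \<in> invariant_measures X"
    and lim: "\<And>w. (\<lambda>j. word_prob (M j) w) \<longlonglongrightarrow> word_prob N w"
  shows "(\<lambda>j. ent (push Y p (M j)) (pre n)) \<longlonglongrightarrow> ent (push Y p N) (pre n)"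
proof (rule Y.ent_pre_LIMSEQ[OF Y.invariant_sets[OF push_invariant[OF M]] Y.invariant_sets[OF push_invariant[OF N]]])
  fix v
  show "(\<lambda>j. word_prob (push Y p (M j)) v) \<longlonglongrightarrow> word_prob (push Y p N) v"
    unfolding word_prob_push[OF X.invariant_prob_space[OF M] X.invariant_sets[OF M]]
      word_prob_push[OF X.invariant_prob_space[OF N] X.invariant_sets[OF N]]
    by (intro tendsto_sum lim)
qed

definition weighted_entropy :: "real \<Rightarrow> (nat \<Rightarrow> nat) measure \<Rightarrow> real" where
  "weighted_entropy \<alpha> M = word_entropy M + \<alpha> * word_entropy (push Y p M)"

lemma weighted_entropy_LIMSEQ:
  assumes M: "M \<in> invariant_measures X"
  shows "(\<lambda>n. (ent M (pre n) + \<alpha> * ent (push Y p M) (pre n)) / real n) \<longlonglongrightarrow> weighted_entropy \<alpha> M"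
proof -
  have "(\<lambda>n. ent M (pre n) / real n + \<alpha> * (ent (push Y p M) (pre n) / real n)) \<longlonglongrightarrow> weighted_entropy \<alpha> M"
    unfolding weighted_entropy_def
    by (intro tendsto_intros X.word_entropy_LIMSEQ[OF M] Y.word_entropy_LIMSEQ[OF push_invariant[OF M]])
  then show ?thesis by (simp add: add_divide_distrib)
qed

lemma weighted_entropy_le:
  assumes M: "M \<in> invariant_measures X" and \<alpha>: "0 \<le> \<alpha>"
  shows "real n * weighted_entropy \<alpha> M \<le> ent M (pre n) + \<alpha> * ent (push Y p M) (pre n)"
proof -
  have "\<alpha> * (real n * word_entropy (push Y p M)) \<le> \<alpha> * ent (push Y p M) (pre n)"
    by (intro mult_left_mono Y.word_entropy_le push_invariant M \<alpha>)
  then show ?thesis using X.word_entropy_le[OF M, of n] by (simp add: weighted_entropy_def algebra_simps)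
qed

lemma weighted_entropy_bounded:
  assumes M: "M \<in> invariant_measures X" and \<alpha>: "0 \<le> \<alpha>"
  shows "weighted_entropy \<alpha> M \<le> ln (real k) + \<alpha> * ln (real l)"
proof -
  note N = push_invariant[OF M]
  have "ent M (pre 1) \<le> ln (real k)"
    using X.ent_pre_le[OF X.invariant_prob_space[OF M] X.invariant_sets[OF M], of 1] by simp
  moreover have "\<alpha> * ent (push Y p M) (pre 1) \<le> \<alpha> * ln (real l)"
    using Y.ent_pre_le[OF Y.invariant_prob_space[OF N] Y.invariant_sets[OF N], of 1] \<alpha> by (simp add: mult_left_mono)
  ultimately show ?thesis using weighted_entropy_le[OF M \<alpha>, of 1] by simp
qed

text \<open>For each \<open>n\<close> the block entropies are continuous in the word probabilities
  and dominate \<open>n\<close> times the functional; the bound passes to the limit in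
  \<open>j\<close> before \<open>n\<close> grows. The sequence \<open>s\<close> covers both
  maximizing sequences and sequences of maximizers.\<close>

lemma weighted_entropy_upper_semicontinuous:
  assumes M: "\<And>j. M j \<in> invariant_measures X" and N: "N \<in> invariant_measures X" and \<alpha>: "0 \<le> \<alpha>"
    and lim: "\<And>w. (\<lambda>j. word_prob (M j) w) \<longlonglongrightarrow> word_prob N w"
    and s: "\<And>j. s j \<le> weighted_entropy \<alpha> (M j)" "s \<longlonglongrightarrow> s'"
  shows "s' \<le> weighted_entropy \<alpha> N"
proof (rule LIMSEQ_le_const[OF weighted_entropy_LIMSEQ[OF N]], intro exI allI impI)
  fix n :: nat assume n: "1 \<le> n"
  have "real n * s' \<le> ent N (pre n) + \<alpha> * ent (push Y p N) (pre n)"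
  proof (rule LIMSEQ_le)
    show "(\<lambda>j. real n * s j) \<longlonglongrightarrow> real n * s'" by (intro tendsto_intros s)
    show "(\<lambda>j. ent (M j) (pre n) + \<alpha> * ent (push Y p (M j)) (pre n)) \<longlonglongrightarrow> ent N (pre n) + \<alpha> * ent (push Y p N) (pre n)"
      by (intro tendsto_intros ent_push_LIMSEQ[OF M N lim]
          X.ent_pre_LIMSEQ[OF X.invariant_sets[OF M] X.invariant_sets[OF N] lim])
    have "real n * s j \<le> ent (M j) (pre n) + \<alpha> * ent (push Y p (M j)) (pre n)" for j
      using weighted_entropy_le[OF M \<alpha>, of n j] mult_left_mono[OF s(1), of "real n" j] by simp
    then show "\<exists>j0. \<forall>j\<ge>j0. real n * s j \<le> ent (M j) (pre n) + \<alpha> * ent (push Y p (M j)) (pre n)" by blast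
  qed
  then show "s' \<le> (ent N (pre n) + \<alpha> * ent (push Y p N) (pre n)) / real n" using n by (simp add: field_simps)
qed

text \<open>Pushing forward preserves the mixture, so both entropies exceed the mixed ones by
  bounded amounts, collected in \<open>E\<close> and removed by division by
  \<open>n\<close>.\<close>

lemma weighted_entropy_mixture_le:
  assumes M: "M \<in> invariant_measures X" "M1 \<in> invariant_measures X" "M2 \<in> invariant_measures X"
    and t: "0 < t" "t < 1" and \<alpha>: "0 \<le> \<alpha>"
    and mix: "\<And>w. word_prob M w = t * word_prob M1 w + (1 - t) * word_prob M2 w"
  shows "weighted_entropy \<alpha> M \<le> t * weighted_entropy \<alpha> M1 + (1 - t) * weighted_entropy \<alpha> M2"
proof -
  let ?A = "\<lambda>M n. ent M (pre n) + \<alpha> * ent (push Y p M) (pre n)"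
  define E where "E = (1 + \<alpha>) * - (t * ln t + (1 - t) * ln (1 - t))"
  have P: "prob_space M" "prob_space M1" "prob_space M2" and S: "sets M = sets (borel_on X)" "sets M1 = sets (borel_on X)" "sets M2 = sets (borel_on X)"
    using M X.invariant_prob_space X.invariant_sets by auto
  note PI = push_invariant[OF M(1)] push_invariant[OF M(2)] push_invariant[OF M(3)]
  have mix': "word_prob (push Y p M) v = t * word_prob (push Y p M1) v + (1 - t) * word_prob (push Y p M2) v" for v
    by (simp add: word_prob_push P S mix sum.distrib sum_distrib_left)
  have A: "?A M n \<le> t * ?A M1 n + (1 - t) * ?A M2 n + E" for n
  proof -
    have 1: "ent M (pre n) \<le> t * ent M1 (pre n) + (1 - t) * ent M2 (pre n) - (t * ln t + (1 - t) * ln (1 - t))"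
      by (rule X.ent_pre_mixture_le[OF S(1) P(2) S(2) P(3) S(3) t mix])
    have "ent (push Y p M) (pre n) \<le> t * ent (push Y p M1) (pre n) + (1 - t) * ent (push Y p M2) (pre n)
        - (t * ln t + (1 - t) * ln (1 - t))"
      by (rule Y.ent_pre_mixture_le[OF Y.invariant_sets[OF PI(1)] Y.invariant_prob_space[OF PI(2)] Y.invariant_sets[OF PI(2)]
            Y.invariant_prob_space[OF PI(3)] Y.invariant_sets[OF PI(3)] t mix'])
    from mult_left_mono[OF this \<alpha>] 1 show ?thesis by (simp add: E_def algebra_simps)
  qed
  have "(\<lambda>n. t * (?A M1 n / real n) + (1 - t) * (?A M2 n / real n) + E / real n)
      \<longlonglongrightarrow> t * weighted_entropy \<alpha> M1 + (1 - t) * weighted_entropy \<alpha> M2 + 0"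
    by (intro tendsto_intros weighted_entropy_LIMSEQ M lim_const_over_n)
  then have "weighted_entropy \<alpha> M \<le> t * weighted_entropy \<alpha> M1 + (1 - t) * weighted_entropy \<alpha> M2 + 0"
  proof (rule LIMSEQ_le[OF weighted_entropy_LIMSEQ[OF M(1)]])
    show "\<exists>n0. \<forall>n\<ge>n0. ?A M n / real n \<le> t * (?A M1 n / real n) + (1 - t) * (?A M2 n / real n) + E / real n"
    proof (intro exI allI impI)
      fix n :: nat assume "1 \<le> n"
      have scale: "t * (x / real n) + (1 - t) * (y / real n) + E / real n = (t * x + (1 - t) * y + E) / real n" for x y
        by (simp add: add_divide_distrib)
      have "?A M n / real n \<le> (t * ?A M1 n + (1 - t) * ?A M2 n + E) / real n"
        by (intro divide_right_mono A) simp
      then show "?A M n / real n \<le> t * (?A M1 n / real n) + (1 - t) * (?A M2 n / real n) + E / real n"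
        unfolding scale .
    qed
  qed
  then show ?thesis by simp
qed

text \<open>Among the maximizers, one that also maximizes the strictly convex functional is an extreme point.\<close>

theorem exists_ergodic_maximizer:
  assumes \<alpha>: "0 \<le> \<alpha>"
  obtains M where "M \<in> invariant_measures X" "ergodic M"
    "\<And>N. N \<in> invariant_measures X \<Longrightarrow> weighted_entropy \<alpha> N \<le> weighted_entropy \<alpha> M"
proof -
  let ?I = "invariant_measures X" and ?\<phi> = "weighted_entropy \<alpha>" and ?V = "X.quadratic_functional"
  \<comment> \<open>Stated for an arbitrary functional because it is used twice, for the weighted
    entropy and then for the quadratic functional on its maximizers.\<close>
  have approx: "\<exists>M. \<forall>j::nat. M j \<in> A \<and> Sup (f ` A) - 1 / real (Suc j) \<le> f (M j)"
    if "A \<noteq> {}" for A and f :: "(nat \<Rightarrow> nat) measure \<Rightarrow> real"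
  proof (rule choice, rule allI)
    fix j :: nat
    have "Sup (f ` A) - 1 / real (Suc j) < Sup (f ` A)" by simp
    then obtain z where "z \<in> f ` A" "Sup (f ` A) - 1 / real (Suc j) < z"
      using less_cSupE[of "Sup (f ` A) - 1 / real (Suc j)" "f ` A"] \<open>A \<noteq> {}\<close> by blast
    then show "\<exists>M. M \<in> A \<and> Sup (f ` A) - 1 / real (Suc j) \<le> f M" by force
  qed
  have approach: "(\<lambda>j. c - 1 / real (Suc (r j))) \<longlonglongrightarrow> c" if "strict_mono (r :: nat \<Rightarrow> nat)" for c :: real and r
  proof -
    have "(\<lambda>j. c - 1 / real (Suc j)) \<longlonglongrightarrow> c - 0" by (intro tendsto_diff tendsto_const LIMSEQ_Suc[OF lim_const_over_n])
    from LIMSEQ_subseq_LIMSEQ[OF this that] show ?thesis by (simp add: comp_def)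
  qed
  define s where "s = Sup (?\<phi> ` ?I)"
  have bdd: "bdd_above (?\<phi> ` ?I)"
    using weighted_entropy_bounded[OF _ \<alpha>] by (intro bdd_aboveI2) auto
  have s: "?\<phi> N \<le> s" if "N \<in> ?I" for N unfolding s_def using that bdd by (intro cSUP_upper) auto
  define K where "K = {M \<in> ?I. s \<le> ?\<phi> M}"
  have K_nonempty: "K \<noteq> {}"
  proof -
    obtain M where M: "\<And>j::nat. M j \<in> ?I" "\<And>j. s - 1 / real (Suc j) \<le> ?\<phi> (M j)"
      using approx[OF X.invariant_measures_nonempty, of ?\<phi>] unfolding s_def by blast
    obtain N r where N: "N \<in> ?I" "strict_mono (r :: nat \<Rightarrow> nat)" "\<And>w. (\<lambda>j. word_prob (M (r j)) w) \<longlonglongrightarrow> word_prob N w"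
      using X.invariant_measures_subsequence[of M, OF M(1)] by blast
    have "s \<le> ?\<phi> N"
      by (rule weighted_entropy_upper_semicontinuous[OF M(1) N(1) \<alpha> N(3) M(2) approach[OF N(2)]])
    then show ?thesis using N(1) by (auto simp: K_def)
  qed
  define v where "v = Sup (?V ` K)"
  have bdd_v: "bdd_above (?V ` K)"
    using X.quadratic_functional_bounds(2)[OF X.invariant_prob_space] by (intro bdd_aboveI2) (auto simp: K_def)
  have v: "?V N \<le> v" if "N \<in> K" for N unfolding v_def using that bdd_v by (intro cSUP_upper) auto
  obtain M where M: "\<And>j::nat. M j \<in> K" "\<And>j. v - 1 / real (Suc j) \<le> ?V (M j)"
    using approx[OF K_nonempty, of ?V] unfolding v_def by blast
  have MI: "M j \<in> ?I" and M\<phi>: "s \<le> ?\<phi> (M j)" for j using M(1) by (auto simp: K_def)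
  obtain N r where N: "N \<in> ?I" "strict_mono (r :: nat \<Rightarrow> nat)" "\<And>w. (\<lambda>j. word_prob (M (r j)) w) \<longlonglongrightarrow> word_prob N w"
    using X.invariant_measures_subsequence[of M, OF MI] by blast
  have s_N: "s \<le> ?\<phi> N"
    by (rule weighted_entropy_upper_semicontinuous[OF MI N(1) \<alpha> N(3) M\<phi> tendsto_const])
  have v_N: "v \<le> ?V N"
    by (rule LIMSEQ_le[OF approach[OF N(2)] X.quadratic_functional_LIMSEQ[OF X.invariant_prob_space[OF MI] N(3)]])
      (use M(2) in blast)
  have "ergodic N"
  proof (rule ccontr)
    assume "\<not> ergodic N"
    with N(1) obtain t M1 M2 where t: "0 < t" "t < 1" and M12: "M1 \<in> ?I" "M2 \<in> ?I" "M1 \<noteq> M2"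
      and mix: "\<And>w. word_prob N w = t * word_prob M1 w + (1 - t) * word_prob M2 w"
      by (rule X.measure_not_ergodic_split) blast
    \<comment> \<open>Both values are at most \<open>s\<close>, so a convex combination that reaches
      \<open>s\<close> makes \<open>M1\<close> and \<open>M2\<close> maximizers too; then strict
      convexity contradicts the maximality of \<open>?V N\<close> among the maximizers.\<close>
    have le: "s \<le> t * ?\<phi> M1 + (1 - t) * ?\<phi> M2"
      using weighted_entropy_mixture_le[OF N(1) M12(1,2) t \<alpha> mix] s_N by linarith
    have "(1 - t) * ?\<phi> M2 \<le> (1 - t) * s" "t * ?\<phi> M1 \<le> t * s"
      using t s[OF M12(1)] s[OF M12(2)] by (auto intro!: mult_left_mono)
    then have "t * s \<le> t * ?\<phi> M1" "(1 - t) * s \<le> (1 - t) * ?\<phi> M2"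
      using le by (simp_all add: algebra_simps)
    then have "M1 \<in> K" "M2 \<in> K" using t M12 by (simp_all add: K_def)
    then have "t * ?V M1 \<le> t * v" "(1 - t) * ?V M2 \<le> (1 - t) * v"
      using t v by (auto intro!: mult_left_mono)
    then have "t * ?V M1 + (1 - t) * ?V M2 \<le> v" by (simp add: algebra_simps)
    then show False
      using X.quadratic_functional_strict_convex[OF N(1) M12(1,2) t M12(3) mix] v_N by linarith
  qed
  then show thesis using that[OF N(1)] s s_N by (meson order_trans)
qed

end

section \<open>The variational equalities\<close>

context factor
begin

lemma relative_variational_principle:
  assumes m: "m \<in> invariant_measures Y"
  shows "(SUP N\<in>{N \<in> invariant_measures X. push Y p N = m}. h N)
    = ereal (word_entropy m + (\<integral>y. fibre_entropy y \<partial>m))"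
proof (rule antisym)
  show "(SUP N\<in>{N \<in> invariant_measures X. push Y p N = m}. h N)
      \<le> ereal (word_entropy m + (\<integral>y. fibre_entropy y \<partial>m))"
    using word_entropy_le_fibre_entropy by (intro SUP_least) (auto simp: X.h_eq_word_entropy)
  obtain M where M: "M \<in> invariant_measures X" "push Y p M = m"
    "word_entropy m + (\<integral>y. fibre_entropy y \<partial>m) \<le> word_entropy M"
    by (rule exists_lift_of_full_entropy[OF m])
  then show "ereal (word_entropy m + (\<integral>y. fibre_entropy y \<partial>m))
      \<le> (SUP N\<in>{N \<in> invariant_measures X. push Y p N = m}. h N)"
    by (intro SUP_upper2[of M]) (simp_all add: X.h_eq_word_entropy)
qed

section \<open>Comparison of all suprema with one maximizer of the weighted entropy\<close>

context
  fixes \<alpha> :: real and M0 :: "(nat \<Rightarrow> nat) measure"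
  assumes \<alpha>: "\<alpha> > 0" and M0: "M0 \<in> invariant_measures X"
    and maximal: "\<And>N. N \<in> invariant_measures X \<Longrightarrow> weighted_entropy \<alpha> N \<le> weighted_entropy \<alpha> M0"
begin

text \<open>A lift of \<open>m\<close> with full relative entropy has at least the left side as its
  weighted entropy.\<close>

lemma weighted_entropy_factor_le:
  assumes m: "m \<in> invariant_measures Y"
  shows "(\<alpha> + 1) * word_entropy m + (\<integral>y. fibre_entropy y \<partial>m) \<le> weighted_entropy \<alpha> M0"
proof -
  obtain M where M: "M \<in> invariant_measures X" "push Y p M = m"
    "word_entropy m + (\<integral>y. fibre_entropy y \<partial>m) \<le> word_entropy M"
    by (rule exists_lift_of_full_entropy[OF m])
  then show ?thesis using maximal[OF M(1)] by (simp add: weighted_entropy_def algebra_simps)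
qed

text \<open>The weighted entropy of \<open>M\<close> is at most the middle expression by the upper
  bound, and that is at most the maximum by lifting. Equality overall means equality in both
  steps.\<close>

lemma maximal_iff:
  assumes M: "M \<in> invariant_measures X"
  shows "weighted_entropy \<alpha> M = weighted_entropy \<alpha> M0 \<longleftrightarrow>
      (\<alpha> + 1) * word_entropy (push Y p M) + (\<integral>y. fibre_entropy y \<partial>push Y p M) = weighted_entropy \<alpha> M0
      \<and> word_entropy M = word_entropy (push Y p M) + (\<integral>y. fibre_entropy y \<partial>push Y p M)"
  using word_entropy_le_fibre_entropy[OF M] weighted_entropy_factor_le[OF push_invariant[OF M]]
  unfolding weighted_entropy_def[of \<alpha> M] by (auto simp: algebra_simps)

lemma SUP_weighted_entropy:
  "(SUP M\<in>invariant_measures X. h M + ereal \<alpha> * h (push Y p M)) = ereal (weighted_entropy \<alpha> M0)"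
proof (rule SUP_eqI)
  fix M assume M: "M \<in> invariant_measures X"
  then show "h M + ereal \<alpha> * h (push Y p M) \<le> ereal (weighted_entropy \<alpha> M0)"
    using maximal[OF M] by (simp add: X.h_eq_word_entropy Y.h_eq_word_entropy push_invariant weighted_entropy_def)
next
  fix z assume "\<And>M. M \<in> invariant_measures X \<Longrightarrow> h M + ereal \<alpha> * h (push Y p M) \<le> z"
  from this[OF M0] show "ereal (weighted_entropy \<alpha> M0) \<le> z"
    using M0 by (simp add: X.h_eq_word_entropy Y.h_eq_word_entropy push_invariant weighted_entropy_def)
qed

lemma SUP_factor_pressure:
  "(SUP m\<in>invariant_measures Y. h m + ereal (1 / (\<alpha> + 1) * (\<integral>y. fibre_entropy y \<partial>m)))
    = ereal (weighted_entropy \<alpha> M0 / (\<alpha> + 1))"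
proof (rule SUP_eqI)
  fix m assume m: "m \<in> invariant_measures Y"
  have "word_entropy m + 1 / (\<alpha> + 1) * (\<integral>y. fibre_entropy y \<partial>m)
      = ((\<alpha> + 1) * word_entropy m + (\<integral>y. fibre_entropy y \<partial>m)) / (\<alpha> + 1)"
    using \<alpha> by (simp add: field_simps)
  also have "\<dots> \<le> weighted_entropy \<alpha> M0 / (\<alpha> + 1)"
    using weighted_entropy_factor_le[OF m] \<alpha> by (intro divide_right_mono) auto
  finally have "word_entropy m + 1 / (\<alpha> + 1) * (\<integral>y. fibre_entropy y \<partial>m) \<le> weighted_entropy \<alpha> M0 / (\<alpha> + 1)" .
  then show "h m + ereal (1 / (\<alpha> + 1) * (\<integral>y. fibre_entropy y \<partial>m)) \<le> ereal (weighted_entropy \<alpha> M0 / (\<alpha> + 1))"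
    by (simp add: Y.h_eq_word_entropy[OF m])
next
  fix z assume z: "\<And>m. m \<in> invariant_measures Y \<Longrightarrow> h m + ereal (1 / (\<alpha> + 1) * (\<integral>y. fibre_entropy y \<partial>m)) \<le> z"
  note m = push_invariant[OF M0]
  \<comment> \<open>Applied to \<open>M0\<close> itself, \<open>maximal_iff\<close> shows that its
    image attains the supremum on \<open>Y\<close>.\<close>
  have "weighted_entropy \<alpha> M0 / (\<alpha> + 1)
      = word_entropy (push Y p M0) + 1 / (\<alpha> + 1) * (\<integral>y. fibre_entropy y \<partial>push Y p M0)"
    using maximal_iff[OF M0] \<alpha> by (simp add: field_simps)
  then show "ereal (weighted_entropy \<alpha> M0 / (\<alpha> + 1)) \<le> z"
    using z[OF m] by (simp add: Y.h_eq_word_entropy[OF m])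
qed

text \<open>Multiplied by \<open>\<alpha> + 1\<close>, the left side is at most
  \<open>(\<alpha> + 1) * ?e + ?I\<close> by the relative upper bound, and this is at most
  \<open>?w\<close>. These are the inequalities of \<open>maximal_iff\<close>, so the cases of
  equality coincide.\<close>

lemma lifted_pressure_le:
  assumes M: "M \<in> invariant_measures X"
  shows "word_entropy M - \<alpha> / (\<alpha> + 1) * (\<integral>y. fibre_entropy y \<partial>push Y p M) \<le> weighted_entropy \<alpha> M0 / (\<alpha> + 1)"
    and "word_entropy M - \<alpha> / (\<alpha> + 1) * (\<integral>y. fibre_entropy y \<partial>push Y p M) = weighted_entropy \<alpha> M0 / (\<alpha> + 1)
      \<longleftrightarrow> weighted_entropy \<alpha> M = weighted_entropy \<alpha> M0"
proof -
  let ?e = "word_entropy (push Y p M)" and ?I = "\<integral>y. fibre_entropy y \<partial>push Y p M"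
  let ?w = "weighted_entropy \<alpha> M0"
  have 1: "word_entropy M \<le> ?e + ?I" by (rule word_entropy_le_fibre_entropy[OF M])
  have 2: "(\<alpha> + 1) * ?e + ?I \<le> ?w" by (rule weighted_entropy_factor_le[OF push_invariant[OF M]])
  have scale: "(\<alpha> + 1) * (word_entropy M - \<alpha> / (\<alpha> + 1) * ?I) = (\<alpha> + 1) * word_entropy M - \<alpha> * ?I"
    using \<alpha> by (simp add: field_simps)
  have 3: "(\<alpha> + 1) * word_entropy M \<le> (\<alpha> + 1) * (?e + ?I)" using 1 \<alpha> by (intro mult_left_mono) auto
  have le: "(\<alpha> + 1) * word_entropy M - \<alpha> * ?I \<le> ?w" using 2 3 by (simp add: algebra_simps)
  then show "word_entropy M - \<alpha> / (\<alpha> + 1) * ?I \<le> ?w / (\<alpha> + 1)"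
    using scale \<alpha> by (simp add: pos_le_divide_eq mult.commute)
  have "word_entropy M - \<alpha> / (\<alpha> + 1) * ?I = ?w / (\<alpha> + 1) \<longleftrightarrow> (\<alpha> + 1) * word_entropy M - \<alpha> * ?I = ?w"
    using scale \<alpha> by (simp add: eq_divide_eq mult.commute)
  also have "\<dots> \<longleftrightarrow> (\<alpha> + 1) * ?e + ?I = ?w \<and> word_entropy M = ?e + ?I"
  proof
    assume eq: "(\<alpha> + 1) * word_entropy M - \<alpha> * ?I = ?w"
    then have "(\<alpha> + 1) * word_entropy M = (\<alpha> + 1) * (?e + ?I)" using 2 3 by (simp add: algebra_simps)
    then have "word_entropy M = ?e + ?I" using \<alpha> by simp
    then show "(\<alpha> + 1) * ?e + ?I = ?w \<and> word_entropy M = ?e + ?I" using eq by (simp add: algebra_simps)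
  qed (auto simp: algebra_simps)
  finally show "word_entropy M - \<alpha> / (\<alpha> + 1) * ?I = ?w / (\<alpha> + 1) \<longleftrightarrow> weighted_entropy \<alpha> M = ?w"
    using maximal_iff[OF M] by simp
qed

lemma integral_fibre_entropy_push:
  "M \<in> invariant_measures X \<Longrightarrow> (\<integral>x. fibre_entropy (p x) \<partial>M) = (\<integral>y. fibre_entropy y \<partial>push Y p M)"
  by (rule integral_push[OF X.invariant_sets fibre_entropy_measurable, symmetric])

lemma SUP_lifted_pressure:
  "(SUP M\<in>invariant_measures X. h M - ereal (\<alpha> / (\<alpha> + 1) * (\<integral>x. fibre_entropy (p x) \<partial>M)))
    = ereal (weighted_entropy \<alpha> M0 / (\<alpha> + 1))"
proof (rule SUP_eqI)
  fix M assume M: "M \<in> invariant_measures X"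
  show "h M - ereal (\<alpha> / (\<alpha> + 1) * (\<integral>x. fibre_entropy (p x) \<partial>M)) \<le> ereal (weighted_entropy \<alpha> M0 / (\<alpha> + 1))"
    using lifted_pressure_le(1)[OF M] by (simp add: X.h_eq_word_entropy[OF M] integral_fibre_entropy_push[OF M])
next
  fix z assume "\<And>M. M \<in> invariant_measures X \<Longrightarrow> h M - ereal (\<alpha> / (\<alpha> + 1) * (\<integral>x. fibre_entropy (p x) \<partial>M)) \<le> z"
  from this[OF M0] show "ereal (weighted_entropy \<alpha> M0 / (\<alpha> + 1)) \<le> z"
    using lifted_pressure_le(2)[OF M0] by (simp add: X.h_eq_word_entropy[OF M0] integral_fibre_entropy_push[OF M0])
qed

lemma K_set_iff:
  "M \<in> K_set X Y p \<alpha> \<longleftrightarrow> M \<in> invariant_measures X \<and> weighted_entropy \<alpha> M = weighted_entropy \<alpha> M0"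
  unfolding K_set_def SUP_weighted_entropy
  by (auto simp: X.h_eq_word_entropy Y.h_eq_word_entropy push_invariant weighted_entropy_def)

lemma K_set_eq_equilibrium_states:
  "K_set X Y p \<alpha> = equilibrium_states X (\<lambda>x. - (\<alpha> / (\<alpha> + 1)) * fibre_entropy (p x))"
proof -
  have eq: "h N + ereal (\<integral>x. - (\<alpha> / (\<alpha> + 1)) * fibre_entropy (p x) \<partial>N)
      = h N - ereal (\<alpha> / (\<alpha> + 1) * (\<integral>x. fibre_entropy (p x) \<partial>N))"
    if "N \<in> invariant_measures X" for N
    unfolding integral_mult_right_zero by (simp add: X.h_eq_word_entropy[OF that])
  have "(SUP N\<in>invariant_measures X. h N + ereal (\<integral>x. - (\<alpha> / (\<alpha> + 1)) * fibre_entropy (p x) \<partial>N))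
      = ereal (weighted_entropy \<alpha> M0 / (\<alpha> + 1))"
    unfolding SUP_lifted_pressure[symmetric] by (rule SUP_cong[OF refl eq])
  then have "M \<in> equilibrium_states X (\<lambda>x. - (\<alpha> / (\<alpha> + 1)) * fibre_entropy (p x)) \<longleftrightarrow>
      M \<in> invariant_measures X \<and> h M - ereal (\<alpha> / (\<alpha> + 1) * (\<integral>x. fibre_entropy (p x) \<partial>M))
        = ereal (weighted_entropy \<alpha> M0 / (\<alpha> + 1))" for M
    unfolding equilibrium_states_def using eq by auto
  then show ?thesis
    using lifted_pressure_le(2)
    by (auto simp: K_set_iff X.h_eq_word_entropy integral_fibre_entropy_push)
qed

text \<open>Of the two equalities in \<open>maximal_iff\<close>, the first, divided by
  \<open>\<alpha> + 1\<close>, says that the image is an equilibrium state, and the second is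
  maximal relative entropy by the relative variational principle.\<close>

lemma K_set_iff_factor:
  "M \<in> K_set X Y p \<alpha> \<longleftrightarrow>
    push Y p M \<in> equilibrium_states Y (\<lambda>y. 1 / (\<alpha> + 1) * fibre_entropy y)
    \<and> max_relative_entropy X Y p M (push Y p M)"
proof (cases "M \<in> invariant_measures X")
  case True
  note m = push_invariant[OF True]
  let ?e = "word_entropy (push Y p M)" and ?I = "\<integral>y. fibre_entropy y \<partial>push Y p M"
  have "push Y p M \<in> equilibrium_states Y (\<lambda>y. 1 / (\<alpha> + 1) * fibre_entropy y)
      \<longleftrightarrow> ?e + 1 / (\<alpha> + 1) * ?I = weighted_entropy \<alpha> M0 / (\<alpha> + 1)"
    unfolding equilibrium_states_def integral_mult_right_zero SUP_factor_pressure
    by (simp add: m Y.h_eq_word_entropy)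
  also have "\<dots> \<longleftrightarrow> (\<alpha> + 1) * ?e + ?I = weighted_entropy \<alpha> M0"
    using \<alpha> by (simp add: field_simps)
  finally have 1: "push Y p M \<in> equilibrium_states Y (\<lambda>y. 1 / (\<alpha> + 1) * fibre_entropy y)
      \<longleftrightarrow> (\<alpha> + 1) * ?e + ?I = weighted_entropy \<alpha> M0" .
  have "max_relative_entropy X Y p M (push Y p M) \<longleftrightarrow> word_entropy M = ?e + ?I"
    unfolding max_relative_entropy_def relative_variational_principle[OF m]
    by (simp add: True m X.h_eq_word_entropy)
  then show ?thesis using 1 maximal_iff[OF True] by (simp add: K_set_iff True)
next
  case False
  then show ?thesis by (simp add: K_set_iff max_relative_entropy_def)
qed

end

end

text \<open>\<open>F\<close> is only specified on \<open>Y\<close>, which carries the invariant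
  measures, so there it may be exchanged for \<open>fibre_entropy\<close>.\<close>

lemma (in one_sided_subshift) integral_cong_on:
  fixes f g :: "(nat \<Rightarrow> nat) \<Rightarrow> real"
  shows "M \<in> invariant_measures X \<Longrightarrow> (\<And>x. x \<in> X \<Longrightarrow> f x = g x) \<Longrightarrow> (\<integral>x. f x \<partial>M) = (\<integral>x. g x \<partial>M)"
  by (rule Bochner_Integration.integral_cong) (simp_all add: invariant_space)

lemma (in one_sided_subshift) equilibrium_states_cong:
  assumes "\<And>x. x \<in> X \<Longrightarrow> f x = g x"
  shows "equilibrium_states X f = equilibrium_states X g"
proof -
  have eq: "h N + ereal (\<integral>x. f x \<partial>N) = h N + ereal (\<integral>x. g x \<partial>N)" if "N \<in> invariant_measures X" for N
    using integral_cong_on[OF that, of f g] assms by simp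
  have "(SUP N\<in>invariant_measures X. h N + ereal (\<integral>x. f x \<partial>N)) = (SUP N\<in>invariant_measures X. h N + ereal (\<integral>x. g x \<partial>N))"
    by (rule SUP_cong[OF refl eq])
  then show ?thesis unfolding equilibrium_states_def using eq by auto
qed

theorem theorem3p12:
  fixes k l :: nat
    and X Y :: "(nat \<Rightarrow> nat) set"
    and p :: "(nat \<Rightarrow> nat) \<Rightarrow> (nat \<Rightarrow> nat)"
    and D :: "nat \<Rightarrow> (nat \<Rightarrow> nat) \<Rightarrow> (nat \<Rightarrow> nat) set"
    and F :: "(nat \<Rightarrow> nat) \<Rightarrow> real"
    and \<alpha> :: real
  assumes "subshift k X" and "subshift l Y"
    and "factor_map X Y p" and "one_block X p"
    and "\<alpha> > 0"
    and "\<And>n y. n \<ge> 1 \<Longrightarrow> y \<in> Y \<Longrightarrow> fibre_selection X p n y (D n y)"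
    and "\<And>y. y \<in> Y \<Longrightarrow> F y = fibre_growth D y"
  shows "F \<in> borel_measurable (borel_on Y) \<and> bounded (F ` Y)
    \<and> (SUP \<mu>\<in>invariant_measures X. h \<mu> + ereal \<alpha> * h (push Y p \<mu>))
      = ereal (\<alpha> + 1) *
        (SUP m\<in>invariant_measures Y. h m + ereal (1 / (\<alpha> + 1) * (\<integral>y. F y \<partial>m)))
    \<and> ereal (\<alpha> + 1) *
        (SUP m\<in>invariant_measures Y. h m + ereal (1 / (\<alpha> + 1) * (\<integral>y. F y \<partial>m)))
      = ereal (\<alpha> + 1) *
        (SUP \<mu>\<in>invariant_measures X. h \<mu> - ereal (\<alpha> / (\<alpha> + 1) * (\<integral>x. F (p x) \<partial>\<mu>)))
    \<and> (\<exists>\<mu>\<in>K_set X Y p \<alpha>. ergodic \<mu>)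
    \<and> K_set X Y p \<alpha> = equilibrium_states X (\<lambda>x. - (\<alpha> / (\<alpha> + 1)) * F (p x))
    \<and> (\<forall>\<mu>. \<mu> \<in> K_set X Y p \<alpha> \<longleftrightarrow>
          push Y p \<mu> \<in> equilibrium_states Y (\<lambda>y. 1 / (\<alpha> + 1) * F y)
          \<and> max_relative_entropy X Y p \<mu> (push Y p \<mu>))"
proof -
  interpret factor k l X Y p by unfold_locales fact+
  \<comment> \<open>Here the selection \<open>D\<close> disappears: only the number of fibre words
    remains.\<close>
  have F: "F y = fibre_entropy y" if "y \<in> Y" for y
    using fibre_growth_eq[OF assms(6) that] assms(7)[OF that] that by simp
  obtain M0 where M0: "M0 \<in> invariant_measures X" "ergodic M0"
    and max: "\<And>N. N \<in> invariant_measures X \<Longrightarrow> weighted_entropy \<alpha> N \<le> weighted_entropy \<alpha> M0"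
    by (rule exists_ergodic_maximizer[of \<alpha>]) (use \<open>\<alpha> > 0\<close> in auto)
  note facts = SUP_weighted_entropy[OF \<open>\<alpha> > 0\<close> M0(1) max] SUP_factor_pressure[OF \<open>\<alpha> > 0\<close> M0(1) max]
    SUP_lifted_pressure[OF \<open>\<alpha> > 0\<close> M0(1) max]
  have "(SUP m\<in>invariant_measures Y. h m + ereal (1 / (\<alpha> + 1) * (\<integral>y. F y \<partial>m)))
      = (SUP m\<in>invariant_measures Y. h m + ereal (1 / (\<alpha> + 1) * (\<integral>y. fibre_entropy y \<partial>m)))"
    using Y.integral_cong_on[of _ F fibre_entropy] F by (intro SUP_cong refl) simp
  then have sup_Y: "(SUP m\<in>invariant_measures Y. h m + ereal (1 / (\<alpha> + 1) * (\<integral>y. F y \<partial>m)))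
      = ereal (weighted_entropy \<alpha> M0 / (\<alpha> + 1))" using facts(2) by simp
  have "(SUP \<mu>\<in>invariant_measures X. h \<mu> - ereal (\<alpha> / (\<alpha> + 1) * (\<integral>x. F (p x) \<partial>\<mu>)))
      = (SUP \<mu>\<in>invariant_measures X. h \<mu> - ereal (\<alpha> / (\<alpha> + 1) * (\<integral>x. fibre_entropy (p x) \<partial>\<mu>)))"
    using X.integral_cong_on[of _ "\<lambda>x. F (p x)" "\<lambda>x. fibre_entropy (p x)"] F p_in by (intro SUP_cong refl) simp
  then have sup_X: "(SUP \<mu>\<in>invariant_measures X. h \<mu> - ereal (\<alpha> / (\<alpha> + 1) * (\<integral>x. F (p x) \<partial>\<mu>)))
      = ereal (weighted_entropy \<alpha> M0 / (\<alpha> + 1))" using facts(3) by simp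
  have "F \<in> borel_measurable (borel_on Y)"
    using fibre_entropy_measurable by (subst measurable_cong[of _ F fibre_entropy]) (simp_all add: F)
  moreover have "bounded (F ` Y)"
    unfolding bounded_iff using fibre_entropy_facts(1,2) F by (intro exI[of _ "ln (real k)"]) auto
  moreover have "M0 \<in> K_set X Y p \<alpha>"
    using K_set_iff[OF \<open>\<alpha> > 0\<close> M0(1) max] M0(1) by simp
  moreover have "equilibrium_states X (\<lambda>x. - (\<alpha> / (\<alpha> + 1)) * F (p x))
      = equilibrium_states X (\<lambda>x. - (\<alpha> / (\<alpha> + 1)) * fibre_entropy (p x))"
    using F p_in by (intro X.equilibrium_states_cong) simp
  moreover have "equilibrium_states Y (\<lambda>y. 1 / (\<alpha> + 1) * F y)
      = equilibrium_states Y (\<lambda>y. 1 / (\<alpha> + 1) * fibre_entropy y)"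
    using F by (intro Y.equilibrium_states_cong) simp
  moreover have "ereal (\<alpha> + 1) * ereal (weighted_entropy \<alpha> M0 / (\<alpha> + 1)) = ereal (weighted_entropy \<alpha> M0)"
    using \<open>\<alpha> > 0\<close> by simp
  ultimately show ?thesis
    using facts(1) sup_Y sup_X M0(2) K_set_eq_equilibrium_states[OF \<open>\<alpha> > 0\<close> M0(1) max]
      K_set_iff_factor[OF \<open>\<alpha> > 0\<close> M0(1) max]
    by metis
qed

end
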